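(* Let $q$ be a fixed odd prime power. Assume the following hypothesis (the one-over-one ratios conjecture): for all constants $c,C,\varepsilon>0$, as $g\to\infty$, $$\sum_{D\in\mathcal H_{2g+1,q}}\frac{L(\frac12+\alpha,\chi_D)}{L(\frac12+\gamma,\chi_D)}=\sum_{D\in\mathcal H_{2g+1,q}}\left(\frac{\zeta_A(1+2\alpha)}{\zeta_A(1+\alpha+\gamma)}A_D(\alpha;\gamma)+|D|^{-\alpha}X(\tfrac12+\alpha)\frac{\zeta_A(1-2\alpha)}{\zeta_A(1-\alpha+\gamma)}A_D(-\alpha;\gamma)\right)+o(|D|),$$ uniformly for $-\frac14<\Re(\alpha)<\frac14$, $\frac{c}{\log|D|}\le\Re(\gamma)<\frac14$ and $|\Im(\alpha)|,|\Im(\gamma)|\le C|D|^{1-\varepsilon}$. Let $f:\mathbb C\to\mathbb C$ be a fixed (independent of $g$) even holomorphic function that is periodic with period $2\pi/\log q$. For $D\in\mathcal H_{2g+1,q}$ let $\gamma_D$ run over the ordinates of the zeros $\frac12+i\gamma_D$ of $L(s,\chi_D)$, counted with multiplicity, with $\gamma_D$ in one period $(-\pi/\log q,\pi/\log q]$. Then, as $g\to\infty$, $$\sum_{D\in\mathcal H_{2g+1,q}}\sum_{\gamma_D}f(\gamma_D)=\frac1{2\pi}\int_{-\pi/\log q}^{\pi/\log q}f(t)\sum_{D\in\mathcal H_{2g+1,q}}\Bigg(\log|D|-\frac{X'}{X}(\tfrac12-it)+2\Big(\frac{\zeta_A'(1+2it)}{\zeta_A(1+2it)}+A_D'(it;it)-(\log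 q)|D|^{-it}X(\tfrac12+it)\zeta_A(1-2it)A_D(-it;it)\Big)\Bigg)dt+o(|D|).$$
   Context: $A=\mathbb F_q[x]$; for nonzero $f\in A$, $|f|=q^{\deg f}$; $P$ always denotes a monic irreducible polynomial. $\mathcal H_{2g+1,q}$ is the set of monic square-free polynomials of degree $2g+1$ in $\mathbb F_q[x]$, so $|D|=q^{2g+1}$ for every $D$ in it. $\zeta_A(s)=\sum_{f\text{ monic}}|f|^{-s}=1/(1-q^{1-s})$ (meromorphically continued to $\mathbb C$). For $D\in\mathcal H_{2g+1,q}$, $\chi_D(f)=\left(\frac Df\right)$ is the quadratic character: it is completely multiplicative on monic $f$, and $\chi_D(P)=0$ if $P\mid D$, $1$ if $P\nmid D$ and $D$ is a square modulo $P$, and $-1$ otherwise. $L(s,\chi_D)=\sum_{f\text{ monic}}\chi_D(f)|f|^{-s}$; it is a polynomial of degree $2g$ in $q^{-s}$, hence entire and $2\pi i/\log q$-periodic, all its zeros lie on $\Re(s)=\frac12$ (Weil), and it satisfies $L(s,\chi_D)=\mathcal X_D(s)L(1-s,\chi_D)$ with $\mathcal X_D(s)=|D|^{1/2-s}X(s)=q^{g(1-2s)}$, where $X(s)=q^{-1/2+s}$. $L(s,\chi_D)$ is associated with the hyperelliptic curve $y^2=D(x)$. $$A_D(\alpha;\gamma)=\prod_{P}\left(1-\frac1{|P|^{1+\alpha+\gamma}}\right)^{-1}\left(1-\frac1{(|P|+1)|P|^{1+2\alpha}}-\frac1{(|P|+1)|P|^{\alpha+\gamma}}\right),$$ which does not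 depend on $D$. $A_D'(r;r)$ denotes $\frac{\partial}{\partial\alpha}A_D(\alpha;\gamma)\big|_{\alpha=\gamma=r}=\sum_P\frac{\log|P|}{(|P|^{1+2r}-1)(|P|+1)}$. Expressions with removable singularities (in $\alpha$ in the hypothesis, and in $t$ in the integrand) are interpreted by continuity. $\log$ is the natural logarithm. *)

theory Defs
  imports
    "HOL-Complex_Analysis.Complex_Analysis"
    "HOL-Computational_Algebra.Computational_Algebra"
    "HOL-Library.Landau_Symbols"
begin

text \<open>
  The field with \<open>q\<close> elements is a type \<open>'a\<close> with \<open>CARD('a) = q\<close>. The class \<open>field_gcd\<close> adds to
  \<open>field\<close> only the trivial division and gcd operations that every field carries; the library
  needs them for unique factorisation in \<open>'a poly\<close>, where normalised means monic.
\<close>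

definition monics :: "nat \<Rightarrow> 'a::{finite,field_gcd} poly set" where
  "monics n = {f. lead_coeff f = 1 \<and> degree f = n}"

definition monic_irreds :: "nat \<Rightarrow> 'a::{finite,field_gcd} poly set" where
  "monic_irreds n = {P. lead_coeff P = 1 \<and> irreducible P \<and> degree P = n}"

text \<open>Only used for nonzero polynomials.\<close>
definition pnorm :: "'a::{finite,field_gcd} poly \<Rightarrow> real" where
  "pnorm f = real CARD('a) ^ degree f"

definition hyp_family :: "nat \<Rightarrow> 'a::{finite,field_gcd} poly set" where
  "hyp_family g = {D. lead_coeff D = 1 \<and> squarefree D \<and> degree D = 2 * g + 1}"

definition legendre_poly :: "'a::{finite,field_gcd} poly \<Rightarrow> 'a poly \<Rightarrow> int" where
  "legendre_poly D P = (if P dvd D then 0 else if \<exists>h. P dvd h ^ 2 - D then 1 else - 1)"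

definition chi :: "'a::{finite,field_gcd} poly \<Rightarrow> 'a poly \<Rightarrow> int" where
  "chi D f = (\<Prod>P\<in>#prime_factorization f. legendre_poly D P)"

text \<open>
  The terms are grouped by degree. For \<open>D\<close> in the family the inner sum vanishes for
  \<open>n > 2 * g\<close>, so the series is a finite sum and represents the \<open>L\<close>-function on the whole plane.
\<close>
definition Lfun :: "'a::{finite,field_gcd} poly \<Rightarrow> complex \<Rightarrow> complex" where
  "Lfun D s = (\<Sum>n. \<Sum>f\<in>monics n. of_int (chi D f) * of_real (pnorm f) powr (- s))"

definition zeta_A :: "nat \<Rightarrow> complex \<Rightarrow> complex" where
  "zeta_A q s = 1 / (1 - of_nat q powr (1 - s))"

definition X_fun :: "nat \<Rightarrow> complex \<Rightarrow> complex" where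
  "X_fun q s = of_nat q powr (- 1 / 2 + s)"

definition A_factor :: "complex \<Rightarrow> complex \<Rightarrow> 'a::{finite,field_gcd} poly \<Rightarrow> complex" where
  "A_factor \<alpha> \<gamma> P = (let N = complex_of_real (pnorm P) in
     inverse (1 - 1 / N powr (1 + \<alpha> + \<gamma>)) *
     (1 - 1 / ((N + 1) * N powr (1 + 2 * \<alpha>)) - 1 / ((N + 1) * N powr (\<alpha> + \<gamma>))))"

definition A_prod :: "'a::{finite,field_gcd} itself \<Rightarrow> complex \<Rightarrow> complex \<Rightarrow> complex" where
  "A_prod _ \<alpha> \<gamma> = (\<Prod>n. \<Prod>P\<in>(monic_irreds n :: 'a poly set). A_factor \<alpha> \<gamma> P)"

text \<open>The derivative is in the first variable only.\<close>
definition A_prod' :: "'a::{finite,field_gcd} itself \<Rightarrow> complex \<Rightarrow> complex" where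
  "A_prod' T r = deriv (\<lambda>\<alpha>. A_prod T \<alpha> r) r"

text \<open>
  \<open>remove_sings\<close> gives the values at the removable singularities \<open>q powr (2 * \<alpha>) = 1\<close>.
\<close>
definition ratios_main :: "'a::{finite,field_gcd} poly \<Rightarrow> complex \<Rightarrow> complex \<Rightarrow> complex" where
  "ratios_main D \<alpha> \<gamma> = remove_sings (\<lambda>a. let \<zeta> = zeta_A CARD('a) in
       \<zeta> (1 + 2 * a) / \<zeta> (1 + a + \<gamma>) * A_prod TYPE('a) a \<gamma>
       + of_real (pnorm D) powr (- a) * X_fun CARD('a) (1 / 2 + a)
         * (\<zeta> (1 - 2 * a) / \<zeta> (1 - a + \<gamma>)) * A_prod TYPE('a) (- a) \<gamma>) \<alpha>"

text \<open>
  As a function of complex \<open>z\<close>, so that \<open>remove_sings\<close> applies; it is used for real \<open>z\<close> only.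
\<close>
definition zero_density :: "'a::{finite,field_gcd} poly \<Rightarrow> complex \<Rightarrow> complex" where
  "zero_density D t = remove_sings (\<lambda>z. let q = CARD('a); \<zeta> = zeta_A q; X = X_fun q in
       of_real (ln (pnorm D)) - deriv X (1 / 2 - \<i> * z) / X (1 / 2 - \<i> * z)
       + 2 * (deriv \<zeta> (1 + 2 * \<i> * z) / \<zeta> (1 + 2 * \<i> * z)
              + A_prod' TYPE('a) (\<i> * z)
              - of_real (ln (real q)) * of_real (pnorm D) powr (- (\<i> * z)) * X (1 / 2 + \<i> * z)
                * \<zeta> (1 - 2 * \<i> * z) * A_prod TYPE('a) (- (\<i> * z)) (\<i> * z))) t"

text \<open>
  All zeros \<open>1/2 + \<i> * \<gamma>\<close> in one period; \<open>\<gamma>\<close> is not required to be real here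
  (that it is real is the Riemann hypothesis for these \<open>L\<close>-functions), so no zero is left out.
\<close>
definition ordinates :: "'a::{finite,field_gcd} poly \<Rightarrow> complex set" where
  "ordinates D = {\<gamma>. Lfun D (1 / 2 + \<i> * \<gamma>) = 0 \<and>
     - pi / ln (real CARD('a)) < Re \<gamma> \<and> Re \<gamma> \<le> pi / ln (real CARD('a))}"

text \<open>The series behind the closed form of \<open>zeta_A\<close>.\<close>

lemma monics_Suc:
  "(monics (Suc n) :: 'a::{finite,field_gcd} poly set) = (\<lambda>(a, f). pCons a f) ` (UNIV \<times> monics n)"
proof (intro set_eqI iffI)
  fix p :: "'a poly" assume p: "p \<in> monics (Suc n)"
  obtain a f where [simp]: "p = pCons a f" by (cases p)
  from p have "f \<in> monics n" by (auto simp: monics_def split: if_splits)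
  then show "p \<in> (\<lambda>(a, f). pCons a f) ` (UNIV \<times> monics n)" by force
next
  fix p :: "'a poly" assume "p \<in> (\<lambda>(a, f). pCons a f) ` (UNIV \<times> monics n)"
  then show "p \<in> monics (Suc n)" by (auto simp: monics_def)
qed

lemma monics_0: "(monics 0 :: 'a::{finite,field_gcd} poly set) = {1}"
  by (auto simp: monics_def elim!: degree_eq_zeroE)

lemma card_monics: "card (monics n :: 'a::{finite,field_gcd} poly set) = CARD('a) ^ n"
proof (induction n)
  case 0
  show ?case by (simp add: monics_0)
next
  case (Suc n)
  have "inj_on (\<lambda>(a, f). pCons a f) (UNIV \<times> (monics n :: 'a poly set))"
    by (auto simp: inj_on_def)
  then show ?case using Suc by (simp add: monics_Suc card_image card_cartesian_product)
qed

lemma zeta_A_sums: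
  assumes "Re s > 1"
  shows "(\<lambda>n. \<Sum>f\<in>(monics n :: 'a::{finite,field_gcd} poly set). of_real (pnorm f) powr (- s))
           sums zeta_A CARD('a) s"
proof -
  let ?q = "of_nat CARD('a) :: complex"
  have "CARD('a) \<ge> card {0, 1 :: 'a}"
    by (rule card_mono) auto
  then have q: "real CARD('a) > 1" by simp
  have "norm (?q powr (1 - s)) = real CARD('a) powr (1 - Re s)"
    using q norm_powr_real_powr[of ?q "1 - s"] by simp
  also have "\<dots> < 1"
    using q assms by (simp add: powr_less_one)
  finally have "(\<lambda>n. (?q powr (1 - s)) ^ n) sums zeta_A CARD('a) s"
    unfolding zeta_A_def by (rule geometric_sums)
  moreover have "(\<Sum>f\<in>(monics n :: 'a poly set). of_real (pnorm f) powr (- s)) = (?q powr (1 - s)) ^ n"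
    for n
  proof -
    have "(\<Sum>f\<in>(monics n :: 'a poly set). complex_of_real (pnorm f) powr (- s))
            = (\<Sum>f\<in>(monics n :: 'a poly set). (?q ^ n) powr (- s))"
      by (rule sum.cong) (auto simp: monics_def pnorm_def)
    also have "\<dots> = ?q ^ n * (?q ^ n) powr (- s)"
      by (simp add: card_monics)
    also have "(?q ^ n) powr (- s) = (?q powr (- s)) ^ n"
    proof (induction n)
      case (Suc n)
      have "(?q ^ Suc n) powr (- s)
              = (of_real (real CARD('a)) * of_real (real CARD('a) ^ n)) powr (- s)"
        by simp
      also have "\<dots> = of_real (real CARD('a)) powr (- s) * of_real (real CARD('a) ^ n) powr (- s)"
        by (rule powr_times_real) auto
      finally show ?case using Suc by simp
    qed simp
    also have "?q ^ n * (?q powr (- s)) ^ n = (?q powr (1 - s)) ^ n"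
      using q by (simp add: powr_diff powr_minus power_divide field_simps flip: power_mult_distrib)
    finally show ?thesis .
  qed
  ultimately show ?thesis by simp
qed

end

theory Submission
  imports Defs
begin

text \<open>
  Let \<open>L = ln q\<close>. An even entire function of period \<open>2 * pi / L\<close> is an everywhere convergent power
  series in \<open>cos (L * z)\<close>, so by dominated convergence it suffices to compare the two sides for
  \<open>cos (k * L * z)\<close> with \<open>k\<close> fixed. The logarithmic derivative of the polynomial \<open>L(s, \<chi>\<^sub>D)\<close> and its
  functional equation (proved from quadratic reciprocity) turn the sum over the zeros into
  \<open>- q powr (- k / 2)\<close> times a sum of values \<open>\<chi>\<^sub>D(P ^ m)\<close> over prime powers of degree \<open>k\<close>. Summed over
  square-free \<open>D\<close>, the odd powers contribute a bounded amount and the even powers count the \<open>D\<close> prime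
  to \<open>P\<close>. On the other side \<open>A\<^sub>D(-r; r)\<close> equals \<open>(1 - q ^ (2 * r - 1)) / (1 - 1 / q)\<close>, so that the
  density is a power series in \<open>q ^ (- 2 * i * t)\<close>; for \<open>g > k\<close> its Fourier coefficient is the same average.
\<close>

section \<open>Residues modulo a polynomial\<close>

text \<open>Both sides grow like g |D|, so the comparison must be exact in the growing part. That
  part sits in the constant Fourier coefficient: there are 2g zeros per period, and log|D| - X'/X is
  exactly 2g log q. For the other coefficients put v = q^(-2it). The poles at v = 1 of
  zeta_A'/zeta_A and of the term with |D|^(-it) cancel; what remains is the finite sum -(v + ... +
  v^(g-1)) and a boundary term in v^g, which a fixed frequency no longer meets for large g. So v^j
  has coefficient c_j - 1, up to the factor 2 log q, where c_j comes from A_D' and carries the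
  weights 1/(|P|+1). The zeros give the same number because a square-free D is prime to P with
  density |P|/(|P|+1) = 1 - 1/(|P|+1). Bounds at frequency k lose a factor q^k, which is affordable
  because the coefficients of the power series in the cosine are summable against every geometric
  sequence. For the functional equation the Gauss sums are kept integer valued: the quadratic
  character of the constant field stands in for an additive character. This works since the degree
  of D is odd, which makes the residue symbol modulo D nontrivial on constants.\<close>

lemma card_field_gt_1: "CARD('a::{finite,field_gcd}) > 1"
proof -
  have "CARD('a) \<ge> card {0, 1 :: 'a}"
    by (rule card_mono) auto
  then show ?thesis by simp
qed

definition polys_lt :: "nat \<Rightarrow> 'a::{finite,field_gcd} poly set" where
  "polys_lt n = {f. f = 0 \<or> degree f < n}"

definition monics_lt :: "nat \<Rightarrow> 'a::{finite,field_gcd} poly set" where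
  "monics_lt n = {k. lead_coeff k = 1 \<and> degree k < n}"

lemma finite_monics [simp]: "finite (monics n :: 'a::{finite,field_gcd} poly set)"
  by (rule card_ge_0_finite) (simp add: card_monics)

lemma monics_lt_Un: "monics_lt n = (\<Union>i<n. monics i)"
  by (auto simp: monics_lt_def monics_def)

lemma finite_monics_lt [simp]: "finite (monics_lt n :: 'a::{finite,field_gcd} poly set)"
  by (simp add: monics_lt_Un)

lemma card_monics_lt:
  "card (monics_lt n :: 'a::{finite,field_gcd} poly set) = (\<Sum>i<n. CARD('a) ^ i)"
proof -
  have "card (\<Union>i<n. monics i :: 'a poly set) = (\<Sum>i<n. card (monics i :: 'a poly set))"
    by (rule card_UN_disjoint) (simp, simp, auto simp: monics_def)
  then show ?thesis by (simp add: monics_lt_Un card_monics)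
qed

lemma even_card_monics_lt:
  assumes "odd CARD('a)"
  shows "even (card (monics_lt n :: 'a::{finite,field_gcd} poly set)) \<longleftrightarrow> even n"
  unfolding card_monics_lt using assms by (induction n) auto

lemma monics_lt_Suc: "monics_lt (Suc n) = monics_lt n \<union> monics n"
  by (auto simp: monics_lt_def monics_def)

lemma polys_ltI: "degree p \<le> n \<Longrightarrow> coeff p n = 0 \<Longrightarrow> p \<in> polys_lt n"
  by (cases "degree p = n") (auto simp: polys_lt_def)

lemma bij_betw_polys_lt_monics:
  "bij_betw (\<lambda>f. f + monom 1 n) (polys_lt n) (monics n :: 'a::{finite,field_gcd} poly set)"
proof (rule bij_betw_byWitness[where f' = "\<lambda>f. f - monom 1 n"])
  show "(\<lambda>f. f + monom 1 n) ` polys_lt n \<subseteq> (monics n :: 'a poly set)"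
  proof safe
    fix f :: "'a poly" assume "f \<in> polys_lt n"
    then have "f = 0 \<or> degree f < n" by (auto simp: polys_lt_def)
    then have "degree (f + monom 1 n) = n"
      by (metis add_0 degree_add_eq_right degree_monom_eq zero_neq_one)
    moreover have "coeff f n = 0" using \<open>f = 0 \<or> degree f < n\<close> by (auto simp: coeff_eq_0)
    ultimately show "f + monom 1 n \<in> monics n" by (simp add: monics_def)
  qed
  show "(\<lambda>f. f - monom 1 n) ` monics n \<subseteq> (polys_lt n :: 'a poly set)"
  proof safe
    fix f :: "'a poly" assume f: "f \<in> monics n"
    have "degree (f - monom 1 n) \<le> n"
      using f by (auto intro!: degree_diff_le degree_monom_le simp: monics_def)
    moreover have "coeff (f - monom 1 n) n = 0" using f by (auto simp: monics_def)
    ultimately show "f - monom 1 n \<in> polys_lt n"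
      by (rule polys_ltI)
  qed
qed auto

lemma finite_polys_lt [simp]: "finite (polys_lt n :: 'a::{finite,field_gcd} poly set)"
  using bij_betw_finite[OF bij_betw_polys_lt_monics] by simp

lemma card_polys_lt: "card (polys_lt n :: 'a::{finite,field_gcd} poly set) = CARD('a) ^ n"
  using bij_betw_same_card[OF bij_betw_polys_lt_monics] by (simp add: card_monics)

text \<open>The monic polynomials represent the nonzero residues up to constants; they are the
  analogue of the half system 1, ..., (p-1)/2 in Gauss's lemma.\<close>

lemma bij_betw_smult_monics_lt:
  "bij_betw (\<lambda>(c, k). smult c k) ((UNIV - {0}) \<times> monics_lt n) (polys_lt n - {0 :: 'a::{finite,field_gcd} poly})"
  by (rule bij_betw_byWitness[where f' = "\<lambda>f. (lead_coeff f, smult (inverse (lead_coeff f)) f)"])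
     (auto simp: polys_lt_def monics_lt_def)

section \<open>Gauss's lemma with the monic polynomials as representatives\<close>

definition monic_part :: "'a::{finite,field_gcd} poly \<Rightarrow> 'a poly" where
  "monic_part f = smult (inverse (lead_coeff f)) f"

lemma smult_monic_part: "f \<noteq> 0 \<Longrightarrow> smult (lead_coeff f) (monic_part f) = f"
  by (simp add: monic_part_def)

text \<open>
  Multiplication by \<open>g\<close> permutes the nonzero residues modulo \<open>f\<close> up to constants; \<open>gauss_sym f g\<close>
  collects these constants, as in Gauss's lemma.
\<close>

definition gauss_sym :: "'a::{finite,field_gcd} poly \<Rightarrow> 'a poly \<Rightarrow> 'a" where
  "gauss_sym f g = (\<Prod>k\<in>monics_lt (degree f). lead_coeff (g * k mod f))"

lemma mult_mod_nonzero:
  fixes f g k :: "'a::{finite,field_gcd} poly"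
  assumes "coprime f g" "k \<in> monics_lt (degree f)"
  shows "g * k mod f \<noteq> 0"
proof
  assume "g * k mod f = 0"
  then have "f dvd g * k" by auto
  then have "f dvd k" using assms coprime_dvd_mult_right_iff by blast
  then show False using assms(2) by (auto simp: monics_lt_def dest: dvd_imp_degree_le)
qed

lemma degree_mod_lt: "f \<noteq> 0 \<Longrightarrow> g mod f \<in> polys_lt (degree f)"
  for f g :: "'a::{finite,field_gcd} poly"
  using degree_mod_less[of f g] by (auto simp: polys_lt_def)

lemma polys_lt_dvd_imp_zero: "f dvd h \<Longrightarrow> h \<in> polys_lt (degree f) \<Longrightarrow> h = 0"
  by (auto simp: polys_lt_def dest: dvd_imp_degree_le)

text \<open>If k and k' have proportional images with constants c and c', then f divides g (c' k - c
  k'), hence c' k - c k', whose degree is below that of f. Leading coefficients of c' k = c k' then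
  give c = c' and k = k'.\<close>

lemma bij_betw_gauss:
  fixes f g :: "'a::{finite,field_gcd} poly"
  assumes "coprime f g"
  shows "bij_betw (\<lambda>k. monic_part (g * k mod f)) (monics_lt (degree f)) (monics_lt (degree f))"
proof (cases "degree f = 0")
  case True
  then show ?thesis by (simp add: monics_lt_def bij_betw_def)
next
  case False
  then have f0: "f \<noteq> 0" by auto
  let ?h = "\<lambda>k. monic_part (g * k mod f)"
  have inj: "inj_on ?h (monics_lt (degree f))"
  proof (rule inj_onI)
    fix k k' assume k: "k \<in> monics_lt (degree f)" "k' \<in> monics_lt (degree f)" "?h k = ?h k'"
    let ?c = "lead_coeff (g * k mod f)" and ?c' = "lead_coeff (g * k' mod f)"
    have nz: "g * k mod f \<noteq> 0" "g * k' mod f \<noteq> 0"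
      using mult_mod_nonzero[OF assms k(1)] mult_mod_nonzero[OF assms k(2)] by auto
    then have "?c \<noteq> 0" by simp
    have "smult ?c' (g * k mod f) = smult ?c' (smult ?c (monic_part (g * k mod f)))"
      by (simp only: smult_monic_part[OF nz(1)])
    also have "\<dots> = smult ?c (smult ?c' (monic_part (g * k' mod f)))"
      by (simp only: k(3) smult_smult mult.commute)
    also have "\<dots> = smult ?c (g * k' mod f)"
      by (simp only: smult_monic_part[OF nz(2)])
    finally have "smult ?c' (g * k mod f) = smult ?c (g * k' mod f)" .
    then have "(smult ?c' (g * k) - smult ?c (g * k')) mod f = 0"
      by (simp add: poly_mod_diff_left mod_smult_left)
    then have "f dvd g * (smult ?c' k - smult ?c k')"
      by (auto simp: algebra_simps)
    then have "f dvd smult ?c' k - smult ?c k'"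
      using assms coprime_dvd_mult_right_iff by blast
    moreover have "degree (smult ?c' k - smult ?c k') < degree f"
      using k by (intro degree_diff_less) (auto simp: monics_lt_def intro: le_less_trans[OF degree_smult_le])
    ultimately have "smult ?c' k = smult ?c k'"
      using polys_lt_dvd_imp_zero[of f "smult ?c' k - smult ?c k'"] by (simp add: polys_lt_def)
    moreover have "?c' * lead_coeff k = ?c * lead_coeff k'"
      using arg_cong[OF calculation, of lead_coeff] by (simp only: lead_coeff_smult)
    then have "?c' = ?c" using k(1,2) by (simp only: monics_lt_def mem_Collect_eq mult_1_right)
    ultimately show "k = k'" using \<open>?c \<noteq> 0\<close> by (metis smult_eq_iff)
  qed
  have "?h ` monics_lt (degree f) \<subseteq> monics_lt (degree f)"
  proof safe
    fix k :: "'a poly" assume k: "k \<in> monics_lt (degree f)"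
    then show "?h k \<in> monics_lt (degree f)"
      using mult_mod_nonzero[OF assms k] degree_mod_less'[of f "g * k"] f0
      by (auto simp: monics_lt_def monic_part_def)
  qed
  then show ?thesis using inj endo_inj_surj[of "monics_lt (degree f)" ?h]
    by (simp add: bij_betw_def)
qed

lemma gauss_sym_mod: "gauss_sym f (g mod f) = gauss_sym f g"
  by (simp add: gauss_sym_def mod_mult_left_eq)

lemma gauss_sym_nonzero: "coprime f g \<Longrightarrow> gauss_sym f g \<noteq> 0"
  unfolding gauss_sym_def by (auto dest: mult_mod_nonzero)

text \<open>Multiplication by h sends k to a constant times another monic representative. The
  constants multiply to the symbol of h, and the representatives are merely permuted before g acts
  on them.\<close>

lemma gauss_sym_mult:
  fixes f g h :: "'a::{finite,field_gcd} poly"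
  assumes "coprime f h"
  shows "gauss_sym f (g * h) = gauss_sym f g * gauss_sym f h"
proof -
  let ?m = "\<lambda>k. monic_part (h * k mod f)" and ?M = "monics_lt (degree f)"
  have "lead_coeff (g * h * k mod f) = lead_coeff (h * k mod f) * lead_coeff (g * ?m k mod f)"
    if "k \<in> ?M" for k
  proof -
    have "g * h * k mod f = g * (h * k mod f) mod f"
      by (simp add: mod_mult_right_eq mult.assoc)
    also have "h * k mod f = smult (lead_coeff (h * k mod f)) (?m k)"
      using smult_monic_part mult_mod_nonzero[OF assms that] by metis
    finally show ?thesis by (simp add: mod_smult_left)
  qed
  then have "gauss_sym f (g * h) = gauss_sym f h * (\<Prod>k\<in>?M. lead_coeff (g * ?m k mod f))"
    unfolding gauss_sym_def by (simp add: prod.distrib)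
  also have "(\<Prod>k\<in>?M. lead_coeff (g * ?m k mod f)) = gauss_sym f g"
    unfolding gauss_sym_def by (rule prod.reindex_bij_betw[OF bij_betw_gauss[OF assms]])
  finally show ?thesis by simp
qed

lemma gauss_sym_1 [simp]: "gauss_sym f 1 = 1"
proof -
  have "lead_coeff (k mod f) = 1" if "k \<in> monics_lt (degree f)" for k
    using that by (simp add: monics_lt_def mod_poly_less)
  then show ?thesis unfolding gauss_sym_def by simp
qed

lemma gauss_sym_const:
  fixes c :: "'a::{finite,field_gcd}"
  shows "gauss_sym f [:c:] = c ^ card (monics_lt (degree f) :: 'a poly set)"
proof -
  have "lead_coeff ([:c:] * k mod f) = c" if "k \<in> monics_lt (degree f)" for k
    using that by (simp add: monics_lt_def mod_poly_less mod_smult_left)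
  then show ?thesis unfolding gauss_sym_def by simp
qed

text \<open>The product of all g k is evaluated in two ways modulo f, and the product of the monic
  representatives is cancelled. Their number is (q^n - 1)/(q - 1) with n the degree of f, so raising
  the result to the power (q - 1)/2 yields Euler's criterion.\<close>

lemma gauss_lemma:
  fixes f g :: "'a::{finite,field_gcd} poly"
  assumes "irreducible f" "coprime f g"
  shows "f dvd g ^ card (monics_lt (degree f) :: 'a poly set) - [:gauss_sym f g:]"
proof -
  let ?M = "monics_lt (degree f) :: 'a poly set"
  let ?c = "\<lambda>k. lead_coeff (g * k mod f)" and ?m = "\<lambda>k. monic_part (g * k mod f)"
  have "(\<Prod>k\<in>?M. g * k) mod f = (\<Prod>k\<in>?M. g * k mod f) mod f"
    by (simp add: mod_prod_eq)
  also have "(\<Prod>k\<in>?M. g * k mod f) = (\<Prod>k\<in>?M. [:?c k:] * ?m k)"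
    by (rule prod.cong) (auto simp: smult_monic_part mult_mod_nonzero[OF assms(2)])
  also have "\<dots> = (\<Prod>k\<in>?M. [:?c k:]) * (\<Prod>k\<in>?M. ?m k)"
    by (rule prod.distrib)
  also have "(\<Prod>k\<in>?M. ?m k) = \<Prod>?M"
    by (rule prod.reindex_bij_betw[OF bij_betw_gauss[OF assms(2)], of "\<lambda>x. x"])
  also have "(\<Prod>k\<in>?M. [:?c k:]) = [:gauss_sym f g:]"
    unfolding gauss_sym_def by (induction rule: infinite_finite_induct) (auto simp: one_pCons)
  finally have "f dvd (\<Prod>k\<in>?M. g * k) - [:gauss_sym f g:] * \<Prod>?M"
    by (simp add: mod_eq_dvd_iff)
  also have "(\<Prod>k\<in>?M. g * k) - [:gauss_sym f g:] * \<Prod>?M = (g ^ card ?M - [:gauss_sym f g:]) * \<Prod>?M"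
    by (simp add: prod.distrib algebra_simps)
  finally have "f dvd (g ^ card ?M - [:gauss_sym f g:]) * \<Prod>?M" .
  moreover have pe: "prime_elem f" using assms(1) by (simp add: irreducible_imp_prime_elem_gcd)
  then have "prime (normalize f)" by simp
  moreover have "\<not> f dvd \<Prod>?M"
  proof
    assume "f dvd \<Prod>?M"
    then obtain k where "k \<in> ?M" "f dvd k" 
      using prime_dvd_prod_iff[OF _ \<open>prime (normalize f)\<close>, of ?M "\<lambda>x. x"] by auto
    then show False by (auto simp: monics_lt_def dest: dvd_imp_degree_le)
  qed
  ultimately show ?thesis using prime_elem_dvd_multD[OF pe] by blast
qed

text \<open>Fermat's theorem holds because multiplication by c permutes the units. Hence X^(q-1) - 1
  and the product of all X - c agree: their difference has degree below q - 1 but q - 1 roots. The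
  constant terms give Wilson's theorem.\<close>

lemma prod_units_field:
  assumes "odd CARD('a::{finite,field_gcd})"
  shows "(\<Prod>c\<in>UNIV - {0::'a}. c) = -1"
    and "\<And>c::'a. c \<noteq> 0 \<Longrightarrow> c ^ (CARD('a) - 1) = 1"
proof -
  let ?U = "UNIV - {0::'a}"
  have cardU: "card ?U = CARD('a) - 1" by (simp add: card_Diff_singleton)
  show fer: "c ^ (CARD('a) - 1) = 1" if "c \<noteq> 0" for c :: 'a
  proof -
    have "(\<Prod>x\<in>?U. x) = (\<Prod>x\<in>?U. c * x)"
      by (rule prod.reindex_bij_witness[of _ "\<lambda>x. c * x" "\<lambda>x. x / c"]) (use that in auto)
    also have "\<dots> = c ^ (CARD('a) - 1) * (\<Prod>x\<in>?U. x)" by (simp add: prod.distrib cardU)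
    finally show ?thesis by (simp add: prod_zero_iff)
  qed
  let ?q = "CARD('a) - 1"
  have q: "?q > 0" using card_field_gt_1[where 'a='a] by simp
  define p where "p = (\<Prod>c\<in>?U. [:- c, 1:]) - (monom 1 ?q - 1)"
  have deg1: "degree (\<Prod>c\<in>?U. [:- c, 1:]) = ?q" by (simp add: degree_prod_sum_eq cardU)
  have lc1: "lead_coeff (\<Prod>c\<in>?U. [:- c, 1:]) = 1" by (simp add: lead_coeff_prod)
  have deg2: "degree (monom 1 ?q - 1 :: 'a poly) = ?q"
    using q degree_add_eq_left[of "- 1 :: 'a poly" "monom 1 ?q"] by (simp add: degree_monom_eq)
  have "p = 0"
  proof (rule ccontr)
    assume p0: "p \<noteq> 0"
    have "degree p \<le> ?q"
      unfolding p_def by (rule degree_diff_le) (simp_all only: deg1 deg2 order.refl)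
    moreover have "coeff p ?q = 0"
      using lc1 deg1 q by (simp only: p_def coeff_diff coeff_monom coeff_1) simp
    ultimately have "p \<in> polys_lt ?q" by (rule polys_ltI)
    then have "degree p < ?q" using p0 by (simp add: polys_lt_def)
    moreover have pz: "(\<Prod>c\<in>?U. x - c) = 0" if "x \<noteq> 0" for x
      by (rule prod_zero) (use that in auto)
    then have "poly p x = 0" if "x \<noteq> 0" for x
      using that by (simp add: p_def poly_prod poly_monom pz fer[unfolded One_nat_def])
    then have "?U \<subseteq> {x. poly p x = 0}" by auto
    then have "?q \<le> card {x. poly p x = 0}" by (metis card_mono cardU finite)
    then have "?q \<le> degree p" using card_poly_roots_bound[OF p0] by linarith
    ultimately show False by simp
  qed
  then have "poly p 0 = 0" by simp
  then have "(\<Prod>c\<in>?U. - c) = -1" using q by (simp add: eq_neg_iff_add_eq_0 p_def poly_prod poly_monom zero_power)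
  moreover have "(\<Prod>c\<in>?U. - c) = (-1) ^ ?q * (\<Prod>c\<in>?U. c)" 
    by (simp only: prod_uminus cardU)
  moreover have "even ?q" using assms by simp
  ultimately show "(\<Prod>c\<in>?U. c) = -1" by simp
qed

section \<open>Quadratic reciprocity\<close>

lemma degree_less_mult_leD:
  fixes g h :: "'a::{finite,field_gcd} poly"
  assumes "g * h \<in> polys_lt a" "g \<noteq> 0"
  shows "h \<in> polys_lt (a - degree g)"
  using assms by (cases "h = 0") (auto simp: polys_lt_def degree_mult_eq)

lemma polys_lt_add: "f \<in> polys_lt n \<Longrightarrow> g \<in> polys_lt n \<Longrightarrow> f + g \<in> polys_lt n"
  by (auto simp: polys_lt_def intro: degree_add_less)

lemma polys_lt_diff: "f \<in> polys_lt n \<Longrightarrow> g \<in> polys_lt n \<Longrightarrow> f - g \<in> polys_lt n"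
  by (auto simp: polys_lt_def intro: degree_diff_less)

lemma polys_lt_mono: "f \<in> polys_lt n \<Longrightarrow> n \<le> m \<Longrightarrow> f \<in> polys_lt m"
  by (auto simp: polys_lt_def)

lemma polys_lt_uminus: "- f \<in> polys_lt n \<longleftrightarrow> f \<in> polys_lt n"
  by (simp add: polys_lt_def)

lemma polys_lt_mult: "f \<in> polys_lt n \<Longrightarrow> degree g + n \<le> m \<Longrightarrow> g * f \<in> polys_lt m"
  for f g :: "'a::{finite,field_gcd} poly"
  by (cases "f = 0 \<or> g = 0") (auto simp: polys_lt_def degree_mult_eq)

lemma monic_add_lower:
  assumes "lead_coeff f = 1" "e \<in> polys_lt (degree f)"
  shows "lead_coeff (f + e) = 1" "degree (f + e) = degree f"
proof -
  show "degree (f + e) = degree f" 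
    using assms by (auto simp: polys_lt_def intro: degree_add_eq_left)
  moreover have "coeff e (degree f) = 0"
    using assms by (auto simp: polys_lt_def coeff_eq_0)
  ultimately show "lead_coeff (f + e) = 1" using assms by simp
qed

text \<open>Every monic polynomial contributes the product of all units, which is -1, and for odd q
  the number of monic polynomials of degree below n has the parity of n.\<close>

lemma prod_lead_coeff_polys_lt:
  assumes "odd CARD('a::{finite,field_gcd})"
  shows "(\<Prod>e\<in>polys_lt n - {0::'a poly}. lead_coeff e) = (-1) ^ n"
proof -
  have "(\<Prod>e\<in>polys_lt n - {0::'a poly}. lead_coeff e) =
      (\<Prod>(c, k)\<in>(UNIV - {0::'a}) \<times> monics_lt n. lead_coeff (smult c k))"
    using prod.reindex_bij_betw[OF bij_betw_smult_monics_lt, of lead_coeff n, symmetric]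
    by (simp only: case_prod_unfold)
  also have "\<dots> = (\<Prod>c\<in>UNIV - {0::'a}. \<Prod>k\<in>(monics_lt n :: 'a poly set). lead_coeff (smult c k))"
    by (simp only: prod.cartesian_product)
  also have "\<dots> = (\<Prod>c\<in>UNIV - {0::'a}. \<Prod>k\<in>(monics_lt n :: 'a poly set). c)"
    by (intro prod.cong refl) (simp add: monics_lt_def lead_coeff_smult)
  also have "\<dots> = (\<Prod>c\<in>UNIV - {0::'a}. c) ^ card (monics_lt n :: 'a poly set)"
    by (simp add: prod_power_distrib)
  also have "\<dots> = (-1) ^ n"
    using even_card_monics_lt[OF assms, of n] by (simp add: prod_units_field[OF assms] minus_one_power_iff)
  finally show ?thesis .
qed

lemma monic_div:
  fixes f g l :: "'a::{finite,field_gcd} poly"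
  assumes "lead_coeff f = 1" "lead_coeff g = 1" "degree g \<le> degree f" "lead_coeff l = 1"
  shows "lead_coeff (f * l div g) = 1" "degree (f * l div g) + degree g = degree f + degree l"
proof -
  have g0: "g \<noteq> 0" and f0: "f \<noteq> 0" and l0: "l \<noteq> 0" using assms by auto
  let ?d = "f * l div g" and ?r = "f * l mod g"
  have dfl: "degree (f * l) = degree f + degree l" using f0 l0 by (simp add: degree_mult_eq)
  have r: "?r \<in> polys_lt (degree g)" using g0 by (rule degree_mod_lt)
  have r': "- ?r \<in> polys_lt (degree (f * l))"
    using r assms(3) dfl by (auto simp: polys_lt_uminus intro: polys_lt_mono)
  have eq: "?d * g = f * l + - ?r" by (simp add: minus_mod_eq_div_mult [symmetric])
  have lc: "lead_coeff (f * l) = 1" using assms by (simp add: lead_coeff_mult)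
  note m = monic_add_lower[OF lc r', folded eq]
  show "lead_coeff ?d = 1" using m(1) assms(2) by (simp add: lead_coeff_mult)
  then have "?d \<noteq> 0" by auto
  then show "degree ?d + degree g = degree f + degree l"
    using m(2) g0 dfl by (simp add: degree_mult_eq)
qed

text \<open>These are the k for which g k has at least the degree of f and is reduced modulo f. The
  quotient l of g k by f determines k up to an error e, since k is close to f l / g. The
  parametrisation exchanges the roles of f and g.\<close>

lemma bij_betw_reciprocity:
  fixes f g :: "'a::{finite,field_gcd} poly"
  assumes f: "lead_coeff f = 1" and g: "lead_coeff g = 1" and le: "degree g \<le> degree f"
  shows "bij_betw (\<lambda>(l, e). f * l div g + e) (monics_lt (degree g) \<times> polys_lt (degree f - degree g))
          {k. lead_coeff k = 1 \<and> degree k < degree f \<and> degree f - degree g \<le> degree k}"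
    (is "bij_betw ?h (?M \<times> ?E) ?K")
  unfolding bij_betw_def
proof
  have g0: "g \<noteq> 0" and f0: "f \<noteq> 0" using f g by auto
  have gh: "g * ?h (l, e) = f * l - f * l mod g + g * e" for l e
    by (simp add: algebra_simps minus_mod_eq_div_mult [symmetric])
  have rlt: "x mod g \<in> polys_lt (degree f)" for x
    using degree_mod_lt[OF g0] le by (blast intro: polys_lt_mono)
  have glt: "e \<in> ?E \<Longrightarrow> g * e \<in> polys_lt (degree f)" for e
    using le by (auto intro: polys_lt_mult)
  show "inj_on ?h (?M \<times> ?E)"
  proof (rule inj_onI, clarify)
    fix l e l' e' assume l: "l \<in> ?M" "l' \<in> ?M" "e \<in> ?E" "e' \<in> ?E"
      and eq: "f * l div g + e = f * l' div g + e'"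
    have "f * l - f * l mod g + g * e = f * l' - f * l' mod g + g * e'"
      using gh[of l e] gh[of l' e'] eq by simp
    then have "f * (l - l') = (f * l mod g - f * l' mod g) + (g * e' - g * e)"
      by (simp add: algebra_simps)
    also have "\<dots> \<in> polys_lt (degree f)"
      using l by (intro polys_lt_add polys_lt_diff rlt glt)
    finally have "f * (l - l') = 0" by (rule polys_lt_dvd_imp_zero[OF dvd_triv_left])
    then have "l = l'" using f0 by simp
    then show "l = l' \<and> e = e'" using eq by simp
  qed
  show "?h ` (?M \<times> ?E) = ?K"
  proof (intro equalityI subsetI)
    fix k assume "k \<in> ?h ` (?M \<times> ?E)"
    then obtain l e where l: "l \<in> ?M" "e \<in> ?E" and k: "k = f * l div g + e" by auto
    have l1: "lead_coeff l = 1" "degree l < degree g" using l by (auto simp: monics_lt_def)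
    note d = monic_div[OF f g le l1(1)]
    have "e \<in> polys_lt (degree (f * l div g))"
      using l(2) d(2) by (auto intro: polys_lt_mono)
    from monic_add_lower[OF d(1) this] d(2) l1(2) show "k \<in> ?K"
      unfolding k by auto
  next
    fix k assume "k \<in> ?K"
    then have k: "lead_coeff k = 1" "degree k < degree f" "degree f - degree g \<le> degree k" by auto
    then have k0: "k \<noteq> 0" by auto
    let ?l = "g * k div f" and ?r = "g * k mod f"
    have r: "?r \<in> polys_lt (degree f)" using f0 by (rule degree_mod_lt)
    have dgk: "degree (g * k) = degree g + degree k" using g0 k0 by (simp add: degree_mult_eq)
    have eq: "f * ?l = g * k + - ?r" by (simp add: minus_mod_eq_mult_div [symmetric])
    have r': "- ?r \<in> polys_lt (degree (g * k))"
      using r k le dgk by (auto simp: polys_lt_uminus intro: polys_lt_mono)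
    have lc: "lead_coeff (g * k) = 1" using g k by (simp add: lead_coeff_mult)
    note m = monic_add_lower[OF lc r', folded eq]
    have l1: "lead_coeff ?l = 1" using m(1) f by (simp add: lead_coeff_mult)
    then have "?l \<noteq> 0" by auto
    then have "degree f + degree ?l = degree g + degree k" using m(2) f0 dgk by (simp add: degree_mult_eq)
    then have "?l \<in> ?M" using l1 k by (simp add: monics_lt_def)
    \<comment> \<open>The error is bounded through g times it, which is a sum of two remainders and
      so has degree below that of f.\<close>
    moreover have "g * (k - f * ?l div g) = ?r + f * ?l mod g"
      using eq by (simp add: algebra_simps minus_mod_eq_mult_div [symmetric])
    then have "g * (k - f * ?l div g) \<in> polys_lt (degree f)"
      using r rlt by (simp only: polys_lt_add)
    then have "k - f * ?l div g \<in> ?E" using g0 by (rule degree_less_mult_leD)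
    ultimately show "k \<in> ?h ` (?M \<times> ?E)" by (force simp: image_iff)
  qed
qed

text \<open>For k of degree below deg f - deg g the product g k is already reduced and monic. For
  the others, with (l, e) as in \<open>bij_betw_reciprocity\<close>, g k reduces to g e - (f l mod
  g). Its leading coefficient is that of e if e is nonzero, and minus that of f l mod g if e = 0. So
  each l contributes its factor in the symbol of f modulo g, and a sign.\<close>

lemma gauss_sym_reciprocity_le:
  fixes f g :: "'a::{finite,field_gcd} poly"
  assumes q: "odd CARD('a)" and f: "lead_coeff f = 1" and g: "lead_coeff g = 1"
    and le: "degree g \<le> degree f" and cop: "coprime f g"
  shows "gauss_sym f g = (-1) ^ (degree f * degree g) * gauss_sym g f"
proof -
  have g0: "g \<noteq> 0" and f0: "f \<noteq> 0" using f g by auto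
  let ?a = "degree f" and ?b = "degree g"
  let ?M = "monics_lt ?b :: 'a poly set" and ?E = "polys_lt (?a - ?b) :: 'a poly set"
  let ?K = "{k :: 'a poly. lead_coeff k = 1 \<and> degree k < ?a \<and> ?a - ?b \<le> degree k}"
  let ?F = "\<lambda>k. lead_coeff (g * k mod f)"
  have fin: "finite ?K" by (rule finite_subset[of _ "monics_lt ?a"], unfold monics_lt_def[of ?a], blast)
      (simp flip: monics_lt_def)
  have "gauss_sym f g = prod ?F (monics_lt (?a - ?b) \<union> ?K)"
    unfolding gauss_sym_def by (rule prod.cong) (auto simp: monics_lt_def)
  also have "\<dots> = prod ?F (monics_lt (?a - ?b)) * prod ?F ?K"
    by (rule prod.union_disjoint) (simp, simp add: fin, auto simp: monics_lt_def)
  also have "prod ?F (monics_lt (?a - ?b)) = 1"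
  proof (rule prod.neutral, safe)
    fix k :: "'a poly" assume k: "k \<in> monics_lt (?a - ?b)"
    then have k0: "k \<noteq> 0" by (auto simp: monics_lt_def)
    have "g * k mod f = g * k"
      using k k0 g0 by (intro mod_poly_less) (auto simp: monics_lt_def degree_mult_eq)
    then show "?F k = 1" using k g by (simp add: monics_lt_def lead_coeff_mult)
  qed
  also have "prod ?F ?K = (\<Prod>(l, e)\<in>?M \<times> ?E. ?F (f * l div g + e))"
    using prod.reindex_bij_betw[OF bij_betw_reciprocity[OF f g le], of ?F]
    by (simp add: case_prod_unfold)
  also have "\<dots> = (\<Prod>l\<in>?M. \<Prod>e\<in>?E. ?F (f * l div g + e))"
    by (simp add: prod.cartesian_product)
  also have "\<dots> = (\<Prod>l\<in>?M. - lead_coeff (f * l mod g) * (\<Prod>e\<in>?E - {0}. lead_coeff e))"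
  proof (rule prod.cong[OF refl])
    fix l assume l: "l \<in> ?M"
    let ?s = "f * l mod g"
    have s: "?s \<in> polys_lt ?b" using g0 by (rule degree_mod_lt)
    have F: "?F (f * l div g + e) = lead_coeff (g * e - ?s)" if "e \<in> ?E" for e
    proof -
      have "g * (f * l div g + e) = f * l + (g * e - ?s)"
        by (simp add: algebra_simps minus_mod_eq_mult_div [symmetric])
      then have "g * (f * l div g + e) mod f = (g * e - ?s) mod f" by simp
      moreover have "g * e - ?s \<in> polys_lt ?a"
        using that s le by (intro polys_lt_diff polys_lt_mult) (auto intro: polys_lt_mono)
      then have "(g * e - ?s) mod f = g * e - ?s"
        by (auto simp: polys_lt_def mod_poly_less)
      ultimately show ?thesis by simp
    qed
    have F': "?F (f * l div g + e) = lead_coeff e" if e: "e \<in> ?E - {0}" for e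
    proof -
      have e0: "e \<noteq> 0" using e by simp
      have "degree (g * e) = ?b + degree e" using e0 g0 by (simp add: degree_mult_eq)
      then have "- ?s \<in> polys_lt (degree (g * e))"
        using s by (auto simp: polys_lt_uminus intro: polys_lt_mono)
      then have "degree (g * e + - ?s) = degree (g * e)" "coeff (- ?s) (degree (g * e)) = 0"
        using e0 g0 degree_add_eq_left[of "- ?s" "g * e"] by (auto simp: polys_lt_def coeff_eq_0)
      then have "lead_coeff (g * e - ?s) = lead_coeff (g * e)" by simp
      then show ?thesis using F[of e] e g by (simp add: lead_coeff_mult)
    qed
    have "0 \<in> ?E" by (simp add: polys_lt_def)
    then have "(\<Prod>e\<in>?E. ?F (f * l div g + e)) = ?F (f * l div g + 0) * (\<Prod>e\<in>?E - {0}. ?F (f * l div g + e))"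
      by (intro prod.remove) auto
    also have "?F (f * l div g + 0) = - lead_coeff ?s" using F[OF \<open>0 \<in> ?E\<close>] by simp
    also have "(\<Prod>e\<in>?E - {0}. ?F (f * l div g + e)) = (\<Prod>e\<in>?E - {0}. lead_coeff e)"
      by (rule prod.cong[OF refl F'])
    finally show "(\<Prod>e\<in>?E. ?F (f * l div g + e)) = - lead_coeff ?s * (\<Prod>e\<in>?E - {0}. lead_coeff e)" .
  qed
  also have "\<dots> = (\<Prod>l\<in>?M. (-1) ^ Suc (?a - ?b) * lead_coeff (f * l mod g))"
    by (simp add: prod_lead_coeff_polys_lt[OF q] mult.commute)
  also have "\<dots> = ((-1) ^ Suc (?a - ?b)) ^ card ?M * gauss_sym g f"
    by (simp only: prod.distrib prod_constant gauss_sym_def)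
  \<comment> \<open>The number of l has the parity of b, and b (1 + a - b) has the parity of a
    b.\<close>
  also have "((-1) ^ Suc (?a - ?b)) ^ card ?M = ((-1) ^ (?a * ?b) :: 'a)"
    using le even_card_monics_lt[OF q, of ?b] 
    by (simp only: power_mult [symmetric] minus_one_power_iff) auto
  finally show ?thesis by simp
qed

lemma gauss_sym_reciprocity:
  fixes f g :: "'a::{finite,field_gcd} poly"
  assumes q: "odd CARD('a)" and f: "lead_coeff f = 1" and g: "lead_coeff g = 1" and cop: "coprime f g"
  shows "gauss_sym f g = (-1) ^ (degree f * degree g) * gauss_sym g f"
proof (cases "degree g \<le> degree f")
  case True
  then show ?thesis using gauss_sym_reciprocity_le assms by blast
next
  case False
  then have "gauss_sym g f = (-1) ^ (degree g * degree f) * gauss_sym f g"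
    using assms by (intro gauss_sym_reciprocity_le) (auto simp: coprime_commute)
  then have "(-1) ^ (degree f * degree g) * gauss_sym g f =
      ((-1) ^ (degree f * degree g) * (-1) ^ (degree f * degree g)) * gauss_sym f g"
    by (simp add: mult.commute[of "degree g"] mult.assoc)
  then show ?thesis by (simp add: power_mult_distrib [symmetric])
qed

section \<open>The quadratic character\<close>

text \<open>The shift by 1 permutes the field, so summing all elements shows that q vanishes in it;
  with 2 = 0 and q odd this would give 1 = 0.\<close>

lemma one_neq_uminus_one:
  assumes "odd CARD('a::{finite,field_gcd})"
  shows "(1::'a) \<noteq> -1"
proof
  assume 1: "(1::'a) = -1"
  then have two: "(2::'a) = 0" by (metis add.right_inverse one_add_one)
  have "(\<Sum>x\<in>(UNIV::'a set). x) = (\<Sum>x\<in>(UNIV::'a set). x + 1)"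
    by (rule sum.reindex_bij_witness[of _ "\<lambda>x. x + 1" "\<lambda>x. x - 1"]) auto
  also have "\<dots> = (\<Sum>x\<in>(UNIV::'a set). x) + of_nat CARD('a)"
    by (simp add: sum.distrib)
  finally have "(of_nat CARD('a) :: 'a) = 0" by simp
  moreover obtain k where "CARD('a) = 2 * k + 1" using assms oddE by blast
  ultimately show False using two by simp
qed

text \<open>The quadratic character of the constant field, by Euler's criterion. It takes integer
  values, so that character sums are taken in the integers and not in the field.\<close>

definition eta :: "'a::{finite,field_gcd} \<Rightarrow> int" where
  "eta c = (if c = 0 then 0 else if c ^ ((CARD('a) - 1) div 2) = 1 then 1 else -1)"

lemma eta_0 [simp]: "eta 0 = 0" and eta_1 [simp]: "eta 1 = 1"
  by (simp_all add: eta_def)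

lemma eta_eq_0_iff [simp]: "eta c = 0 \<longleftrightarrow> c = 0"
  by (simp add: eta_def)

lemma eta_values: "c \<noteq> 0 \<Longrightarrow> eta c = 1 \<or> eta c = -1"
  by (simp add: eta_def)

lemma eta_square: "c \<noteq> 0 \<Longrightarrow> eta c * eta c = 1"
  using eta_values[of c] by auto

context
  assumes odd_card: "odd CARD('a::{finite,field_gcd})"
begin

lemma half_card: "(CARD('a) - 1) div 2 + (CARD('a) - 1) div 2 = CARD('a) - 1" "(CARD('a) - 1) div 2 > 0"
proof -
  have "CARD('a) > 1" by (rule card_field_gt_1)
  moreover obtain k where "CARD('a) = 2 * k + 1" using odd_card oddE by blast
  ultimately show "(CARD('a) - 1) div 2 + (CARD('a) - 1) div 2 = CARD('a) - 1" "(CARD('a) - 1) div 2 > 0"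
    by simp_all
qed

lemma of_int_eta: "of_int (eta c) = (c::'a) ^ ((CARD('a) - 1) div 2)"
proof (cases "c = 0")
  case True
  then show ?thesis using half_card(2) by (simp add: zero_power)
next
  case False
  let ?x = "c ^ ((CARD('a) - 1) div 2)"
  have "?x * ?x = 1"
    using prod_units_field(2)[OF odd_card False] half_card(1) by (simp only: power_add [symmetric])
  then have "?x = 1 \<or> ?x = -1" by (simp add: square_eq_1_iff)
  then show ?thesis using False by (auto simp: eta_def)
qed

lemma eta_eqI:
  assumes "of_int (eta c) = (of_int s :: 'a)" "s \<in> {-1, 0, 1}"
  shows "eta (c::'a) = s"
proof -
  have "eta c \<in> {-1, 0, 1}" by (simp add: eta_def)
  moreover have "of_int x \<noteq> (of_int y :: 'a)" if "x \<in> {-1, 0, 1}" "y \<in> {-1, 0, 1}" "x \<noteq> y" for x y :: int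
    using that one_neq_uminus_one[OF odd_card] by (elim insertE emptyE) (auto dest: sym)
  ultimately show ?thesis using assms by blast
qed

lemma eta_mult: "eta (c * d) = eta c * eta (d::'a)"
proof (rule eta_eqI)
  show "of_int (eta (c * d)) = (of_int (eta c * eta d) :: 'a)"
    by (simp add: of_int_eta power_mult_distrib)
  show "eta c * eta d \<in> {-1, 0, 1}" by (simp add: eta_def)
qed

lemma eta_power: "eta ((c::'a) ^ n) = eta c ^ n"
  by (induction n) (simp_all add: eta_mult)

text \<open>Otherwise all q - 1 units would be roots of a polynomial of degree (q - 1)/2.\<close>

lemma exists_eta_minus_one: "\<exists>c::'a. eta c = -1"
proof (rule ccontr)
  assume no: "\<not> (\<exists>c::'a. eta c = -1)"
  then have one: "c ^ ((CARD('a) - 1) div 2) = 1" if "c \<noteq> 0" for c :: 'a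
  proof -
    have "eta c = 1" using no eta_values[OF that] by blast
    then show ?thesis using that by (simp add: eta_def split: if_splits)
  qed
  let ?h = "(CARD('a) - 1) div 2"
  let ?p = "monom 1 ?h - 1 :: 'a poly"
  have "coeff ?p ?h = 1" using half_card(2) by (simp only: coeff_diff coeff_monom coeff_1) simp
  then have p0: "?p \<noteq> 0" by (intro notI) (simp only: coeff_0 zero_neq_one)
  have "degree ?p \<le> ?h" by (rule degree_diff_le) (simp_all add: degree_monom_le)
  moreover have "UNIV - {0} \<subseteq> {x. poly ?p x = 0}" using one by (auto simp: poly_monom)
  then have "card (UNIV - {0::'a}) \<le> card {x. poly ?p x = 0}" by (rule card_mono[rotated]) simp
  ultimately have "CARD('a) - 1 \<le> ?h"
    using card_poly_roots_bound[OF p0] by (simp add: card_Diff_singleton)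
  then show False using half_card by linarith
qed

lemma sum_eta: "(\<Sum>c\<in>(UNIV::'a set). eta c) = 0"
proof -
  obtain d :: 'a where d: "eta d = -1" using exists_eta_minus_one by blast
  then have d0: "d \<noteq> 0" by auto
  have "(\<Sum>c\<in>(UNIV::'a set). eta c) = (\<Sum>c\<in>(UNIV::'a set). eta (d * c))"
    by (rule sum.reindex_bij_witness[of _ "\<lambda>x. d * x" "\<lambda>x. x / d"]) (use d0 in auto)
  also have "\<dots> = - (\<Sum>c\<in>(UNIV::'a set). eta c)"
    by (simp add: eta_mult d sum_negf)
  finally show ?thesis by simp
qed

end

text \<open>Lagrange's theorem on roots modulo a prime element. A root x is split off by synthetic
  division, and the prime element divides no difference y - x, so the remaining y are roots of the
  quotient.\<close>

lemma card_incongruent_roots_le: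
  fixes P :: "'b::idom" and p :: "'b poly"
  assumes "prime_elem P" "finite S" "\<And>x. x \<in> S \<Longrightarrow> P dvd poly p x" "\<not> P dvd lead_coeff p"
    and "\<And>x y. x \<in> S \<Longrightarrow> y \<in> S \<Longrightarrow> P dvd x - y \<Longrightarrow> x = y"
  shows "card S \<le> degree p"
  using assms(2-)
proof (induction "degree p" arbitrary: p S)
  case 0
  then have "poly p x = lead_coeff p" for x by (metis degree_eq_zeroE lead_coeff_pCons(2) poly_const_conv)
  then have "S = {}" using 0 by fastforce
  then show ?case by simp
next
  case (Suc n)
  show ?case
  proof (cases "S = {}")
    case False
    then obtain x where x: "x \<in> S" by blast
    let ?q = "synthetic_div p x"
    have eq: "p = [:- x, 1:] * ?q + [:poly p x:]" by (simp only: synthetic_div_correct')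
    have dq: "degree ?q = n" using Suc(2) by (simp add: degree_synthetic_div)
    have q0: "?q \<noteq> 0" using Suc(2) by (simp add: synthetic_div_eq_0_iff)
    have "degree [:poly p x:] < degree ([:- x, 1:] * ?q)"
      using q0 by (subst degree_mult_eq) auto
    then have "lead_coeff ([:poly p x:] + [:- x, 1:] * ?q) = lead_coeff ([:- x, 1:] * ?q)"
      by (rule lead_coeff_add_le)
    then have "lead_coeff p = lead_coeff ([:- x, 1:] * ?q)"
      using eq by (simp only: add.commute)
    also have "\<dots> = lead_coeff ?q" by (simp only: lead_coeff_mult) simp
    finally have lc: "lead_coeff ?q = lead_coeff p" ..
    have "card (S - {x}) \<le> degree ?q"
    proof (rule Suc(1))
      show "n = degree ?q" "finite (S - {x})" "\<not> P dvd lead_coeff ?q" using dq Suc lc by auto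
      show "y = z" if "y \<in> S - {x}" "z \<in> S - {x}" "P dvd y - z" for y z using Suc that by blast
      show "P dvd poly ?q y" if y: "y \<in> S - {x}" for y
      proof -
        have "poly p y = poly ([:- x, 1:] * ?q + [:poly p x:]) y" using eq by (rule arg_cong)
        also have "\<dots> = (y - x) * poly ?q y + poly p x" by (simp add: algebra_simps)
        finally have "poly p y = (y - x) * poly ?q y + poly p x" .
        then have "(y - x) * poly ?q y = poly p y - poly p x" by simp
        moreover have "P dvd poly p y - poly p x" using Suc x y by (intro dvd_diff) auto
        ultimately have "P dvd (y - x) * poly ?q y" by simp
        moreover have "\<not> P dvd y - x" using Suc x y by blast
        ultimately show ?thesis using assms(1) prime_elem_dvd_multD by blast
      qed
    qed
    then show ?thesis using dq Suc x by (simp add: card_Diff_singleton)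
  qed simp
qed

lemma monic_iff_normalize:
  fixes f :: "'a::{finite,field_gcd} poly"
  shows "lead_coeff f = 1 \<longleftrightarrow> f \<noteq> 0 \<and> normalize f = f"
proof
  assume lc: "lead_coeff f = 1"
  then have "unit_factor f = 1" by (simp add: unit_factor_poly_def one_pCons)
  then show "f \<noteq> 0 \<and> normalize f = f"
    using lc unit_factor_mult_normalize[of f] by auto
next
  assume f: "f \<noteq> 0 \<and> normalize f = f"
  then have "unit_factor f = 1" by (metis unit_factor_normalize)
  moreover have "unit_factor (lead_coeff f) = lead_coeff f"
    using f by (simp add: is_unit_unit_factor dvd_field_iff)
  ultimately show "lead_coeff f = 1" by (simp add: unit_factor_poly_def one_pCons)
qed

lemma prime_poly_iff:
  fixes P :: "'a::{finite,field_gcd} poly"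
  shows "prime P \<longleftrightarrow> irreducible P \<and> lead_coeff P = 1"
  unfolding prime_def monic_iff_normalize
  by (auto simp: prime_elem_iff_irreducible)

lemma card_polys_lt_nonzero:
  "card (polys_lt n - {0 :: 'a::{finite,field_gcd} poly}) = CARD('a) ^ n - 1"
proof -
  have "0 \<in> (polys_lt n :: 'a poly set)" by (simp add: polys_lt_def)
  then show ?thesis by (simp add: card_Diff_singleton card_polys_lt)
qed

text \<open>
  The residue symbol of \<open>f\<close> modulo \<open>D\<close>, defined through Gauss's lemma; for irreducible \<open>D\<close> it is the
  Legendre symbol, and reciprocity relates it to \<open>chi D f\<close>.
\<close>

definition jacobi :: "'a::{finite,field_gcd} poly \<Rightarrow> 'a poly \<Rightarrow> int" where
  "jacobi D f = (if coprime D f then eta (gauss_sym D f) else 0)"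

lemma jacobi_mod: "D \<noteq> 0 \<Longrightarrow> jacobi D (f mod D) = jacobi D f"
  by (simp add: jacobi_def gauss_sym_mod gcd_mod_left coprime_iff_gcd_eq_1 gcd.commute)

lemma jacobi_cong: "D \<noteq> 0 \<Longrightarrow> D dvd f - g \<Longrightarrow> jacobi D f = jacobi D g"
  using jacobi_mod[of D f] jacobi_mod[of D g] by (simp add: mod_eq_dvd_iff [symmetric])

lemma jacobi_1 [simp]: "jacobi D 1 = 1"
  by (simp add: jacobi_def)

lemma jacobi_values: "jacobi D f \<in> {-1, 0, 1}"
  by (simp add: jacobi_def eta_def)

lemma jacobi_nonzero_square: "coprime D f \<Longrightarrow> jacobi D f * jacobi D f = 1"
  by (simp add: jacobi_def eta_square gauss_sym_nonzero)

context
  assumes odd_card: "odd CARD('a::{finite,field_gcd})"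
begin

lemma jacobi_mult: "jacobi D (f * g) = jacobi D f * jacobi D (g :: 'a poly)"
  by (auto simp: jacobi_def gauss_sym_mult eta_mult[OF odd_card])

text \<open>For odd degree the number of monic representatives is odd, so the symbol of c is an odd
  power of \<open>eta c\<close>. The character modulo D is therefore nontrivial on constants; the
  functional equation depends on this.\<close>

lemma jacobi_const:
  assumes "odd (degree D)" "c \<noteq> 0"
  shows "jacobi D [:c::'a:] = eta c"
proof -
  have "is_unit [:c:]" using assms by (simp add: is_unit_const_poly_iff dvd_field_iff)
  then have "coprime D [:c:]" by (rule is_unit_right_imp_coprime)
  moreover obtain k where "card (monics_lt (degree D) :: 'a poly set) = 2 * k + 1"
    using assms(1) even_card_monics_lt[OF odd_card, of "degree D"] oddE by metis
  ultimately show ?thesis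
    using assms(2) eta_square[of c] 
    by (simp add: jacobi_def gauss_sym_const eta_power[OF odd_card] power_mult power2_eq_square eta_mult[OF odd_card])
qed

lemma jacobi_reciprocity:
  fixes f g :: "'a poly"
  assumes "lead_coeff f = 1" "lead_coeff g = 1"
  shows "jacobi f g = eta (-1::'a) ^ (degree f * degree g) * jacobi g f"
proof (cases "coprime f g")
  case True
  then show ?thesis
    using gauss_sym_reciprocity[OF odd_card assms True]
    by (simp add: jacobi_def coprime_commute eta_mult[OF odd_card] eta_power[OF odd_card])
next
  case False
  then show ?thesis by (simp add: jacobi_def coprime_commute)
qed

text \<open>By Gauss's lemma every element of the kernel is a root modulo P of X^(N h) - 1, where N
  counts the monic representatives and h = (q - 1)/2, so that 2 N h = q^(deg P) - 1.\<close>

lemma card_jacobi_kernel_le: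
  fixes P :: "'a poly"
  assumes "irreducible P" "degree P > 0"
  shows "2 * card {b \<in> polys_lt (degree P). jacobi P b = 1} \<le> CARD('a) ^ degree P - 1"
proof -
  let ?N = "card (monics_lt (degree P) :: 'a poly set)" and ?h = "(CARD('a) - 1) div 2"
  let ?S = "{b \<in> polys_lt (degree P). jacobi P b = 1}"
  have pe: "prime_elem P" using assms(1) by (simp add: irreducible_imp_prime_elem_gcd)
  have N0: "?N > 0"
  proof -
    have "1 \<in> (monics_lt (degree P) :: 'a poly set)" using assms by (simp add: monics_lt_def)
    then show ?thesis by (auto simp: card_gt_0_iff)
  qed
  have "?h > 0" using half_card[OF odd_card] by simp
  with N0 have pos: "?N * ?h > 0" unfolding nat_0_less_mult_iff by (rule conjI)
  let ?p = "monom 1 (?N * ?h) - 1 :: 'a poly poly"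
  have cp: "coeff ?p (?N * ?h) = 1"
    using pos by (simp only: coeff_diff coeff_monom coeff_1 neq0_conv [symmetric] simp_thms if_False if_True of_bool_eq diff_zero)
  have dp: "degree ?p = ?N * ?h"
  proof (rule antisym)
    show "degree ?p \<le> ?N * ?h" by (rule degree_diff_le) (simp_all add: degree_monom_le)
    show "?N * ?h \<le> degree ?p" by (rule le_degree) (simp only: cp, simp)
  qed
  have "card ?S \<le> degree ?p"
  proof (rule card_incongruent_roots_le[OF pe])
    show "finite ?S" by simp
    show "\<not> P dvd lead_coeff ?p" unfolding dp cp using pe by auto
    show "x = y" if "x \<in> ?S" "y \<in> ?S" "P dvd x - y" for x y
      using polys_lt_dvd_imp_zero[OF that(3)] polys_lt_diff that(1,2) by auto
    show "P dvd poly ?p x" if "x \<in> ?S" for x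
    proof -
      have cop: "coprime P x" and e: "eta (gauss_sym P x) = 1"
        using that by (auto simp: jacobi_def split: if_splits)
      have "gauss_sym P x ^ ?h = 1" using of_int_eta[OF odd_card, of "gauss_sym P x"] e by simp
      then have "[:gauss_sym P x:] ^ ?h = 1" by (simp add: poly_const_pow one_pCons)
      moreover have "P dvd (x ^ ?N) ^ ?h - [:gauss_sym P x:] ^ ?h"
        using gauss_lemma[OF assms(1) cop] by (subst power_diff_sumr2) (rule dvd_mult2)
      ultimately show ?thesis by (simp add: poly_monom power_mult)
    qed
  qed
  then have "2 * card ?S \<le> 2 * (?N * ?h)" using dp by simp
  also have "2 * (?N * ?h) = ?N * (CARD('a) - 1)" 
    using arg_cong[OF half_card(1)[OF odd_card], of "\<lambda>x. ?N * x"] by (simp add: algebra_simps)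
  also have "\<dots> = card ((UNIV - {0::'a}) \<times> (monics_lt (degree P) :: 'a poly set))"
    by (simp add: card_cartesian_product card_Diff_singleton mult.commute)
  also have "\<dots> = card (polys_lt (degree P) - {0 :: 'a poly})"
    by (rule bij_betw_same_card[OF bij_betw_smult_monics_lt])
  also have "\<dots> = CARD('a) ^ degree P - 1"
    by (rule card_polys_lt_nonzero)
  finally show ?thesis .
qed

lemma irreducible_degree_pos:
  assumes "irreducible (P :: 'a poly)"
  shows "degree P > 0"
proof (rule ccontr)
  assume "\<not> degree P > 0"
  then obtain c where c: "P = [:c:]" using degree_eq_zeroE by blast
  moreover have "P \<noteq> 0" using assms by auto
  ultimately have "is_unit P" by (simp add: is_unit_const_poly_iff dvd_field_iff)
  then show False using assms irreducible_not_unit by blast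
qed

lemma coprime_irreducible_iff:
  assumes "irreducible (P :: 'a poly)"
  shows "coprime P f \<longleftrightarrow> \<not> P dvd f"
proof
  show "\<not> P dvd f" if "coprime P f"
    using coprime_common_divisor[OF that, of P] assms irreducible_not_unit by auto
  show "coprime P f" if "\<not> P dvd f"
    using that assms by (intro prime_elem_imp_coprime irreducible_imp_prime_elem_gcd)
qed

text \<open>Squaring is at most two-to-one, since c^2 = b^2 modulo the prime P forces c = b or c =
  -b.\<close>

lemma card_squares_ge:
  fixes P :: "'a poly"
  assumes "irreducible P"
  shows "CARD('a) ^ degree P - 1 \<le> 2 * card ((\<lambda>b. b ^ 2 mod P) ` (polys_lt (degree P) - {0}))"
proof -
  let ?U = "polys_lt (degree P) - {0 :: 'a poly}"
  let ?s = "\<lambda>b. b ^ 2 mod P"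
  have pe: "prime_elem P" using assms(1) by (simp add: irreducible_imp_prime_elem_gcd)
  have "?U \<subseteq> (\<Union>y\<in>?s ` ?U. {b \<in> ?U. ?s b = y})" by auto
  then have "card ?U \<le> card (\<Union>y\<in>?s ` ?U. {b \<in> ?U. ?s b = y})" by (rule card_mono[rotated]) simp
  also have "\<dots> \<le> (\<Sum>y\<in>?s ` ?U. card {b \<in> ?U. ?s b = y})" by (rule card_UN_le) simp
  also have "\<dots> \<le> (\<Sum>y\<in>?s ` ?U. 2)"
  proof (rule sum_mono)
    fix y assume "y \<in> ?s ` ?U"
    then obtain b where b: "b \<in> ?U" "y = ?s b" by blast
    have "{c \<in> ?U. ?s c = y} \<subseteq> {b, - b}"
    proof
      fix c assume "c \<in> {c \<in> ?U. ?s c = y}"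
      then have c: "c \<in> polys_lt (degree P)" "?s c = y" by auto
      have "P dvd c ^ 2 - b ^ 2" using c b by (simp add: mod_eq_dvd_iff)
      then have "P dvd (c - b) * (c + b)" by (simp add: power2_eq_square algebra_simps)
      then have "P dvd c - b \<or> P dvd c + b" using pe prime_elem_dvd_multD by blast
      moreover have "c - b \<in> polys_lt (degree P)" "c + b \<in> polys_lt (degree P)"
        using b c by (auto intro: polys_lt_add polys_lt_diff)
      ultimately have "c - b = 0 \<or> c + b = 0" using polys_lt_dvd_imp_zero by blast
      then show "c \<in> {b, - b}" by (auto simp: add_eq_0_iff2)
    qed
    then have "card {c \<in> ?U. ?s c = y} \<le> card {b, - b}" by (rule card_mono[rotated]) simp
    also have "\<dots> \<le> 2" by (simp add: card_insert_if)
    finally show "card {c \<in> ?U. ?s c = y} \<le> 2" .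
  qed
  also have "\<dots> = 2 * card (?s ` ?U)" by simp
  also have "card ?U = CARD('a) ^ degree P - 1"
    by (rule card_polys_lt_nonzero)
  finally show ?thesis .
qed

text \<open>All nonzero squares lie in the kernel of the symbol. The squares fill at least half of
  the nonzero residues and the kernel at most half, so a nonsquare in the kernel would make it too
  large.\<close>

lemma legendre_poly_eq_jacobi:
  fixes P D :: "'a poly"
  assumes "irreducible P"
  shows "legendre_poly D P = jacobi P D"
proof (cases "P dvd D")
  case True
  then show ?thesis using assms by (simp add: legendre_poly_def jacobi_def coprime_irreducible_iff)
next
  case False
  note P = irreducible_degree_pos[OF assms]
  then have P0: "P \<noteq> 0" by auto
  have cop: "coprime P D" using False assms by (simp add: coprime_irreducible_iff)
  have sq: "jacobi P (h ^ 2 mod P) = 1" if "\<not> P dvd h" for h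
    using that assms P0
    by (simp add: jacobi_mod power2_eq_square jacobi_mult jacobi_nonzero_square coprime_irreducible_iff)
  show ?thesis
  proof (cases "\<exists>h. P dvd h ^ 2 - D")
    case True
    then obtain h where h: "P dvd h ^ 2 - D" by blast
    have "\<not> P dvd h"
    proof
      assume "P dvd h"
      then have "P dvd h ^ 2" by (simp add: power2_eq_square)
      then have "P dvd h ^ 2 - (h ^ 2 - D)" using h by (rule dvd_diff)
      then show False using False by simp
    qed
    have "jacobi P D = jacobi P (h ^ 2 mod P)"
      using jacobi_cong[OF P0 h] P0 by (simp add: jacobi_mod)
    also have "\<dots> = 1" by (rule sq) fact
    finally show ?thesis using True False unfolding legendre_poly_def by (simp only: if_True if_False)
  next
    case nsq: False
    have "jacobi P D \<noteq> 1"
    proof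
      assume 1: "jacobi P D = 1"
      let ?Q = "(\<lambda>b. b ^ 2 mod P) ` (polys_lt (degree P) - {0})"
      let ?S = "{b \<in> polys_lt (degree P). jacobi P b = 1}"
      have "D mod P \<notin> ?Q" using nsq by (auto simp: mod_eq_dvd_iff dest: sym)
      then have "Suc (card ?Q) = card (insert (D mod P) ?Q)" by simp
      also have "\<dots> \<le> card ?S"
      proof (rule card_mono)
        have "b ^ 2 mod P \<in> ?S" if "b \<in> polys_lt (degree P) - {0}" for b
          using that polys_lt_dvd_imp_zero[of P b] by (auto intro!: sq degree_mod_lt P0)
        moreover have "D mod P \<in> ?S" using 1 P0 by (auto intro: degree_mod_lt simp: jacobi_mod)
        ultimately show "insert (D mod P) ?Q \<subseteq> ?S" by blast
      qed simp
      finally show False using card_squares_ge[OF assms] card_jacobi_kernel_le[OF assms P] by linarith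
    qed
    then have "jacobi P D = -1"
      using cop eta_values[OF gauss_sym_nonzero[OF cop]] by (simp add: jacobi_def)
    then show ?thesis using nsq False unfolding legendre_poly_def by (simp only: if_True if_False)
  qed
qed

lemma exists_nonresidue:
  fixes P :: "'a poly"
  assumes "irreducible P"
  shows "\<exists>b. jacobi P b = -1"
proof (rule ccontr)
  assume no: "\<not> (\<exists>b. jacobi P b = -1)"
  let ?S = "{b \<in> polys_lt (degree P). jacobi P b = 1}"
  note P = irreducible_degree_pos[OF assms]
  have "polys_lt (degree P) - {0} \<subseteq> ?S"
  proof
    fix b :: "'a poly" assume "b \<in> polys_lt (degree P) - {0}"
    then have b: "b \<in> polys_lt (degree P)" "b \<noteq> 0" by auto
    then have "coprime P b" using assms polys_lt_dvd_imp_zero[of P b] by (auto simp: coprime_irreducible_iff)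
    then have "jacobi P b \<noteq> 0" using jacobi_nonzero_square by fastforce
    then show "b \<in> ?S" using no jacobi_values[of P b] b by auto
  qed
  then have "card (polys_lt (degree P) - {0 :: 'a poly}) \<le> card ?S" by (rule card_mono[rotated]) simp
  then have "CARD('a) ^ degree P - 1 \<le> card ?S"
    by (simp only: card_polys_lt_nonzero)
  moreover have "CARD('a) ^ degree P > 1"
    using P card_field_gt_1[where 'a='a] by (intro one_less_power)
  ultimately show False using card_jacobi_kernel_le[OF assms P] by linarith
qed

end

section \<open>\<open>chi D\<close> as a primitive character modulo D\<close>

lemma chi_mult: "f \<noteq> 0 \<Longrightarrow> g \<noteq> 0 \<Longrightarrow> chi D (f * g) = chi D f * chi D g"
  by (simp add: chi_def prime_factorization_mult)

lemma chi_1 [simp]: "chi D 1 = 1"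
  by (simp add: chi_def)

lemma chi_prime: "prime P \<Longrightarrow> chi D P = legendre_poly D P"
  by (simp add: chi_def prime_factorization_prime)

lemma monic_ne_0: "lead_coeff f = (1::'a::{finite,field_gcd}) \<Longrightarrow> f \<noteq> 0"
  by auto

lemma monic_prod_mset:
  "(\<And>P. P \<in># M \<Longrightarrow> lead_coeff P = 1) \<Longrightarrow> lead_coeff (prod_mset M :: 'a::{finite,field_gcd} poly) = 1"
  by (induction M) (simp_all add: lead_coeff_mult)

lemma prod_mset_prime_factorization_monic:
  fixes f :: "'a::{finite,field_gcd} poly"
  assumes "lead_coeff f = 1"
  shows "prod_mset (prime_factorization f) = f"
  using assms monic_iff_normalize[of f] by (simp add: prod_mset_prime_factorization)

context
  assumes odd_card: "odd CARD('a::{finite,field_gcd})"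
begin

text \<open>An odd degree of D leaves a sign that depends on the degree of f only, so it is constant
  in each coefficient of the L-series.\<close>

lemma jacobi_reciprocity_odd:
  fixes D f :: "'a poly"
  assumes "lead_coeff D = 1" "odd (degree D)" "lead_coeff f = 1"
  shows "jacobi f D = eta (-1::'a) ^ degree f * jacobi D f"
proof -
  have "eta (-1::'a) \<in> {-1, 1}" using eta_values[of "-1::'a"] by auto
  then have "eta (-1::'a) ^ (degree f * degree D) = eta (-1::'a) ^ degree f"
    using assms(2) by (auto simp: minus_one_power_iff)
  then show ?thesis using jacobi_reciprocity[OF odd_card assms(3) assms(1)] by simp
qed

text \<open>Both sides are multiplicative in f, and for a prime P this is reciprocity. Here a
  product of Legendre symbols with varying moduli becomes, up to sign, a character of f modulo
  D.\<close>

lemma chi_eq_jacobi: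
  fixes D f :: "'a poly"
  assumes D: "lead_coeff D = 1" "odd (degree D)" and f: "lead_coeff f = 1"
  shows "chi D f = eta (-1::'a) ^ degree f * jacobi D f"
proof -
  have "(\<Prod>P\<in>#M. legendre_poly D P) = eta (-1::'a) ^ degree (prod_mset M) * jacobi D (prod_mset M)"
    if "\<And>P. P \<in># M \<Longrightarrow> prime P" for M
    using that
  proof (induction M)
    case (add P M)
    then have P: "irreducible P" "lead_coeff P = 1" by (auto simp: prime_poly_iff)
    have "lead_coeff (prod_mset M) = 1"
      using add.prems by (intro monic_prod_mset) (auto simp: prime_poly_iff)
    then have "degree (P * prod_mset M) = degree P + degree (prod_mset M)"
      using P(2) by (intro degree_mult_eq monic_ne_0)
    moreover have "legendre_poly D P = eta (-1::'a) ^ degree P * jacobi D P"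
      using legendre_poly_eq_jacobi[OF odd_card P(1)] jacobi_reciprocity_odd[OF D P(2)] by simp
    ultimately show ?case
      using add by (simp add: jacobi_mult[OF odd_card] power_add)
  qed simp
  from this[of "prime_factorization f", OF in_prime_factors_imp_prime] show ?thesis
    by (simp add: chi_def prod_mset_prime_factorization_monic[OF f])
qed

text \<open>Primitivity of the character. For a prime P dividing D and a, and D = P E, the Chinese
  remainder theorem gives b that is a nonresidue modulo P and 1 modulo E. Then b - 1 is divisible by
  E and a by P, so b fixes a modulo D.\<close>

lemma primitive_jacobi:
  fixes D a :: "'a poly"
  assumes D: "lead_coeff D = 1" "squarefree D" and a: "\<not> coprime D a"
  shows "\<exists>b. jacobi D b = -1 \<and> D dvd a * b - a"
proof -
  have D0: "D \<noteq> 0" using D by auto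
  have "gcd D a \<noteq> 0" "\<not> is_unit (gcd D a)" using D0 a by (auto simp: coprime_iff_gcd_eq_1)
  then obtain P where P: "prime P" "P dvd gcd D a" using prime_divisor_exists by blast
  then have Pa: "P dvd a" and PD: "P dvd D" by auto
  have irr: "irreducible P" and lP: "lead_coeff P = 1" using P(1) by (auto simp: prime_poly_iff)
  have P0: "P \<noteq> 0" using lP by auto
  obtain E where E: "D = P * E" using PD by blast
  then have lE: "lead_coeff E = 1" using D lP by (simp add: lead_coeff_mult)
  then have E0: "E \<noteq> 0" by auto
  have "\<not> P dvd E"
  proof
    assume "P dvd E"
    then have "P ^ 2 dvd D" using E by (simp add: power2_eq_square)
    then have "is_unit P" using D(2) by (simp add: squarefree_def)
    then show False using irr irreducible_not_unit by blast
  qed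
  then have cop: "coprime P E" using irr odd_card by (simp add: coprime_irreducible_iff)
  obtain n where n: "jacobi P n = -1" using exists_nonresidue[OF odd_card irr] by blast
  define x y where "x = fst (bezout_coefficients P E)" and "y = snd (bezout_coefficients P E)"
  have xy: "x * P + y * E = 1"
    using bezout_coefficients[of P E x y] cop by (simp add: x_def y_def)
  define b0 where "b0 = n * (y * E) + x * P"
  \<comment> \<open>Adding D to the residue makes b monic without changing its class, as reciprocity
    requires.\<close>
  define b where "b = b0 mod D + D"
  have bm: "lead_coeff b = 1" "degree b = degree D"
    unfolding b_def using monic_add_lower[OF D(1) degree_mod_lt[OF D0]] by (simp_all only: add.commute)
  have Db: "D dvd b - b0"
    by (simp add: b_def mod_eq_dvd_iff [symmetric])
  have yE: "y * E = 1 - x * P" and xP: "x * P = 1 - y * E"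
    using xy by (simp_all add: algebra_simps flip: xy)
  have "b0 - n = (x * P) * (1 - n)"
    unfolding b0_def yE by (simp add: algebra_simps)
  then have "P dvd b0 - n" by simp
  moreover have "P dvd b - b0" using Db PD dvd_trans by blast
  ultimately have "P dvd (b0 - n) + (b - b0)" by (rule dvd_add)
  then have Pb: "P dvd b - n" by simp
  have "b0 - 1 = (y * E) * (n - 1)" unfolding b0_def xP by (simp add: algebra_simps)
  then have "E dvd b0 - 1" by simp
  moreover have "E dvd b - b0" using Db E dvd_trans[of E D] by simp
  ultimately have "E dvd (b0 - 1) + (b - b0)" by (rule dvd_add)
  then have Eb: "E dvd b - 1" by simp
  have jE: "jacobi E b = 1" using jacobi_cong[OF E0 Eb] by simp
  have jP: "jacobi P b = -1" using jacobi_cong[OF P0 Pb] n by simp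
  \<comment> \<open>Multiplicativity in the modulus is obtained by reciprocity: turn the symbol
    over, split the product P E in the upper argument, and turn both factors back.\<close>
  have "jacobi D b = eta (-1::'a) ^ (degree D * degree b) * jacobi b D"
    by (rule jacobi_reciprocity[OF odd_card D(1) bm(1)])
  also have "jacobi b D = jacobi b P * jacobi b E" unfolding E by (rule jacobi_mult[OF odd_card])
  also have "degree D * degree b = degree P * degree b + degree E * degree b"
    using P0 E0 E by (simp add: degree_mult_eq algebra_simps)
  also have "eta (-1::'a) ^ (degree P * degree b + degree E * degree b) * (jacobi b P * jacobi b E)
     = (eta (-1::'a) ^ (degree P * degree b) * jacobi b P) * (eta (-1::'a) ^ (degree E * degree b) * jacobi b E)"
    by (simp add: power_add)
  also have "eta (-1::'a) ^ (degree P * degree b) * jacobi b P = jacobi P b"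
    by (rule jacobi_reciprocity[OF odd_card lP bm(1), symmetric])
  also have "eta (-1::'a) ^ (degree E * degree b) * jacobi b E = jacobi E b"
    by (rule jacobi_reciprocity[OF odd_card lE bm(1), symmetric])
  finally have "jacobi D b = -1" using jE jP by simp
  moreover have "P * E dvd a * (b - 1)" using Pa Eb by (rule mult_dvd_mono)
  then have "D dvd a * b - a" by (simp add: E algebra_simps)
  ultimately show ?thesis by blast
qed

end

section \<open>The functional equation\<close>

lemma bij_betw_mult_mod:
  fixes D b :: "'a::{finite,field_gcd} poly"
  assumes "D \<noteq> 0" "coprime D b"
  shows "bij_betw (\<lambda>f. b * f mod D) (polys_lt (degree D)) (polys_lt (degree D))"
proof -
  have "inj_on (\<lambda>f. b * f mod D) (polys_lt (degree D))"
  proof (rule inj_onI)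
    fix f f' assume f: "f \<in> polys_lt (degree D)" "f' \<in> polys_lt (degree D)" "b * f mod D = b * f' mod D"
    then have "D dvd b * (f - f')" by (simp add: mod_eq_dvd_iff algebra_simps)
    then have "D dvd f - f'" using assms coprime_dvd_mult_right_iff by blast
    then show "f = f'" using f polys_lt_dvd_imp_zero[of D "f - f'"] by (simp add: polys_lt_diff)
  qed
  moreover have "(\<lambda>f. b * f mod D) ` polys_lt (degree D) \<subseteq> polys_lt (degree D)"
    using degree_mod_lt[OF assms(1)] by blast
  ultimately show ?thesis by (simp add: bij_betw_def endo_inj_surj)
qed

definition jacobi_sum :: "'a::{finite,field_gcd} poly \<Rightarrow> nat \<Rightarrow> int" where
  "jacobi_sum D m = (\<Sum>f\<in>monics m. jacobi D f)"

text \<open>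
  An analogue of a Gauss sum: \<open>eta\<close> of the leading coordinate takes the role of an additive character.
\<close>

definition top_sum :: "'a::{finite,field_gcd} poly \<Rightarrow> 'a poly \<Rightarrow> int" where
  "top_sum D a = (\<Sum>f\<in>polys_lt (degree D). jacobi D f * eta (coeff (a * f mod D) (degree D - 1)))"

lemma coeff_mult_monic:
  fixes k f :: "'a::{finite,field_gcd} poly"
  assumes "k \<in> monics m" "f \<in> polys_lt (Suc d)"
  shows "coeff (k * f) (m + d) = coeff f d"
proof (cases "coeff f d = 0")
  case True
  then have "f \<in> polys_lt d"
    using assms(2) by (intro polys_ltI) (auto simp: polys_lt_def)
  then have "f = 0 \<or> degree (k * f) < m + d"
    using assms(1) le_less_trans[OF degree_mult_le[of k f]] by (auto simp: polys_lt_def monics_def)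
  then show ?thesis using True by (auto simp: coeff_eq_0)
next
  case False
  then have "d \<le> degree f" by (rule le_degree)
  then have "degree f = d" using assms(2) by (auto simp: polys_lt_def)
  then show ?thesis
    using assms(1) coeff_mult_degree_sum[of k f] by (auto simp: monics_def)
qed

context
  assumes odd_card: "odd CARD('a::{finite,field_gcd})"
begin

lemma sum_eta_affine:
  fixes a c :: 'a
  assumes "a \<noteq> 0"
  shows "(\<Sum>x\<in>UNIV. eta (c + x * a)) = 0"
proof -
  have "(\<Sum>x\<in>UNIV. eta (c + x * a)) = (\<Sum>x\<in>(UNIV::'a set). eta x)"
    by (rule sum.reindex_bij_witness[of _ "\<lambda>x. (x - c) / a" "\<lambda>x. c + x * a"]) (use assms in auto)
  then show ?thesis by (simp add: sum_eta[OF odd_card])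
qed

text \<open>An orthogonality relation. If f has degree at most d, then k f is already reduced and
  its top coordinate is that of f. Otherwise shifts of k by c X^i move the top coordinate through
  the whole field, where \<open>eta\<close> sums to 0.\<close>

lemma sum_eta_top:
  fixes D f :: "'a poly"
  assumes D: "degree D = Suc (m + d)" and f: "f \<in> polys_lt (degree D)"
  shows "(\<Sum>k\<in>monics m. eta (coeff (k * f mod D) (m + d))) =
           (if f \<in> polys_lt (Suc d) then int CARD('a) ^ m * eta (coeff f d) else 0)"
proof (cases "f \<in> polys_lt (Suc d)")
  case True
  have "coeff (k * f mod D) (m + d) = coeff f d" if k: "k \<in> monics m" for k
  proof -
    have "degree (k * f) < degree D"
      using True k D le_less_trans[OF degree_mult_le[of k f]] by (auto simp: polys_lt_def monics_def)
    then show ?thesis using coeff_mult_monic[OF k True] by (simp add: mod_poly_less)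
  qed
  then show ?thesis using True by (simp add: card_monics)
next
  case False
  then have f0: "f \<noteq> 0" and df: "d < degree f" "degree f < degree D"
    using f by (auto simp: polys_lt_def)
  \<comment> \<open>X^i moves the leading term of f to the coordinate m + d, and i < m keeps k + c
    X^i monic of degree m.\<close>
  define i where "i = m + d - degree f"
  have i: "i < m" "i + degree f = m + d" using df D by (auto simp: i_def)
  let ?X = "monom 1 i :: 'a poly"
  have X: "coeff (?X * f mod D) (m + d) = lead_coeff f"
  proof -
    have "degree (?X * f) = m + d" using f0 i by (simp add: degree_mult_eq degree_monom_eq)
    then have "?X * f mod D = ?X * f" using D by (simp add: mod_poly_less)
    moreover have "coeff (?X * f) (m + d) = lead_coeff f"
      using coeff_mult_degree_sum[of ?X f] i by (simp add: degree_monom_eq)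
    ultimately show ?thesis by simp
  qed
  let ?A = "\<lambda>k. coeff (k * f mod D) (m + d)"
  have shift: "(\<Sum>k\<in>monics m. eta (?A k)) = (\<Sum>k\<in>monics m. eta (?A k + c * lead_coeff f))" for c
  proof -
    have deg: "smult c ?X \<in> polys_lt m" for c
      using i(1) by (auto simp: polys_lt_def degree_monom_eq)
    have mon: "k + smult c ?X \<in> monics m" if "k \<in> monics m" for k c
      using monic_add_lower[of k "smult c ?X"] deg[of c] that by (auto simp: monics_def)
    have canc: "smult c ?X + smult (- c) ?X = 0" "smult (- c) ?X + smult c ?X = 0" for c
      by (simp_all only: smult_add_left [symmetric]) simp_all
    have "(\<Sum>k\<in>monics m. eta (?A k)) = (\<Sum>k\<in>monics m. eta (?A (k + smult c ?X)))"
      by (rule sum.reindex_bij_witness[of _ "\<lambda>k. k + smult c ?X" "\<lambda>k. k + smult (- c) ?X"])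
         (auto simp only: mon add.assoc canc add_0_right)
    also have "\<dots> = (\<Sum>k\<in>monics m. eta (?A k + c * lead_coeff f))"
    proof (rule sum.cong[OF refl])
      fix k
      have "(k + smult c ?X) * f mod D = k * f mod D + smult c (?X * f mod D)"
        by (simp only: distrib_right poly_mod_add_left mult_smult_left mod_smult_left)
      then show "eta (?A (k + smult c ?X)) = eta (?A k + c * lead_coeff f)"
        by (simp only: coeff_add coeff_smult X)
    qed
    finally show ?thesis .
  qed
  have "int CARD('a) * (\<Sum>k\<in>monics m. eta (?A k)) = (\<Sum>c\<in>(UNIV::'a set). \<Sum>k\<in>monics m. eta (?A k))"
    by simp
  also have "\<dots> = (\<Sum>c\<in>UNIV. \<Sum>k\<in>monics m. eta (?A k + c * lead_coeff f))"
    by (intro sum.cong refl shift)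
  also have "\<dots> = (\<Sum>k\<in>monics m. \<Sum>c\<in>UNIV. eta (?A k + c * lead_coeff f))"
    by (rule sum.swap)
  also have "\<dots> = 0" using f0 by (simp add: sum_eta_affine)
  finally show ?thesis using False by simp
qed

text \<open>Replacing the residue of f by that of b f changes only terms of degree below deg D, so
  for m at least deg D it permutes the monic polynomials of degree m. It also flips the sign of
  every symbol.\<close>

lemma jacobi_sum_eq_0_if_nontrivial:
  fixes D b :: "'a poly"
  assumes b: "jacobi D b = -1" and D0: "D \<noteq> 0" and le: "degree D \<le> m"
  shows "jacobi_sum D m = 0"
proof -
  have cop: "coprime D b" using b by (auto simp: jacobi_def split: if_splits)
  let ?h = "\<lambda>f. f + (b * f mod D - f mod D)"
  have hmod: "?h f mod D = b * f mod D" for f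
  proof -
    have "D dvd (f - f mod D) - (b * f - b * f mod D)" by (intro dvd_diff dvd_minus_mod)
    then show ?thesis by (simp add: mod_eq_dvd_iff algebra_simps)
  qed
  have "inj_on ?h (monics m)"
  proof (rule inj_onI)
    fix f f' assume f: "?h f = ?h f'"
    then have bf: "b * f mod D = b * f' mod D" using hmod by metis
    then have "D dvd b * (f - f')" by (simp add: mod_eq_dvd_iff algebra_simps)
    then have "D dvd f - f'" using cop coprime_dvd_mult_right_iff by blast
    then have "f mod D = f' mod D" by (simp add: mod_eq_dvd_iff)
    then show "f = f'" using f bf by simp
  qed
  moreover have "?h ` monics m \<subseteq> monics m"
  proof (rule image_subsetI)
    fix f :: "'a poly" assume f: "f \<in> monics m"
    then have "b * f mod D - f mod D \<in> polys_lt (degree f)"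
      using degree_mod_lt[OF D0] le by (auto intro!: polys_lt_diff intro: polys_lt_mono simp: monics_def)
    moreover have "lead_coeff f = 1" "degree f = m" using f by (auto simp: monics_def)
    ultimately show "?h f \<in> monics m"
      using monic_add_lower[of f] by (simp only: monics_def mem_Collect_eq simp_thms)
  qed
  ultimately have bij: "bij_betw ?h (monics m) (monics m)" by (simp add: bij_betw_def endo_inj_surj)
  have "jacobi_sum D m = (\<Sum>f\<in>monics m. jacobi D (?h f))"
    unfolding jacobi_sum_def by (rule sum.reindex_bij_betw[OF bij, symmetric])
  also have "\<dots> = (\<Sum>f\<in>monics m. - jacobi D f)"
  proof (rule sum.cong[OF refl])
    fix f
    show "jacobi D (?h f) = - jacobi D f"
    using hmod[of f] jacobi_mod[OF D0, of "?h f"] jacobi_mod[OF D0, of "b * f"]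
      jacobi_mult[OF odd_card, of D b f] b by simp
  qed
  finally show ?thesis by (simp add: jacobi_sum_def sum_negf)
qed

context
  fixes D :: "'a poly" and g :: nat
  assumes D: "D \<in> hyp_family g"
begin

lemma hyp_family_props: "lead_coeff D = 1" "squarefree D" "degree D = Suc (2 * g)" "D \<noteq> 0" "odd (degree D)"
  using D by (auto simp: hyp_family_def)

text \<open>Separability of the Gauss sum. If a is prime to D, substitute a f for f. Otherwise
  primitivity supplies b with symbol -1 that leaves a f unchanged modulo D, so substituting b f
  shows that the sum equals its negative.\<close>

lemma top_sum_eq: "top_sum D a = jacobi D a * top_sum D 1"
proof (cases "coprime D a")
  case True
  have "top_sum D 1 = (\<Sum>f\<in>polys_lt (degree D). jacobi D f * eta (coeff f (degree D - 1)))"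
    unfolding top_sum_def by (rule sum.cong) (auto simp: polys_lt_def mod_poly_less)
  also have "\<dots> = (\<Sum>f\<in>polys_lt (degree D). jacobi D (a * f mod D) * eta (coeff (a * f mod D) (degree D - 1)))"
    by (rule sum.reindex_bij_betw[OF bij_betw_mult_mod[OF hyp_family_props(4) True], symmetric])
  also have "\<dots> = jacobi D a * top_sum D a"
    by (simp add: top_sum_def sum_distrib_left jacobi_mod hyp_family_props jacobi_mult[OF odd_card] mult.assoc)
  finally have "jacobi D a * top_sum D 1 = (jacobi D a * jacobi D a) * top_sum D a" by simp
  then show ?thesis using jacobi_nonzero_square[OF True] by simp
next
  case False
  obtain b where b: "jacobi D b = -1" "D dvd a * b - a"
    using primitive_jacobi[OF odd_card hyp_family_props(1,2) False] by blast
  have cop: "coprime D b" using b(1) by (auto simp: jacobi_def split: if_splits)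
  have ab: "a * (b * f mod D) mod D = a * f mod D" for f
  proof -
    have "D dvd (a * b - a) * f" using b(2) by simp
    then have "a * b * f mod D = a * f mod D" by (simp add: mod_eq_dvd_iff algebra_simps)
    then show ?thesis by (simp add: mod_mult_right_eq mult.assoc)
  qed
  have "top_sum D a = (\<Sum>f\<in>polys_lt (degree D). jacobi D (b * f mod D) * eta (coeff (a * (b * f mod D) mod D) (degree D - 1)))"
    unfolding top_sum_def by (rule sum.reindex_bij_betw[OF bij_betw_mult_mod[OF hyp_family_props(4) cop], symmetric])
  also have "\<dots> = - top_sum D a"
    by (simp add: ab top_sum_def jacobi_mod hyp_family_props jacobi_mult[OF odd_card] b sum_negf)
  finally have "top_sum D a = 0" by simp
  then show ?thesis using False by (simp add: jacobi_def)
qed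

text \<open>The sum of \<open>top_sum D k\<close> over monic k of degree m is computed by
  separability and by orthogonality. The condition m + d = deg D - 1 makes the surviving f those of
  degree at most d.\<close>

lemma jacobi_sum_top:
  assumes "m + d = 2 * g"
  shows "jacobi_sum D m * top_sum D 1 = int CARD('a) ^ m * (int CARD('a) - 1) * jacobi_sum D d"
proof -
  let ?q = "int CARD('a)"
  have dD: "degree D = Suc (m + d)" using hyp_family_props assms by simp
  have "jacobi_sum D m * top_sum D 1 = (\<Sum>k\<in>monics m. top_sum D k)"
    unfolding jacobi_sum_def sum_distrib_right by (rule sum.cong[OF refl]) (rule top_sum_eq[symmetric])
  also have "\<dots> = (\<Sum>k\<in>monics m. \<Sum>f\<in>polys_lt (degree D). jacobi D f * eta (coeff (k * f mod D) (m + d)))"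
    by (simp add: top_sum_def dD)
  also have "\<dots> = (\<Sum>f\<in>polys_lt (degree D). \<Sum>k\<in>monics m. jacobi D f * eta (coeff (k * f mod D) (m + d)))"
    by (rule sum.swap)
  also have "\<dots> = (\<Sum>f\<in>polys_lt (degree D). if f \<in> polys_lt (Suc d) then jacobi D f * (?q ^ m * eta (coeff f d)) else 0)"
    by (rule sum.cong[OF refl]) (simp add: sum_distrib_left[symmetric] sum_eta_top[OF dD])
  also have "\<dots> = (\<Sum>f\<in>{f \<in> polys_lt (degree D). f \<in> polys_lt (Suc d)}. jacobi D f * (?q ^ m * eta (coeff f d)))"
    by (rule sum.inter_filter[symmetric]) simp
  also have "{f \<in> polys_lt (degree D). f \<in> polys_lt (Suc d)} = polys_lt (Suc d)"
    using dD by (auto intro: polys_lt_mono)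
  also have "(\<Sum>f\<in>polys_lt (Suc d). jacobi D f * (?q ^ m * eta (coeff f d))) =
     (\<Sum>f\<in>polys_lt (Suc d) - {0}. jacobi D f * (?q ^ m * eta (coeff f d)))"
    by (rule sum.mono_neutral_right) auto
  also have "\<dots> = (\<Sum>(c, k)\<in>(UNIV - {0}) \<times> monics_lt (Suc d).
      jacobi D (smult c k) * (?q ^ m * eta (coeff (smult c k) d)))"
    using sum.reindex_bij_betw[OF bij_betw_smult_monics_lt, of "\<lambda>f. jacobi D f * (?q ^ m * eta (coeff f d))" "Suc d", symmetric]
    by (simp only: case_prod_unfold)
  also have "\<dots> = (\<Sum>c\<in>UNIV - {0}. \<Sum>k\<in>monics_lt (Suc d). 
      jacobi D (smult c k) * (?q ^ m * eta (coeff (smult c k) d)))"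
    by (simp only: sum.cartesian_product)
  \<comment> \<open>Only degree exactly d contributes, because \<open>eta 0 = 0\<close>. The
    constant c gives \<open>eta c\<close> once from the odd character and once from the coordinate;
    the product is 1, so all q - 1 constants contribute equally.\<close>
  also have "\<dots> = (\<Sum>c\<in>UNIV - {0::'a}. ?q ^ m * jacobi_sum D d)"
  proof (rule sum.cong[OF refl])
    fix c :: 'a assume "c \<in> UNIV - {0}"
    then have c: "c \<noteq> 0" by simp
    have J: "jacobi D (smult c k) = eta c * jacobi D k" for k
      using jacobi_mult[OF odd_card, of D "[:c:]" k] jacobi_const[OF odd_card hyp_family_props(5) c] by simp
    have "(\<Sum>k\<in>monics_lt (Suc d). jacobi D (smult c k) * (?q ^ m * eta (coeff (smult c k) d))) =
      (\<Sum>k\<in>monics d. jacobi D (smult c k) * (?q ^ m * eta (coeff (smult c k) d)))"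
    proof (rule sum.mono_neutral_right)
      show "\<forall>k\<in>monics_lt (Suc d) - monics d. jacobi D (smult c k) * (?q ^ m * eta (coeff (smult c k) d)) = 0"
        by (auto simp: monics_lt_Suc) (auto simp: monics_lt_def coeff_eq_0)
    qed (simp, simp add: monics_lt_Suc)
    also have "\<dots> = (\<Sum>k\<in>monics d. ?q ^ m * jacobi D k)"
    proof (rule sum.cong[OF refl])
      fix k :: "'a poly" assume "k \<in> monics d"
      then have "coeff (smult c k) d = c" by (auto simp: monics_def)
      then show "jacobi D (smult c k) * (?q ^ m * eta (coeff (smult c k) d)) = ?q ^ m * jacobi D k"
        using eta_square[OF c] by (simp only: J) (simp add: mult.left_commute mult.commute)
    qed
    finally show "(\<Sum>k\<in>monics_lt (Suc d). jacobi D (smult c k) * (?q ^ m * eta (coeff (smult c k) d))) =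
       ?q ^ m * jacobi_sum D d" by (simp add: jacobi_sum_def sum_distrib_left)
  qed
  also have "\<dots> = ?q ^ m * (?q - 1) * jacobi_sum D d"
    using card_field_gt_1[where 'a='a] by (simp add: card_Diff_singleton of_nat_diff)
  finally show ?thesis .
qed

lemma jacobi_sum_0: "jacobi_sum D 0 = 1"
  by (simp add: jacobi_sum_def monics_0)

text \<open>The case m = 0 evaluates the Gauss sum as q - 1 times the top coefficient; substituting
  this value, the factor q - 1 cancels.\<close>

lemma jacobi_sum_functional_eq:
  assumes "m + d = 2 * g"
  shows "jacobi_sum D m * jacobi_sum D (2 * g) = int CARD('a) ^ m * jacobi_sum D d"
proof -
  have "top_sum D 1 = (int CARD('a) - 1) * jacobi_sum D (2 * g)"
    using jacobi_sum_top[of 0 "2 * g"] by (simp add: jacobi_sum_0)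
  then have "(int CARD('a) - 1) * (jacobi_sum D m * jacobi_sum D (2 * g)) =
      (int CARD('a) - 1) * (int CARD('a) ^ m * jacobi_sum D d)"
    using jacobi_sum_top[OF assms] by (simp add: mult_ac)
  moreover have "int CARD('a) - 1 \<noteq> 0" using card_field_gt_1[where 'a='a] by simp
  ultimately show ?thesis by simp
qed

text \<open>Primitivity at a = 0 shows that the character is nontrivial.\<close>

lemma jacobi_sum_eq_0:
  assumes "m > 2 * g"
  shows "jacobi_sum D m = 0"
proof -
  have "\<not> coprime D 0" using hyp_family_props by (auto simp: is_unit_iff_degree)
  then obtain b where "jacobi D b = -1"
    using primitive_jacobi[OF odd_card hyp_family_props(1,2)] by blast
  then show ?thesis
    using assms hyp_family_props by (intro jacobi_sum_eq_0_if_nontrivial) auto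
qed

lemma chi_sum_eq: "(\<Sum>f\<in>monics m. chi D f) = eta (-1::'a) ^ m * jacobi_sum D m"
  unfolding jacobi_sum_def sum_distrib_left
  by (rule sum.cong[OF refl]) (auto simp: chi_eq_jacobi[OF odd_card hyp_family_props(1,5)] monics_def)

text \<open>The signs from reciprocity drop out: m and d have the same parity, and the sign attached
  to degree 2g is 1.\<close>

lemma chi_sum_functional_eq:
  assumes "m + d = 2 * g"
  shows "(\<Sum>f\<in>monics m. chi D f) * (\<Sum>f\<in>monics (2 * g). chi D f) =
           int CARD('a) ^ m * (\<Sum>f\<in>monics d. chi D f)"
proof -
  let ?e = "eta (-1::'a)"
  have "?e * ?e = 1" by (rule eta_square) simp
  then have "?e ^ (2 * g) = 1" by (simp add: power_mult power2_eq_square)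
  moreover have "even m \<longleftrightarrow> even d" using assms by presburger
  then have "?e ^ m = ?e ^ d" using eta_values[of "-1::'a"] by (auto simp: minus_one_power_iff)
  ultimately show ?thesis
    using jacobi_sum_functional_eq[OF assms] by (simp add: chi_sum_eq mult.assoc mult.left_commute)
qed

lemma chi_sum_eq_0: "m > 2 * g \<Longrightarrow> (\<Sum>f\<in>monics m. chi D f) = 0"
  by (simp add: chi_sum_eq jacobi_sum_eq_0)

end

end

section \<open>Logarithmic derivatives\<close>

text \<open>
  The sum of \<open>F\<close> against the von Mangoldt function in degree \<open>k\<close>, that is, for completely multiplicative
  \<open>F\<close> the coefficient of \<open>u ^ k\<close> in \<open>u Z'(u) / Z(u)\<close>, where \<open>Z(u)\<close> is the sum of \<open>F f * u ^ degree f\<close>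
  over monic \<open>f\<close>.
\<close>

definition vm_coeff :: "('a::{finite,field_gcd} poly \<Rightarrow> 'b::comm_ring_1) \<Rightarrow> nat \<Rightarrow> 'b" where
  "vm_coeff F k = (\<Sum>d | d dvd k. of_nat d * (\<Sum>P\<in>monic_irreds d. F P ^ (k div d)))"

lemma monic_irreds_iff: "P \<in> monic_irreds n \<longleftrightarrow> prime P \<and> degree P = n"
  by (auto simp: monic_irreds_def prime_poly_iff)

lemma monic_irreds_subset: "monic_irreds n \<subseteq> monics n"
  by (auto simp: monic_irreds_def monics_def)

lemma finite_monic_irreds [simp]: "finite (monic_irreds n :: 'a::{finite,field_gcd} poly set)"
  using finite_subset[OF monic_irreds_subset] by simp

lemma card_monic_irreds_le:
  "card (monic_irreds n :: 'a::{finite,field_gcd} poly set) \<le> CARD('a) ^ n"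
  using card_mono[OF _ monic_irreds_subset] by (metis card_monics finite_monics)

lemma prime_degree_pos: "prime (P :: 'a::{finite,field_gcd} poly) \<Longrightarrow> degree P > 0"
proof (rule ccontr)
  assume P: "prime P" "\<not> degree P > 0"
  then obtain c where c: "P = [:c:]" using degree_eq_zeroE by blast
  moreover have "P \<noteq> 0" using P by auto
  ultimately have "is_unit P" by (simp add: is_unit_const_poly_iff dvd_field_iff)
  then show False using P not_prime_unit by blast
qed

lemma monic_irreds_0 [simp]: "monic_irreds 0 = {}"
  by (fastforce simp: monic_irreds_iff dest: prime_degree_pos)

lemma degree_prod_mset_nonzero:
  "0 \<notin># M \<Longrightarrow> degree (prod_mset M :: 'a::idom poly) = (\<Sum>P\<in>#M. degree P)"
  by (induction M) (auto simp: degree_mult_eq)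

lemma sum_mset_eq_sum_count:
  "(\<Sum>x\<in>#M. h x) = (\<Sum>x\<in>set_mset M. of_nat (count M x) * (h x :: 'b :: comm_semiring_1))"
proof (induction M)
  case (add y M)
  have "(\<Sum>x\<in>set_mset (add_mset y M). of_nat (count (add_mset y M) x) * h x) =
        (\<Sum>x\<in>insert y (set_mset M). of_nat (count M x) * h x + (if x = y then h x else 0))"
    by (rule sum.cong) (auto simp: algebra_simps)
  also have "\<dots> = (\<Sum>x\<in>insert y (set_mset M). of_nat (count M x) * h x) + (\<Sum>x\<in>insert y (set_mset M). if x = y then h x else 0)"
    by (rule sum.distrib)
  also have "(\<Sum>x\<in>insert y (set_mset M). of_nat (count M x) * h x) = (\<Sum>x\<in>set_mset M. of_nat (count M x) * h x)"
    by (rule sum.mono_neutral_right) (auto simp: not_in_iff)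
  finally show ?case using add by (simp add: sum.delta add.commute)
qed simp

text \<open>The analogue of the identity log n = sum of Lambda(d) over d dividing n: a prime P of
  multiplicity e divides f in the powers i = 1, ..., e.\<close>

lemma degree_eq_sum_prime_powers:
  fixes f :: "'a::{finite,field_gcd} poly"
  assumes f: "f \<in> monics n"
  shows "n = (\<Sum>(P, i)\<in>{(P, i). prime P \<and> i \<ge> 1 \<and> P ^ i dvd f}. degree P)"
proof -
  have lf: "lead_coeff f = 1" and f0: "f \<noteq> 0" and df: "degree f = n" using f by (auto simp: monics_def)
  have nz: "0 \<notin># prime_factorization f" using in_prime_factors_imp_prime by fastforce
  have set: "{(P, i). prime P \<and> i \<ge> 1 \<and> P ^ i dvd f} = Sigma (prime_factors f) (\<lambda>P. {1..multiplicity P f})"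
  proof safe
    fix P i assume P: "prime P" "i \<ge> 1" "P ^ i dvd f"
    have "P dvd P ^ i" using P(2) by (simp add: dvd_power)
    then have "P dvd f" using P(3) dvd_trans by blast
    then show "P \<in> prime_factors f" using P(1) f0 by (simp add: prime_factors_dvd)
    show "i \<in> {1..multiplicity P f}"
      using P f0 by (auto intro: multiplicity_geI)
  next
    fix P i assume "P \<in> prime_factors f" "i \<in> {1..multiplicity P f}"
    then show "prime P" "1 \<le> i" "P ^ i dvd f" by (auto intro: multiplicity_dvd')
  qed
  have "n = (\<Sum>P\<in>#prime_factorization f. degree P)"
    using degree_prod_mset_nonzero[OF nz] prod_mset_prime_factorization_monic[OF lf] df by simp
  also have "\<dots> = (\<Sum>P\<in>prime_factors f. multiplicity P f * degree P)"
    unfolding sum_mset_eq_sum_count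
    by (rule sum.cong[OF refl]) (simp add: count_prime_factorization_prime in_prime_factors_imp_prime)
  also have "\<dots> = (\<Sum>P\<in>prime_factors f. \<Sum>i\<in>{1..multiplicity P f}. degree P)" by simp
  also have "\<dots> = (\<Sum>(P, i)\<in>Sigma (prime_factors f) (\<lambda>P. {1..multiplicity P f}). degree P)"
    by (rule sum.Sigma) auto
  finally show ?thesis by (simp only: set)
qed

definition monic_mult_fun :: "('a::{finite,field_gcd} poly \<Rightarrow> 'b::comm_ring_1) \<Rightarrow> bool" where
  "monic_mult_fun F \<longleftrightarrow> F 1 = 1 \<and> (\<forall>f g. lead_coeff f = 1 \<longrightarrow> lead_coeff g = 1 \<longrightarrow> F (f * g) = F f * F g)"

lemma monic_mult_fun_power:
  assumes "monic_mult_fun F" "lead_coeff P = 1"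
  shows "F (P ^ i) = F P ^ i \<and> lead_coeff (P ^ i) = 1"
  using assms by (induction i) (auto simp: monic_mult_fun_def lead_coeff_mult lead_coeff_power)

lemma sum_multiples_monic:
  fixes F :: "'a::{finite,field_gcd} poly \<Rightarrow> 'b::comm_ring_1"
  assumes F: "monic_mult_fun F" and h: "lead_coeff h = 1" "degree h \<le> n"
  shows "(\<Sum>f | f \<in> monics n \<and> h dvd f. F f) = F h * (\<Sum>f\<in>monics (n - degree h). F f)"
proof -
  have h0: "h \<noteq> 0" using h by auto
  have "(\<Sum>f | f \<in> monics n \<and> h dvd f. F f) = (\<Sum>f\<in>monics (n - degree h). F (h * f))"
  proof (rule sum.reindex_bij_witness[of _ "\<lambda>f. h * f" "\<lambda>f. f div h"])
    fix f assume "f \<in> {f. f \<in> monics n \<and> h dvd f}"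
    then obtain k where k: "f = h * k" "f \<in> monics n" by (auto elim: dvdE)
    then have "lead_coeff k = 1" "k \<noteq> 0" using h by (auto simp: monics_def lead_coeff_mult)
    moreover have "degree k = n - degree h"
      using k h0 \<open>k \<noteq> 0\<close> by (auto simp: monics_def degree_mult_eq)
    ultimately show "f div h \<in> monics (n - degree h)" "h * (f div h) = f" "F (h * (f div h)) = F f"
      using k h0 by (auto simp: monics_def)
  next
    fix k :: "'a poly" assume k: "k \<in> monics (n - degree h)"
    then have "lead_coeff k = 1" "degree k = n - degree h" "k \<noteq> 0" by (auto simp: monics_def)
    then have "degree (h * k) = n" using h h0 by (simp add: degree_mult_eq)
    moreover have "lead_coeff (h * k) = 1"
      unfolding lead_coeff_mult h(1) \<open>lead_coeff k = 1\<close> by simp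
    ultimately
    show "h * k \<in> {f. f \<in> monics n \<and> h dvd f}" "h * k div h = k"
      using h0 by (simp_all only: monics_def mem_Collect_eq simp_thms dvd_triv_left nonzero_mult_div_cancel_left)
  qed
  also have "\<dots> = (\<Sum>f\<in>monics (n - degree h). F h * F f)"
  proof (rule sum.cong[OF refl])
    fix f :: "'a poly" assume "f \<in> monics (n - degree h)"
    then have "lead_coeff f = 1" by (auto simp: monics_def)
    then show "F (h * f) = F h * F f" using F h unfolding monic_mult_fun_def by blast
  qed
  finally show ?thesis by (simp add: sum_distrib_left)
qed

text \<open>The coefficients of u Z' = (u Z'/Z) Z. The degree n is written as a sum over the prime
  powers P^i dividing f; after exchanging sums, the multiples of P^i contribute F(P)^i times a
  coefficient of lower degree, and terms are grouped by k = i deg P.\<close>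

lemma log_deriv_recurrence:
  fixes F :: "'a::{finite,field_gcd} poly \<Rightarrow> 'b::comm_ring_1"
  assumes F: "monic_mult_fun F"
  shows "of_nat n * (\<Sum>f\<in>monics n. F f) = (\<Sum>k=1..n. vm_coeff F k * (\<Sum>f\<in>monics (n - k). F f))"
proof -
  let ?c = "\<lambda>n. \<Sum>f\<in>monics n. F f"
  let ?T = "\<lambda>f. {(P, i). prime P \<and> i \<ge> 1 \<and> P ^ i dvd (f :: 'a poly)}"
  \<comment> \<open>All prime powers of degree at most n, indexed by k = i deg P and d = deg P so
    that the sum over T splits into the coefficients \<open>vm_coeff F k\<close>.\<close>
  define T where "T = (\<Union>k\<in>{1..n}. \<Union>d\<in>{d. d dvd k}. (\<lambda>P. (P, k div d)) ` (monic_irreds d :: 'a poly set))"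
  have finT: "finite T" unfolding T_def by (intro finite_UN_I finite_imageI) auto
  have T_iff: "(P, i) \<in> T \<longleftrightarrow> prime P \<and> i \<ge> 1 \<and> i * degree P \<le> n" for P i
  proof
    assume "(P, i) \<in> T"
    then have "\<exists>k\<in>{1..n}. \<exists>d\<in>{d. d dvd k}. (P, i) \<in> (\<lambda>P. (P, k div d)) ` (monic_irreds d :: 'a poly set)"
      by (simp only: T_def UN_iff)
    then obtain k d where "k \<in> {1..n}" "d \<in> {d. d dvd k}"
      "(P, i) \<in> (\<lambda>P. (P, k div d)) ` (monic_irreds d :: 'a poly set)" by (elim bexE)
    then have kd: "k \<in> {1..n}" "d dvd k" "P \<in> monic_irreds d" "i = k div d" by auto
    then have "d > 0" by (intro gr0I) simp
    then have "i * d = k" using kd by simp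
    then have "i \<ge> 1" using kd by (cases i) auto
    then show "prime P \<and> i \<ge> 1 \<and> i * degree P \<le> n" using kd \<open>i * d = k\<close> by (auto simp: monic_irreds_iff)
  next
    assume P: "prime P \<and> i \<ge> 1 \<and> i * degree P \<le> n"
    then have "i * degree P \<in> {1..n}" using prime_degree_pos[of P] by auto
    moreover have "(P, i) \<in> (\<lambda>Q. (Q, (i * degree P) div degree P)) ` monic_irreds (degree P)"
      using P prime_degree_pos[of P] by (auto simp: monic_irreds_iff)
    ultimately show "(P, i) \<in> T"
      unfolding T_def UN_iff by (intro bexI[of _ "i * degree P"] bexI[of _ "degree P"]) simp_all
  qed
  have sub: "?T f = {p \<in> T. fst p ^ snd p dvd f}" if f: "f \<in> monics n" for f
  proof -
    have "i * degree P \<le> n" if "prime P" "P ^ i dvd f" for P i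
    proof -
      have "P \<noteq> 0" using that(1) by auto
      then have "degree (P ^ i) = i * degree P" by (rule degree_power_eq)
      moreover have "degree (P ^ i) \<le> degree f"
        using f by (intro dvd_imp_degree_le[OF that(2)]) (auto simp: monics_def)
      ultimately show ?thesis using f by (simp add: monics_def)
    qed
    then show ?thesis using T_iff by auto
  qed
  have "of_nat n * ?c n = (\<Sum>f\<in>monics n. F f * of_nat n)" by (simp add: sum_distrib_left mult.commute)
  also have "\<dots> = (\<Sum>f\<in>monics n. \<Sum>p\<in>T. if fst p ^ snd p dvd f then F f * of_nat (degree (fst p)) else 0)"
  proof (rule sum.cong[OF refl])
    fix f :: "'a poly" assume f: "f \<in> monics n"
    have "of_nat n = (of_nat (\<Sum>p\<in>?T f. degree (fst p)) :: 'b)"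
      using degree_eq_sum_prime_powers[OF f] by (simp only: case_prod_unfold)
    also have "\<dots> = (\<Sum>p\<in>T. if fst p ^ snd p dvd f then of_nat (degree (fst p)) else 0)"
      by (simp only: sub[OF f] of_nat_sum sum.inter_filter[OF finT]) (rule sum.cong[OF refl], simp)
    finally show "F f * of_nat n = (\<Sum>p\<in>T. if fst p ^ snd p dvd f then F f * of_nat (degree (fst p)) else 0)"
      by (simp add: sum_distrib_left if_distrib cong: if_cong)
  qed
  also have "\<dots> = (\<Sum>p\<in>T. \<Sum>f\<in>monics n. if fst p ^ snd p dvd f then F f * of_nat (degree (fst p)) else 0)"
    by (rule sum.swap)
  also have "\<dots> = (\<Sum>p\<in>T. of_nat (degree (fst p)) * F (fst p) ^ snd p * ?c (n - snd p * degree (fst p)))"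
  proof (rule sum.cong[OF refl], safe)
    fix P i assume "(P, i) \<in> T"
    then have P: "prime P" "i \<ge> 1" "i * degree P \<le> n" by (auto simp: T_iff)
    then have lP: "lead_coeff P = 1" by (simp add: prime_poly_iff)
    note pw = monic_mult_fun_power[OF F lP, of i]
    have dP: "degree (P ^ i) = i * degree P" using lP by (subst degree_power_eq) auto
    have "(\<Sum>f\<in>monics n. if P ^ i dvd f then F f * of_nat (degree P) else 0) =
       (\<Sum>f | f \<in> monics n \<and> P ^ i dvd f. F f * of_nat (degree P))"
      by (simp add: sum.inter_filter)
    also have "\<dots> = of_nat (degree P) * (\<Sum>f | f \<in> monics n \<and> P ^ i dvd f. F f)"
      by (simp add: sum_distrib_left mult.commute)
    also have "\<dots> = of_nat (degree P) * F P ^ i * ?c (n - i * degree P)"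
      using sum_multiples_monic[OF F, of "P ^ i" n] pw P(3) dP by simp
    finally show "(\<Sum>f\<in>monics n. if fst (P, i) ^ snd (P, i) dvd f then F f * of_nat (degree (fst (P, i))) else 0) =
       of_nat (degree (fst (P, i))) * F (fst (P, i)) ^ snd (P, i) * ?c (n - snd (P, i) * degree (fst (P, i)))"
      by (simp only: fst_conv snd_conv)
  qed
  also have "\<dots> = (\<Sum>k\<in>{1..n}. \<Sum>d\<in>{d. d dvd k}. \<Sum>P\<in>monic_irreds d. of_nat d * F P ^ (k div d) * ?c (n - k))"
  proof -
    let ?G = "\<lambda>p. of_nat (degree (fst p)) * F (fst p) ^ snd p * ?c (n - snd p * degree (fst p))"
    have inner: "sum ?G (\<Union>d\<in>{d. d dvd k}. (\<lambda>P. (P, k div d)) ` (monic_irreds d :: 'a poly set)) =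
       (\<Sum>d\<in>{d. d dvd k}. \<Sum>P\<in>monic_irreds d. of_nat d * F P ^ (k div d) * ?c (n - k))"
      if k: "k \<in> {1..n}" for k
    proof -
      have "sum ?G (\<Union>d\<in>{d. d dvd k}. (\<lambda>P. (P, k div d)) ` (monic_irreds d :: 'a poly set)) =
         (\<Sum>d\<in>{d. d dvd k}. sum ?G ((\<lambda>P. (P, k div d)) ` (monic_irreds d :: 'a poly set)))"
        using k by (intro sum.UNION_disjoint) (auto simp: monic_irreds_iff)
      also have "\<dots> = (\<Sum>d\<in>{d. d dvd k}. \<Sum>P\<in>monic_irreds d. ?G (P, k div d))"
        by (intro sum.cong refl) (subst sum.reindex, auto simp: inj_on_def)
      also have "\<dots> = (\<Sum>d\<in>{d. d dvd k}. \<Sum>P\<in>monic_irreds d. of_nat d * F P ^ (k div d) * ?c (n - k))"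
        using k by (intro sum.cong refl) (auto simp: monic_irreds_iff)
      finally show ?thesis .
    qed
    have "sum ?G T = (\<Sum>k\<in>{1..n}. sum ?G (\<Union>d\<in>{d. d dvd k}. (\<lambda>P. (P, k div d)) ` (monic_irreds d :: 'a poly set)))"
      unfolding T_def
    proof (rule sum.UNION_disjoint)
      show "\<forall>k\<in>{1..n}. \<forall>l\<in>{1..n}. k \<noteq> l \<longrightarrow>
         (\<Union>d\<in>{d. d dvd k}. (\<lambda>P. (P, k div d)) ` (monic_irreds d :: 'a poly set)) \<inter>
         (\<Union>d\<in>{d. d dvd l}. (\<lambda>P. (P, l div d)) ` monic_irreds d) = {}"
      proof (intro ballI impI)
        fix k l :: nat assume kl: "k \<in> {1..n}" "l \<in> {1..n}" "k \<noteq> l"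
        have "False" if "d dvd k" "e dvd l" "(P, k div d) = (Q, l div e)" "P \<in> monic_irreds d" "Q \<in> monic_irreds e" 
          for d e and P Q :: "'a poly"
          using that kl by (auto simp: monic_irreds_iff)
        then show "(\<Union>d\<in>{d. d dvd k}. (\<lambda>P. (P, k div d)) ` (monic_irreds d :: 'a poly set)) \<inter>
         (\<Union>d\<in>{d. d dvd l}. (\<lambda>P. (P, l div d)) ` monic_irreds d) = {}" by blast
      qed
    qed auto
    then show ?thesis using inner by simp
  qed
  also have "\<dots> = (\<Sum>k=1..n. vm_coeff F k * ?c (n - k))"
  proof (rule sum.cong[OF refl])
    fix k
    have "vm_coeff F k * x = (\<Sum>d | d dvd k. \<Sum>P\<in>monic_irreds d. of_nat d * F P ^ (k div d) * x)" for x
      by (simp add: vm_coeff_def sum_distrib_left sum_distrib_right mult.assoc)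
    then show "(\<Sum>d | d dvd k. \<Sum>P\<in>monic_irreds d. of_nat d * F P ^ (k div d) * ?c (n - k)) =
        vm_coeff F k * ?c (n - k)" by (rule sym)
  qed
  finally show ?thesis .
qed

text \<open>Gauss's count of the primes. For F = 1 the coefficients of Z are q^n, and the recurrence
  reads n q^n = v_n + (n - 1) q^n by induction.\<close>

lemma vm_coeff_one:
  assumes "k \<ge> 1"
  shows "(\<Sum>d | d dvd k. d * card (monic_irreds d :: 'a::{finite,field_gcd} poly set)) = CARD('a) ^ k"
proof -
  let ?q = "CARD('a)"
  let ?F = "\<lambda>f :: 'a poly. 1 :: int"
  have F: "monic_mult_fun ?F" by (simp add: monic_mult_fun_def)
  have "vm_coeff ?F k = int ?q ^ k" using assms
  proof (induction k rule: less_induct)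
    case (less k)
    let ?s = "\<Sum>j=1..<k. int ?q ^ j * int ?q ^ (k - j)"
    have "int k * int ?q ^ k = (\<Sum>j=1..k. vm_coeff ?F j * int ?q ^ (k - j))"
      using log_deriv_recurrence[OF F, of k] by (simp add: card_monics)
    also have "{1..k} = insert k {1..<k}" using less.prems by auto
    also have "(\<Sum>j\<in>insert k {1..<k}. vm_coeff ?F j * int ?q ^ (k - j)) = vm_coeff ?F k + ?s"
      using less by (subst sum.insert) auto
    also have "?s = (\<Sum>j=1..<k. int ?q ^ k)" by (intro sum.cong refl) (simp flip: power_add)
    also have "\<dots> = int k * int ?q ^ k - int ?q ^ k" using less.prems by (simp add: of_nat_diff algebra_simps)
    finally show ?case by simp
  qed
  then have "int (\<Sum>d | d dvd k. d * card (monic_irreds d :: 'a poly set)) = int (?q ^ k)"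
    by (simp add: vm_coeff_def)
  then show ?thesis by (simp only: of_nat_eq_iff)
qed

section \<open>The zeros of the L-function\<close>

text \<open>In power series X p' = - p S, where S is the generating series of the power sums; a new
  linear factor 1 - a X adds the geometric series a X / (1 - a X) to S.\<close>

lemma newton_identity:
  fixes A :: "'b::{idom} multiset"
  defines "p \<equiv> \<Prod>a\<in>#A. [:1, - a:]"
  shows "of_nat n * coeff p n = - (\<Sum>k=1..n. (\<Sum>a\<in>#A. a ^ k) * coeff p (n - k))"
proof -
  let ?P = "\<lambda>A. fps_of_poly (\<Prod>a\<in>#A. [:1, - a:] :: 'b poly)"
  let ?S = "\<lambda>A :: 'b multiset. Abs_fps (\<lambda>k. if k = 0 then 0 else \<Sum>a\<in>#A. a ^ k)"
  have main: "fps_X * fps_deriv (?P A) = - (?P A * ?S A)"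
  proof (induction A)
    case empty
    show ?case by (simp add: fps_eq_iff)
  next
    case (add a A)
    let ?l = "1 - fps_const a * fps_X :: 'b fps"
    let ?E = "Abs_fps (\<lambda>k. if k = 0 then 0 else a ^ k)"
    have l: "fps_of_poly [:1, - a:] = ?l"
      by (simp add: fps_of_poly_pCons mult.commute flip: fps_const_neg)
    have E: "?l * ?E = fps_const a * fps_X"
    proof (rule fps_ext)
      fix n show "fps_nth (?l * ?E) n = fps_nth (fps_const a * fps_X) n"
        by (cases n) (auto simp: left_diff_distrib mult.assoc fps_X_nth)
    qed
    have S: "?S (add_mset a A) = ?E + ?S A" by (simp add: fps_eq_iff)
    have P: "?P (add_mset a A) = ?l * ?P A" by (simp add: fps_of_poly_mult l)
    have dl: "fps_deriv ?l = - fps_const a" by simp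
    have "fps_X * fps_deriv (?P (add_mset a A)) = ?l * (fps_X * fps_deriv (?P A)) - fps_const a * fps_X * ?P A"
      unfolding P fps_deriv_mult dl by (simp add: algebra_simps)
    also have "\<dots> = - (?l * ?P A * ?S A) - (?l * ?E) * ?P A"
      unfolding add.IH E by (simp add: algebra_simps)
    also have "\<dots> = - (?P (add_mset a A) * ?S (add_mset a A))"
      unfolding P S by (simp add: algebra_simps)
    finally show ?case .
  qed
  have "of_nat n * coeff p n = fps_nth (fps_X * fps_deriv (?P A)) n"
    unfolding p_def by (cases n) simp_all
  also have "\<dots> = - fps_nth (?S A * ?P A) n" unfolding main by (simp add: mult.commute)
  also have "fps_nth (?S A * ?P A) n = (\<Sum>k=0..n. fps_nth (?S A) k * coeff p (n - k))"
    by (simp add: fps_mult_nth p_def)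
  also have "\<dots> = (\<Sum>k=1..n. fps_nth (?S A) k * coeff p (n - k))"
    by (rule sum.mono_neutral_right) auto
  also have "\<dots> = (\<Sum>k=1..n. (\<Sum>a\<in>#A. a ^ k) * coeff p (n - k))"
    by (rule sum.cong) auto
  finally show ?thesis .
qed

text \<open>The system is triangular with diagonal entry \<open>c 0 = 1\<close>.\<close>

lemma recurrence_unique:
  fixes s t c :: "nat \<Rightarrow> 'b::comm_ring_1"
  assumes "c 0 = 1" "\<And>n. (\<Sum>k=1..n. s k * c (n - k)) = (\<Sum>k=1..n. t k * c (n - k))" "k \<ge> 1"
  shows "s k = t k"
  using assms(3)
proof (induction k rule: less_induct)
  case (less k)
  have "{1..k} = insert k {1..<k}" using less.prems by auto
  then have split: "(\<Sum>j=1..k. u j * c (k - j)) = u k + (\<Sum>j=1..<k. u j * c (k - j))" for u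
    using assms(1) by simp
  have "(\<Sum>j=1..<k. s j * c (k - j)) = (\<Sum>j=1..<k. t j * c (k - j))"
    using less by (intro sum.cong) auto
  then show ?case using assms(2)[of k] split[of s] split[of t] by simp
qed

lemma of_real_power_powr:
  assumes "x > 0"
  shows "complex_of_real (x ^ n) powr s = (of_real x powr s) ^ n"
proof -
  have "complex_of_real (x ^ n) powr s = exp (s * of_real (ln (x ^ n)))"
    using assms by (simp add: powr_def Ln_of_real flip: of_real_power)
  also have "\<dots> = exp (of_nat n * (s * of_real (ln x)))"
    using assms by (simp add: ln_realpow mult_ac)
  also have "\<dots> = (of_real x powr s) ^ n"
    using assms by (simp only: exp_of_nat_mult) (simp add: powr_def Ln_of_real)
  finally show ?thesis .
qed

text \<open>The L-function as a polynomial in u = q^(-s). For D in the family the coefficients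
  beyond this range vanish.\<close>

definition Lpoly :: "'a::{finite,field_gcd} poly \<Rightarrow> complex poly" where
  "Lpoly D = (\<Sum>m<degree D. monom (of_int (\<Sum>f\<in>monics m. chi D f)) m)"

text \<open>The ordinate of the zero at which \<open>q powr - s\<close> has the value \<open>\<rho>\<close>.\<close>
definition ordinate :: "nat \<Rightarrow> complex \<Rightarrow> complex" where
  "ordinate q \<rho> = \<i> * (1 / 2 - Ln (1 / \<rho>) / of_real (ln (real q)))"

lemma zorder_poly:
  assumes "p \<noteq> (0 :: complex poly)"
  shows "zorder (poly p) u = int (order u p)"
proof -
  obtain r where r: "p = [:- u, 1:] ^ order u p * r" "\<not> [:- u, 1:] dvd r"
    using order_decomp[OF assms] by blast
  have "poly r u \<noteq> 0" using r(2) by (simp add: poly_eq_0_iff_dvd)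
  moreover have "poly p w = poly r w * (w - u) powi int (order u p)" for w
    by (subst r(1)) (simp add: poly_power mult.commute)
  ultimately show ?thesis by (intro zorder_eqI[of UNIV u "poly r"]) (auto intro: holomorphic_intros)
qed

context
  fixes D :: "'a::{finite,field_gcd} poly" and g :: nat
  assumes odd_card: "odd CARD('a)" and D: "D \<in> hyp_family g"
begin

lemma coeff_Lpoly: "coeff (Lpoly D) m = of_int (\<Sum>f\<in>monics m. chi D f)"
proof -
  have "coeff (Lpoly D) m = (if m < degree D then of_int (\<Sum>f\<in>monics m. chi D f) else 0)"
    by (simp add: Lpoly_def coeff_sum)
  then show ?thesis using chi_sum_eq_0[OF odd_card D, of m] hyp_family_props[OF odd_card D]
    by (auto simp: not_less simp flip: of_int_sum)
qed

lemma coeff_Lpoly_0: "coeff (Lpoly D) 0 = 1"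
  by (simp add: coeff_Lpoly monics_0)

lemma Lpoly_nonzero: "Lpoly D \<noteq> 0"
  using coeff_Lpoly_0 by auto

lemma coeff_Lpoly_functional_eq:
  assumes "m + d = 2 * g"
  shows "coeff (Lpoly D) m * coeff (Lpoly D) (2 * g) = of_nat CARD('a) ^ m * coeff (Lpoly D) d"
  unfolding coeff_Lpoly
  using arg_cong[OF chi_sum_functional_eq[OF odd_card D assms], of "of_int :: int \<Rightarrow> complex"] by simp

lemma degree_Lpoly: "degree (Lpoly D) = 2 * g"
proof (rule antisym)
  show "degree (Lpoly D) \<le> 2 * g"
    by (rule degree_le) (simp add: coeff_Lpoly chi_sum_eq_0[OF odd_card D] flip: of_int_sum)
  \<comment> \<open>For m = 2g the functional equation says that the square of the top coefficient
    is q^(2g).\<close>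
  have "coeff (Lpoly D) (2 * g) \<noteq> 0"
    using coeff_Lpoly_functional_eq[of "2 * g" 0] by (auto simp: coeff_Lpoly_0)
  then show "2 * g \<le> degree (Lpoly D)" by (rule le_degree)
qed

lemma Lfun_eq_Lpoly: "Lfun D s = poly (Lpoly D) (of_nat CARD('a) powr (- s))"
proof -
  let ?u = "of_nat CARD('a) powr (- s) :: complex"
  let ?c = "\<lambda>n. of_int (\<Sum>f\<in>monics n. chi D f) :: complex"
  have q: "real CARD('a) > 0" by simp
  have "(\<Sum>f\<in>monics n. of_int (chi D f) * of_real (pnorm f) powr (- s)) = ?c n * ?u ^ n" for n
  proof -
    have "(\<Sum>f\<in>monics n. of_int (chi D f) * complex_of_real (pnorm f) powr (- s)) =
      (\<Sum>f\<in>monics n. of_int (chi D f) * ?u ^ n)"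
    proof (rule sum.cong[OF refl])
      fix f :: "'a poly" assume "f \<in> monics n"
      then have "pnorm f = real CARD('a) ^ n" by (auto simp: pnorm_def monics_def)
      then show "of_int (chi D f) * complex_of_real (pnorm f) powr (- s) = of_int (chi D f) * ?u ^ n"
        using of_real_power_powr[OF q, of n "- s"] by simp
    qed
    then show ?thesis by (simp add: sum_distrib_right)
  qed
  then have "Lfun D s = (\<Sum>n. ?c n * ?u ^ n)" unfolding Lfun_def by simp
  also have "\<dots> = (\<Sum>n<degree D. ?c n * ?u ^ n)"
  proof (rule suminf_finite)
    fix n assume "n \<notin> {..<degree D}"
    then have "(\<Sum>f\<in>monics n. chi D f) = 0"
      using hyp_family_props[OF odd_card D] by (intro chi_sum_eq_0[OF odd_card D]) auto
    then show "?c n * ?u ^ n = 0" by simp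
  qed simp
  also have "\<dots> = poly (Lpoly D) ?u" by (simp add: Lpoly_def poly_sum poly_monom)
  finally show ?thesis .
qed

lemma Lpoly_root_nonzero: "\<rho> \<in># proots (Lpoly D) \<Longrightarrow> \<rho> \<noteq> 0"
  using Lpoly_nonzero coeff_Lpoly_0 by (auto simp: poly_0_coeff_0)

lemma size_proots_Lpoly: "size (proots (Lpoly D)) = 2 * g"
  and Lpoly_factors: "Lpoly D = smult (coeff (Lpoly D) (2 * g)) (\<Prod>\<rho>\<in>#proots (Lpoly D). [:- \<rho>, 1:])"
proof -
  obtain A where A: "size A = degree (Lpoly D)" "Lpoly D = smult (lead_coeff (Lpoly D)) (\<Prod>x\<in>#A. [:- x, 1:])"
    using alg_closed_imp_factorization[OF Lpoly_nonzero] by blast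
  have "proots (Lpoly D) = proots (\<Prod>x\<in>#A. [:- x, 1:])"
    by (subst A(2)) (use Lpoly_nonzero in \<open>simp add: proots_smult\<close>)
  also have "\<dots> = A" by (induction A) (simp_all add: proots_mult prod_mset_zero_iff image_iff del: mult_pCons_left)
  finally have "proots (Lpoly D) = A" .
  then show "size (proots (Lpoly D)) = 2 * g"
    "Lpoly D = smult (coeff (Lpoly D) (2 * g)) (\<Prod>\<rho>\<in>#proots (Lpoly D). [:- \<rho>, 1:])"
    using A degree_Lpoly by simp_all
qed

text \<open>The constant term 1 fixes the factor in front of the product of the 1 - u/rho.\<close>

lemma Lpoly_eq_prod_inverse: "Lpoly D = (\<Prod>a\<in>#image_mset inverse (proots (Lpoly D)). [:1, - a:])"
proof -
  let ?p = "Lpoly D"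
  have *: "(\<Prod>\<rho>\<in>#R. [:- \<rho>, 1:]) = smult (\<Prod>\<rho>\<in>#R. - \<rho>) (\<Prod>\<rho>\<in>#R. [:1, - inverse \<rho>:])"
    if "0 \<notin># R" for R :: "complex multiset"
    using that
  proof (induction R)
    case (add x R)
    then have x: "[:- x, 1:] = smult (- x) [:1, - inverse x:]" by simp
    have IH: "(\<Prod>\<rho>\<in>#R. [:- \<rho>, 1:]) = smult (\<Prod>\<rho>\<in>#R. - \<rho>) (\<Prod>\<rho>\<in>#R. [:1, - inverse \<rho>:])"
      using add by simp
    show ?case
      unfolding image_mset_add_mset prod_mset.add_mset x IH
      by (simp only: mult_smult_left mult_smult_right smult_smult mult.commute)
  qed simp
  have "0 \<notin># proots ?p" using Lpoly_root_nonzero by blast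
  from *[OF this] have "?p = smult (coeff ?p (2 * g) * (\<Prod>\<rho>\<in>#proots ?p. - \<rho>)) (\<Prod>\<rho>\<in>#proots ?p. [:1, - inverse \<rho>:])"
    (is "_ = smult ?k ?Q") by (subst Lpoly_factors) simp
  moreover have "coeff ?Q 0 = 1"
    by (simp add: poly_0_coeff_0 [symmetric] poly_prod_mset image_mset.compositionality o_def)
  moreover have "coeff ?p 0 = ?k * coeff ?Q 0" by (subst calculation(1)) simp
  ultimately show ?thesis by (simp add: coeff_Lpoly_0 image_mset.compositionality o_def)
qed

text \<open>The functional equation states that the reversed polynomial at q u is the top
  coefficient times the polynomial itself. The factors of the former are 1 - q rho u, so the inverse
  roots are also the numbers q rho.\<close>

lemma Lpoly_eq_prod_dual: "Lpoly D = (\<Prod>a\<in>#image_mset (\<lambda>\<rho>. of_nat CARD('a) * \<rho>) (proots (Lpoly D)). [:1, - a:])"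
proof -
  let ?p = "Lpoly D" and ?q = "of_nat CARD('a) :: complex"
  let ?c = "coeff ?p (2 * g)"
  have c0: "?c \<noteq> 0" using Lpoly_nonzero degree_Lpoly by (metis leading_coeff_0_iff)
  have "smult ?c ?p = pcompose (reflect_poly ?p) [:0, ?q:]"
  proof (rule poly_eqI)
    fix m
    have "coeff (pcompose (reflect_poly ?p) [:0, ?q:]) m = ?q ^ m * coeff (reflect_poly ?p) m"
      by (simp add: coeff_pcompose_linear)
    also have "\<dots> = ?c * coeff ?p m"
    proof (cases "m \<le> 2 * g")
      case True
      then show ?thesis using coeff_Lpoly_functional_eq[of m "2 * g - m"] degree_Lpoly
        by (simp add: coeff_reflect_poly mult.commute)
    next
      case False
      then show ?thesis using degree_Lpoly by (simp add: coeff_reflect_poly coeff_eq_0)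
    qed
    finally show "coeff (smult ?c ?p) m = coeff (pcompose (reflect_poly ?p) [:0, ?q:]) m" by simp
  qed
  also have "reflect_poly ?p = smult ?c (\<Prod>\<rho>\<in>#proots ?p. [:1, - \<rho>:])"
  proof -
    have "reflect_poly (\<Prod>\<rho>\<in>#R. [:- \<rho>, 1:]) = (\<Prod>\<rho>\<in>#R. [:1, - \<rho>:])" if "0 \<notin># R" for R :: "complex multiset"
      using that by (induction R) (simp_all add: reflect_poly_mult reflect_poly_pCons del: mult_pCons_left)
    moreover have "0 \<notin># proots ?p" using Lpoly_root_nonzero by blast
    ultimately show ?thesis by (subst Lpoly_factors) (simp add: reflect_poly_smult)
  qed
  also have "pcompose (smult ?c (\<Prod>\<rho>\<in>#proots ?p. [:1, - \<rho>:])) [:0, ?q:] =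
      smult ?c (\<Prod>\<rho>\<in>#proots ?p. [:1, - (?q * \<rho>):])"
  proof -
    have "pcompose (\<Prod>\<rho>\<in>#R. [:1, - \<rho>:]) [:0, ?q:] = (\<Prod>\<rho>\<in>#R. [:1, - (?q * \<rho>):])" for R :: "complex multiset"
      by (induction R) (simp_all add: pcompose_1 pcompose_mult pcompose_pCons mult.commute del: mult_pCons_left)
    then show ?thesis by (simp add: pcompose_smult)
  qed
  finally have "smult ?c ?p = smult ?c (\<Prod>\<rho>\<in>#proots ?p. [:1, - (?q * \<rho>):])" .
  from arg_cong[OF this, of "smult (inverse ?c)"] show ?thesis
    using c0 by (simp add: image_mset.compositionality o_def)
qed

lemma monic_mult_fun_chi: "monic_mult_fun (\<lambda>f. of_int (chi D f) :: complex)"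
  unfolding monic_mult_fun_def using chi_mult monic_ne_0 by (auto simp: chi_mult monic_ne_0)

text \<open>Newton's identity and the logarithmic derivative of the Euler product are the same
  triangular system for the coefficients of \<open>Lpoly D\<close>.\<close>

lemma power_sum_from_product:
  assumes "Lpoly D = (\<Prod>a\<in>#A. [:1, - a:])" "k \<ge> 1"
  shows "(\<Sum>a\<in>#A. a ^ k) = - vm_coeff (\<lambda>f. of_int (chi D f)) k"
proof -
  let ?s = "\<lambda>k. \<Sum>a\<in>#A. a ^ k" and ?t = "\<lambda>k. - vm_coeff (\<lambda>f. of_int (chi D f) :: complex) k"
  have "(\<Sum>k=1..n. ?s k * coeff (Lpoly D) (n - k)) = (\<Sum>k=1..n. ?t k * coeff (Lpoly D) (n - k))" for n
  proof -
    have "(\<Sum>k=1..n. ?s k * coeff (Lpoly D) (n - k)) = - (of_nat n * coeff (Lpoly D) n)"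
      using newton_identity[of n A] by (simp flip: assms(1))
    also have "\<dots> = (\<Sum>k=1..n. ?t k * coeff (Lpoly D) (n - k))"
      using log_deriv_recurrence[OF monic_mult_fun_chi, of n] by (simp add: coeff_Lpoly sum_negf)
    finally show ?thesis .
  qed
  from recurrence_unique[of "coeff (Lpoly D)" ?s ?t, OF coeff_Lpoly_0 this assms(2)] show ?thesis .
qed


lemma power_sum_inverse:
  assumes "k \<ge> 1"
  shows "(\<Sum>\<rho>\<in>#proots (Lpoly D). inverse \<rho> ^ k) = - vm_coeff (\<lambda>f. of_int (chi D f)) k"
  using power_sum_from_product[OF Lpoly_eq_prod_inverse assms]
  by (simp add: image_mset.compositionality o_def)

lemma power_sum_dual:
  assumes "k \<ge> 1"
  shows "(\<Sum>\<rho>\<in>#proots (Lpoly D). (of_nat CARD('a) * \<rho>) ^ k) = - vm_coeff (\<lambda>f. of_int (chi D f)) k"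
  using power_sum_from_product[OF Lpoly_eq_prod_dual assms]
  by (simp add: image_mset.compositionality o_def)

text \<open>At the ordinate of rho the two exponentials in the cosine are q^(-k/2) rho^(-k) and
  q^(-k/2) (q rho)^k. Both power sums equal minus the von Mangoldt coefficient, the second by the
  functional equation.\<close>

lemma sum_cos_ordinates:
  fixes k :: nat
  defines "L \<equiv> ln (real CARD('a))"
  assumes "k \<ge> 1"
  shows "(\<Sum>\<rho>\<in>#proots (Lpoly D). cos (of_nat k * of_real L * ordinate CARD('a) \<rho>)) =
           - of_real (real CARD('a) powr (- real k / 2)) * vm_coeff (\<lambda>f. of_int (chi D f)) k"
proof -
  let ?q = "real CARD('a)" and ?R = "proots (Lpoly D)"
  let ?s = "complex_of_real (?q powr (- real k / 2))"
  have q1: "?q > 1" using card_field_gt_1[where 'a='a] by simp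
  then have L: "L > 0" by (simp add: L_def)
  have eL: "exp (of_real L) = (of_nat CARD('a) :: complex)"
    using q1 by (simp add: L_def exp_of_real)
  have "?s = of_real (exp (- (real k * L / 2)))"
    using q1 by (simp add: powr_def L_def)
  also have "\<dots> = exp (of_real (- (real k * L / 2)))" by (simp only: exp_of_real)
  finally have s: "exp (- of_nat k * of_real L / 2) = ?s" by simp
  have pt: "cos (of_nat k * of_real L * ordinate CARD('a) \<rho>) =
      ?s * ((inverse \<rho> ^ k + (of_nat CARD('a) * \<rho>) ^ k) / 2)" if "\<rho> \<noteq> 0" for \<rho>
  proof -
    have A: "\<i> * (of_nat k * of_real L * (\<i> * w)) = - of_nat k * (of_real L * w)" for w :: complex
    proof -
      have "\<i> * (of_nat k * of_real L * (\<i> * w)) = (\<i> * \<i>) * (of_nat k * (of_real L * w))"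
        by (simp only: mult_ac)
      then show ?thesis by simp
    qed
    have B: "of_real L * (1 / 2 - Ln (1 / \<rho>) / of_real L) = of_real L / 2 - Ln (1 / \<rho>)"
      using L by (simp add: right_diff_distrib)
    have "\<i> * (of_nat k * of_real L * ordinate CARD('a) \<rho>) =
        - of_nat k * (of_real L * (1 / 2 - Ln (1 / \<rho>) / of_real L))"
      unfolding ordinate_def L_def by (rule A[unfolded L_def])
    also have "\<dots> = - of_nat k * of_real L / 2 + of_nat k * Ln (1 / \<rho>)"
      unfolding B by (simp add: field_simps)
    finally have ord: "\<i> * (of_nat k * of_real L * ordinate CARD('a) \<rho>) =
        - of_nat k * of_real L / 2 + of_nat k * Ln (1 / \<rho>)" .
    have "exp (\<i> * (of_nat k * of_real L * ordinate CARD('a) \<rho>)) = ?s * inverse \<rho> ^ k"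
    proof -
      have "exp (of_nat k * Ln (1 / \<rho>)) = exp (Ln (1 / \<rho>)) ^ k" by (rule exp_of_nat_mult)
      also have "exp (Ln (1 / \<rho>)) = inverse \<rho>" using that by (simp add: divide_inverse)
      finally show ?thesis by (simp only: ord exp_add s)
    qed
    moreover have "exp (- (\<i> * (of_nat k * of_real L * ordinate CARD('a) \<rho>))) = ?s * (of_nat CARD('a) * \<rho>) ^ k"
    proof -
      have "- (\<i> * (of_nat k * of_real L * ordinate CARD('a) \<rho>)) =
         - of_nat k * of_real L / 2 + (of_nat k * of_real L + of_nat k * (- Ln (1 / \<rho>)))"
        unfolding ord by simp
      also have "exp \<dots> = ?s * (exp (of_real L) ^ k * exp (- Ln (1 / \<rho>)) ^ k)"
        by (simp only: exp_add s exp_of_nat_mult)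
      also have "exp (- Ln (1 / \<rho>)) = \<rho>" using that by (simp add: exp_minus)
      finally show ?thesis by (simp only: eL power_mult_distrib)
    qed
    ultimately show ?thesis unfolding cos_exp_eq by (simp only: distrib_left times_divide_eq_right)
  qed
  have "(\<Sum>\<rho>\<in>#?R. cos (of_nat k * of_real L * ordinate CARD('a) \<rho>)) =
    (\<Sum>\<rho>\<in>#?R. ?s * ((inverse \<rho> ^ k + (of_nat CARD('a) * \<rho>) ^ k) / 2))"
    by (rule arg_cong[of _ _ sum_mset], rule image_mset_cong, rule pt, erule Lpoly_root_nonzero)
  also have "\<dots> = ?s * (((\<Sum>\<rho>\<in>#?R. inverse \<rho> ^ k) + (\<Sum>\<rho>\<in>#?R. (of_nat CARD('a) * \<rho>) ^ k)) / 2)"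
    by (simp only: sum_mset_distrib_left [symmetric] sum_mset.distrib [symmetric] sum_mset_distrib_right [symmetric]
        divide_inverse image_mset.compositionality o_def)
  also have "\<dots> = - ?s * vm_coeff (\<lambda>f. of_int (chi D f)) k"
    unfolding power_sum_inverse[OF assms(2)] power_sum_dual[OF assms(2)] by simp
  finally show ?thesis .
qed

text \<open>The map s to q^(-s) has nonzero derivative, so orders of zeros are preserved. The strip
  -pi < Im \<le> pi of the principal logarithm is the half-open period of the ordinates, scaled by
  log q, so each root is met exactly once.\<close>

lemma sum_ordinates_eq:
  "(\<Sum>\<gamma>\<in>ordinates D. of_int (zorder (Lfun D) (1 / 2 + \<i> * \<gamma>)) * h \<gamma>) =
     (\<Sum>\<rho>\<in>#proots (Lpoly D). (h (ordinate CARD('a) \<rho>) :: complex))"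
proof -
  let ?q = "CARD('a)" and ?p = "Lpoly D"
  define L where "L = ln (real ?q)"
  have q1: "real ?q > 1" using card_field_gt_1[where 'a='a] by simp
  then have L: "L > 0" by (simp add: L_def)
  let ?e = "\<lambda>s. of_nat ?q powr (- s) :: complex"
  have e_exp: "?e s = exp (- (s * of_real L))" for s
  proof -
    have "Ln (of_real (real ?q)) = of_real L" unfolding L_def by (rule Ln_of_real) simp
    then show ?thesis by (simp add: powr_def)
  qed
  have Lf: "Lfun D = poly ?p \<circ> ?e" by (rule ext) (simp add: Lfun_eq_Lpoly)
  have ord: "zorder (Lfun D) s = int (order (?e s) ?p)" for s
  proof -
    have der: "(?e has_field_derivative - of_real L * ?e s) (at s)"
      unfolding e_exp by (auto intro!: derivative_eq_intros)
    have der0: "- of_real L * ?e s \<noteq> 0" using L q1 by simp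
    have an: "?e analytic_on {s}" unfolding e_exp by (intro analytic_intros)
    have "((\<lambda>w. (?e w - ?e s) / (w - s)) \<longlongrightarrow> - of_real L * ?e s) (at s)"
      using der by (simp add: has_field_derivative_iff)
    then have "eventually (\<lambda>w. (?e w - ?e s) / (w - s) \<noteq> 0) (at s)"
      using der0 by (rule tendsto_imp_eventually_ne)
    then have ev: "eventually (\<lambda>w. ?e w \<noteq> ?e s) (at s)" by eventually_elim auto
    have "finite {w. poly ?p w = 0}" using Lpoly_nonzero by (rule poly_roots_finite)
    then have "\<not> ?e s islimpt {w. poly ?p w = 0}" by (rule islimpt_finite)
    then have ev': "eventually (\<lambda>w. poly ?p w \<noteq> 0) (at (?e s))"
      by (simp add: islimpt_iff_eventually)
    have "poly ?p holomorphic_on UNIV" by (auto intro: holomorphic_intros)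
    then have "poly ?p analytic_on UNIV" by (simp add: analytic_on_open)
    then have anp: "poly ?p analytic_on {?e s}" by (rule analytic_on_subset) simp
    have "zorder (\<lambda>w. ?e w - ?e s) s = 1"
    proof (rule zorder_zero_eqI')
      show "(\<lambda>w. ?e w - ?e s) analytic_on {s}" by (intro analytic_intros an)
      have "((\<lambda>w. ?e w - ?e s) has_field_derivative - of_real L * ?e s - 0) (at s)"
        by (intro derivative_intros der)
      then have "deriv (\<lambda>w. ?e w - ?e s) s = - of_real L * ?e s" by (simp add: DERIV_imp_deriv)
      then show "(deriv ^^ nat 1) (\<lambda>w. ?e w - ?e s) s \<noteq> 0" using der0 by simp
    qed auto
    then show ?thesis
      unfolding Lf using zorder_compose'[OF isolated_singularity_at_analytic[OF anp] not_essential_analytic[OF anp] an ev' ev] zorder_poly[OF Lpoly_nonzero, of "?e s"] by simp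
  qed
  have e_ord: "?e (1 / 2 + \<i> * ordinate ?q \<rho>) = \<rho>" if "\<rho> \<noteq> 0" for \<rho>
  proof -
    have "(1 / 2 + \<i> * ordinate ?q \<rho>) * of_real L = Ln (1 / \<rho>)"
      using L by (simp add: ordinate_def L_def [symmetric] field_simps)
    then show ?thesis using that unfolding e_exp by (simp add: exp_minus)
  qed
  have "(\<Sum>\<gamma>\<in>ordinates D. of_int (zorder (Lfun D) (1 / 2 + \<i> * \<gamma>)) * h \<gamma>) =
     (\<Sum>\<rho>\<in>{\<rho>. poly ?p \<rho> = 0}. of_nat (order \<rho> ?p) * h (ordinate ?q \<rho>))"
  proof (rule sum.reindex_bij_witness[of _ "ordinate ?q" "\<lambda>\<gamma>. ?e (1 / 2 + \<i> * \<gamma>)"])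
    fix \<gamma> assume \<gamma>: "\<gamma> \<in> ordinates D"
    let ?u = "?e (1 / 2 + \<i> * \<gamma>)"
    have "1 / ?u = exp ((1 / 2 + \<i> * \<gamma>) * of_real L)"
    proof -
      have "1 / exp (- w) = exp w" for w :: complex by (simp add: exp_minus divide_inverse)
      then show ?thesis unfolding e_exp .
    qed
    moreover have "- pi / L < Re \<gamma>" "Re \<gamma> \<le> pi / L"
      using \<gamma> unfolding ordinates_def L_def by blast+
    then have "- pi < Re \<gamma> * L" "Re \<gamma> * L \<le> pi"
      by (simp_all only: pos_divide_less_eq[OF L] pos_le_divide_eq[OF L])
    ultimately have Ln: "Ln (1 / ?u) = (1 / 2 + \<i> * \<gamma>) * of_real L" by (simp only:) (rule Ln_exp, simp_all)
    have "(1 / 2 + \<i> * \<gamma>) * of_real L / of_real L = 1 / 2 + \<i> * \<gamma>" using L by simp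
    then show o: "ordinate ?q ?u = \<gamma>"
      unfolding ordinate_def Ln L_def by simp
    show "?u \<in> {\<rho>. poly ?p \<rho> = 0}" using \<gamma> by (simp add: ordinates_def Lf)
    show "of_nat (order ?u ?p) * h (ordinate ?q ?u) = of_int (zorder (Lfun D) (1 / 2 + \<i> * \<gamma>)) * h \<gamma>"
      by (simp only: ord o of_int_of_nat_eq)
  next
    fix \<rho> assume "\<rho> \<in> {\<rho>. poly ?p \<rho> = 0}"
    then have r: "poly ?p \<rho> = 0" "\<rho> \<noteq> 0" using Lpoly_root_nonzero[of \<rho>] Lpoly_nonzero by auto
    show "?e (1 / 2 + \<i> * ordinate ?q \<rho>) = \<rho>" by (rule e_ord) fact
    have "Re (ordinate ?q \<rho>) = Im (Ln (1 / \<rho>)) / L"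
      by (simp add: ordinate_def L_def)
    moreover have im: "- pi < Im (Ln (1 / \<rho>))" "Im (Ln (1 / \<rho>)) \<le> pi"
      using r(2) by (simp_all only: mpi_less_Im_Ln Im_Ln_le_pi divide_eq_0_iff one_neq_zero simp_thms)
    ultimately have "- pi / L < Re (ordinate ?q \<rho>)" "Re (ordinate ?q \<rho>) \<le> pi / L"
      using divide_strict_right_mono[OF im(1) L] divide_right_mono[OF im(2) less_imp_le[OF L]] by simp_all
    moreover have "Lfun D (1 / 2 + \<i> * ordinate ?q \<rho>) = 0"
      unfolding Lf o_def e_ord[OF r(2)] by (rule r)
    ultimately show "ordinate ?q \<rho> \<in> ordinates D" by (simp add: ordinates_def L_def)
  qed
  also have "\<dots> = (\<Sum>\<rho>\<in>#proots ?p. h (ordinate ?q \<rho>))"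
    using Lpoly_nonzero by (simp add: sum_mset_eq_sum_count)
  finally show ?thesis .
qed

end

section \<open>Averages over the family\<close>

definition sqfree_monics :: "nat \<Rightarrow> 'a::{finite,field_gcd} poly set" where
  "sqfree_monics n = {D \<in> monics n. squarefree D}"

lemma hyp_family_eq: "hyp_family g = sqfree_monics (2 * g + 1)"
  by (auto simp: hyp_family_def sqfree_monics_def monics_def)

lemma finite_sqfree_monics [simp]: "finite (sqfree_monics n :: 'a::{finite,field_gcd} poly set)"
  by (simp add: sqfree_monics_def)

lemma card_sqfree_monics_le: "card (sqfree_monics n :: 'a::{finite,field_gcd} poly set) \<le> CARD('a) ^ n"
  unfolding card_monics[symmetric] by (rule card_mono) (auto simp: sqfree_monics_def)

lemma squarefree_multiplicity_div_2:
  fixes D :: "'a::{finite,field_gcd} poly"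
  assumes "squarefree D" "D \<noteq> 0" "prime p"
  shows "multiplicity p D div 2 = 0"
proof (cases "p \<in> prime_factors D")
  case True
  then show ?thesis using assms squarefree_factorial_semiring'[of D] by simp
next
  case False
  then have "\<not> p dvd D" using assms by (simp add: prime_factors_dvd)
  then show ?thesis by (simp add: not_dvd_imp_multiplicity_0)
qed

text \<open>Uniqueness of N = D E^2: at each prime the exponent in E is half the exponent in N,
  rounded down, since a square-free D has exponents 0 and 1 only.\<close>

lemma square_part_mult_square:
  fixes D E :: "'a::{finite,field_gcd} poly"
  assumes D: "squarefree D" "D \<noteq> 0" and E: "lead_coeff E = 1"
  shows "square_part (D * E ^ 2) = E" "squarefree_part (D * E ^ 2) = D"
proof -
  have E0: "E \<noteq> 0" using E by auto
  have "normalize (square_part (D * E ^ 2)) = normalize E"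
  proof (rule multiplicity_eq_imp_eq)
    fix p :: "'a poly" assume p: "prime p"
    have "multiplicity p (D * E ^ 2) = multiplicity p D + 2 * multiplicity p E"
      using p D E0 by (simp add: prime_elem_multiplicity_mult_distrib prime_elem_multiplicity_power_distrib)
    then show "multiplicity p (square_part (D * E ^ 2)) = multiplicity p E"
      using squarefree_multiplicity_div_2[OF D p] p by (simp add: prime_multiplicity_square_part)
  qed (use D E0 in auto)
  then show 1: "square_part (D * E ^ 2) = E" using E monic_iff_normalize[of E] by simp
  show "squarefree_part (D * E ^ 2) = D" using D E0 by (simp add: squarefree_part_def 1)
qed

lemma sum_monics_square_decomposition:
  fixes G :: "'a::{finite,field_gcd} poly \<Rightarrow> 'b::comm_monoid_add"
  shows "(\<Sum>N\<in>monics n. G N) = (\<Sum>e\<le>n div 2. \<Sum>E\<in>monics e. \<Sum>D\<in>sqfree_monics (n - 2 * e). G (D * E ^ 2))"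
proof -
  let ?I = "Sigma {..n div 2} (\<lambda>e. (monics e :: 'a poly set) \<times> (sqfree_monics (n - 2 * e) :: 'a poly set))"
  have "(\<Sum>N\<in>monics n. G N) = (\<Sum>(e, E, D)\<in>?I. G (D * E ^ 2))"
  proof (rule sum.reindex_bij_witness[of _ "\<lambda>(e, E, D). D * E ^ 2"
        "\<lambda>N. (degree (square_part N), square_part N, squarefree_part N)"])
    fix N :: "'a poly" assume "N \<in> monics n"
    then have N: "lead_coeff N = 1" "degree N = n" "N \<noteq> 0" by (auto simp: monics_def)
    let ?E = "square_part N" and ?D = "squarefree_part N"
    have dec: "N = ?D * ?E ^ 2" by (rule squarefree_decompose)
    have E: "lead_coeff ?E = 1" using N by (simp only: monic_iff_normalize) simp
    have D: "lead_coeff ?D = 1"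
      using N(1) E arg_cong[OF dec, of lead_coeff] by (simp add: lead_coeff_mult lead_coeff_power)
    have "n = degree ?D + 2 * degree ?E"
    proof -
      have "degree N = degree (?D * ?E ^ 2)" using dec by (rule arg_cong)
      also have "\<dots> = degree ?D + degree (?E ^ 2)"
        using monic_ne_0[OF D] monic_ne_0[OF E] by (intro degree_mult_eq) auto
      also have "degree (?E ^ 2) = 2 * degree ?E" by (rule degree_power_eq[OF monic_ne_0[OF E]])
      finally show ?thesis using N(2) by simp
    qed
    moreover have "squarefree ?D" by (rule squarefree_squarefree_part)
    ultimately show "(degree ?E, ?E, ?D) \<in> ?I"
      using E D by (auto simp: sqfree_monics_def monics_def)
    show "(case (degree ?E, ?E, ?D) of (e, E, D) \<Rightarrow> D * E ^ 2) = N"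
      "(case (degree ?E, ?E, ?D) of (e, E, D) \<Rightarrow> G (D * E ^ 2)) = G N" using dec by simp_all
  next
    fix t assume t: "t \<in> ?I"
    obtain e E D where [simp]: "t = (e, E, D)" by (cases t)
    from t have e: "2 * e \<le> n" and E: "lead_coeff E = 1" "degree E = e"
      and D: "lead_coeff D = 1" "degree D = n - 2 * e" "squarefree D"
      by (auto simp: sqfree_monics_def monics_def)
    have D0: "D \<noteq> 0" "E \<noteq> 0" using D E by auto
    show "(degree (square_part (case t of (e, E, D) \<Rightarrow> D * E ^ 2)), square_part (case t of (e, E, D) \<Rightarrow> D * E ^ 2),
       squarefree_part (case t of (e, E, D) \<Rightarrow> D * E ^ 2)) = t"
      using square_part_mult_square[OF D(3) D0(1) E(1)] E by simp
    have "degree (D * E ^ 2) = n" using D E e D0 by (simp add: degree_mult_eq degree_power_eq)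
    moreover have "lead_coeff (D * E ^ 2) = 1" unfolding lead_coeff_mult lead_coeff_power D(1) E(1) by simp
    ultimately show "(case t of (e, E, D) \<Rightarrow> D * E ^ 2) \<in> monics n" by (simp add: monics_def)
  qed
  also have "\<dots> = (\<Sum>e\<le>n div 2. \<Sum>(E, D)\<in>monics e \<times> sqfree_monics (n - 2 * e). G (D * E ^ 2))"
    by (rule sum.Sigma[symmetric]) auto
  also have "\<dots> = (\<Sum>e\<le>n div 2. \<Sum>E\<in>monics e. \<Sum>D\<in>sqfree_monics (n - 2 * e). G (D * E ^ 2))"
    by (simp only: sum.cartesian_product)
  finally show ?thesis .
qed

text \<open>In generating functions A(u) = b(u^2) T(u), and the hypothesis on b is (1 - q v) b(v) =
  1 - delta(v). Hence T(u) = (1 - q u^2) A(u) + delta(u^2) T(u), and the coefficient of u^n is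
  compared.\<close>

lemma convolution_recurrence:
  fixes A T b \<delta> :: "nat \<Rightarrow> 'b::comm_ring_1" and q :: 'b
  assumes A: "\<And>n. A n = (\<Sum>e\<le>n div 2. b e * T (n - 2 * e))"
    and b: "b 0 = 1" "\<And>e. b (Suc e) = q * b e - \<delta> (Suc e)"
    and n: "n \<ge> 2"
  shows "T n = A n - q * A (n - 2) + (\<Sum>e=1..n div 2. \<delta> e * T (n - 2 * e))"
proof -
  obtain m where m: "n = m + 2" using n le_Suc_ex by (metis add.commute)
  have "A n = (\<Sum>e\<le>Suc (m div 2). b e * T (n - 2 * e))" by (simp add: A m)
  also have "\<dots> = T n + (\<Sum>e\<le>m div 2. b (Suc e) * T (m - 2 * e))"
    unfolding sum.atMost_Suc_shift using b(1) by (simp add: m)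
  also have "(\<Sum>e\<le>m div 2. b (Suc e) * T (m - 2 * e)) =
      q * A m - (\<Sum>e\<le>m div 2. \<delta> (Suc e) * T (m - 2 * e))"
    by (simp add: b(2) A sum_distrib_left left_diff_distrib sum_subtractf mult.assoc)
  also have "(\<Sum>e\<le>m div 2. \<delta> (Suc e) * T (m - 2 * e)) = (\<Sum>e=1..n div 2. \<delta> e * T (n - 2 * e))"
    by (rule sum.reindex_bij_witness[of _ "\<lambda>e. e - 1" Suc]) (auto simp: m)
  finally show ?thesis by (simp add: m)
qed

text \<open>Here b(v) = 1/(1 - q v), so the correction delta is 0.\<close>

lemma card_sqfree_monics:
  assumes "n \<ge> 2"
  shows "real (card (sqfree_monics n :: 'a::{finite,field_gcd} poly set)) = real CARD('a) ^ n - real CARD('a) ^ (n - 1)"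
proof -
  let ?q = "real CARD('a)"
  have "real (card (sqfree_monics n :: 'a poly set)) = ?q ^ n - ?q * ?q ^ (n - 2) + (\<Sum>e=1..n div 2. 0 * real (card (sqfree_monics (n - 2 * e) :: 'a poly set)))"
  proof (rule convolution_recurrence[where b = "\<lambda>e. ?q ^ e"])
    fix n
    show "?q ^ n = (\<Sum>e\<le>n div 2. ?q ^ e * real (card (sqfree_monics (n - 2 * e) :: 'a poly set)))"
      using sum_monics_square_decomposition[of "\<lambda>_ :: 'a poly. 1 :: real" n] by (simp add: card_monics)
  qed (use assms in auto)
  moreover have "?q * ?q ^ (n - 2) = ?q ^ (n - 1)"
    using assms by (simp flip: power_Suc add: Suc_diff_Suc numeral_2_eq_2)
  ultimately show ?thesis by simp
qed

section \<open>Averages over square-free D at a single prime P\<close>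

context
  fixes P :: "'a::{finite,field_gcd} poly"
  assumes odd_card: "odd CARD('a)" and P: "prime P"
begin

lemma monic_prime_props: "irreducible P" "lead_coeff P = 1" "degree P > 0" "P \<noteq> 0"
  using P prime_degree_pos[OF P] by (auto simp: prime_poly_iff)

lemma sum_jacobi_square:
  "(\<Sum>E\<in>monics e. jacobi P (E ^ 2)) =
     int CARD('a) ^ e - (if degree P \<le> e then int CARD('a) ^ (e - degree P) else 0)"
proof -
  have F: "monic_mult_fun (\<lambda>_ :: 'a poly. 1 :: int)" by (simp add: monic_mult_fun_def)
  have "(\<Sum>E\<in>monics e. jacobi P (E ^ 2)) = (\<Sum>E\<in>monics e. 1 - (if P dvd E then 1 else 0))"
  proof (rule sum.cong[OF refl])
    fix E :: "'a poly"
    show "jacobi P (E ^ 2) = 1 - (if P dvd E then 1 else 0)"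
    proof (cases "P dvd E")
      case True
      then have "\<not> coprime P E" using coprime_irreducible_iff[OF odd_card monic_prime_props(1), of E] by blast
      then have "jacobi P E = 0" by (simp add: jacobi_def)
      then show ?thesis using True by (simp add: power2_eq_square jacobi_mult[OF odd_card])
    next
      case False
      then have "coprime P E" using coprime_irreducible_iff[OF odd_card monic_prime_props(1), of E] by blast
      then show ?thesis
        using False by (simp add: power2_eq_square jacobi_mult[OF odd_card] jacobi_nonzero_square)
    qed
  qed
  also have "\<dots> = int CARD('a) ^ e - (\<Sum>E\<in>monics e. if P dvd E then 1 else 0)"
    by (simp add: sum_subtractf card_monics)
  also have "(\<Sum>E\<in>monics e. if P dvd E then 1 else 0 :: int) = (\<Sum>E | E \<in> monics e \<and> P dvd E. 1)"
    by (rule sum.inter_filter[symmetric]) simp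
  also have "(\<Sum>E | E \<in> monics e \<and> P dvd E. 1 :: int) = (if degree P \<le> e then int CARD('a) ^ (e - degree P) else 0)"
  proof (cases "degree P \<le> e")
    case True
    then show ?thesis using sum_multiples_monic[OF F monic_prime_props(2) True] by (simp add: card_monics)
  next
    case False
    then have "{E. E \<in> monics e \<and> P dvd E} = {}" by (auto simp: monics_def dest: dvd_imp_degree_le)
    then show ?thesis using False by simp
  qed
  finally show ?thesis .
qed

text \<open>For n at least deg P + 2 the complete sums of degrees n and n - 2 both vanish, because
  the character modulo P is nontrivial. Only the correction term of the square-free sieve is
  left.\<close>

lemma sum_jacobi_sqfree_recurrence:
  assumes "n \<ge> degree P + 2"
  shows "(\<Sum>D\<in>sqfree_monics n. jacobi P D) =
     (if 2 * degree P \<le> n then \<Sum>D\<in>sqfree_monics (n - 2 * degree P). jacobi P D else 0)"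
proof -
  let ?a = "degree P" and ?q = "int CARD('a)"
  let ?T = "\<lambda>n. \<Sum>D\<in>sqfree_monics n. jacobi P D"
  from exists_nonresidue[OF odd_card monic_prime_props(1)] obtain b where b: "jacobi P b = -1" ..
  have "?T n = jacobi_sum P n - ?q * jacobi_sum P (n - 2) + (\<Sum>e=1..n div 2. of_bool (e = ?a) * ?T (n - 2 * e))"
  proof (rule convolution_recurrence[where b = "\<lambda>e. \<Sum>E\<in>monics e. jacobi P (E ^ 2)"
        and T = ?T and A = "jacobi_sum P" and q = ?q and \<delta> = "\<lambda>e. of_bool (e = ?a)"])
    fix n
    show "jacobi_sum P n = (\<Sum>e\<le>n div 2. (\<Sum>E\<in>monics e. jacobi P (E ^ 2)) * ?T (n - 2 * e))"
    proof -
      have "jacobi_sum P n = (\<Sum>e\<le>n div 2. \<Sum>E\<in>monics e. \<Sum>D\<in>sqfree_monics (n - 2 * e). jacobi P (D * E ^ 2))"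
        unfolding jacobi_sum_def by (rule sum_monics_square_decomposition)
      also have "\<dots> = (\<Sum>e\<le>n div 2. \<Sum>E\<in>monics e. \<Sum>D\<in>sqfree_monics (n - 2 * e). jacobi P (E ^ 2) * jacobi P D)"
        by (simp only: jacobi_mult[OF odd_card] mult.commute)
      finally show ?thesis by (simp only: sum_product)
    qed
  next
    \<comment> \<open>With a = deg P the generating function is (1 - v^a)/(1 - q v), so delta is the
      indicator of e = a.\<close>
    show "(\<Sum>E\<in>monics (Suc e). jacobi P (E ^ 2)) = ?q * (\<Sum>E\<in>monics e. jacobi P (E ^ 2)) - of_bool (Suc e = ?a)" for e
      unfolding sum_jacobi_square by (auto simp: Suc_diff_le algebra_simps le_Suc_eq)
  qed (use assms in \<open>auto simp: monics_0\<close>)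
  moreover have "jacobi_sum P n = 0" "jacobi_sum P (n - 2) = 0"
    using assms by (auto intro!: jacobi_sum_eq_0_if_nontrivial[OF odd_card b monic_prime_props(4)])
  moreover have "(\<Sum>e=1..n div 2. of_bool (e = ?a) * ?T (n - 2 * e)) = (if 2 * ?a \<le> n then ?T (n - 2 * ?a) else 0)"
  proof -
    have "(\<Sum>e=1..n div 2. of_bool (e = ?a) * ?T (n - 2 * e)) = (\<Sum>e=1..n div 2. if e = ?a then ?T (n - 2 * ?a) else 0)"
      by (rule sum.cong) auto
    also have "\<dots> = (if 2 * ?a \<le> n then ?T (n - 2 * ?a) else 0)"
      using monic_prime_props(3) by (subst sum.delta) auto
    finally show ?thesis .
  qed
  ultimately show ?thesis by simp
qed

text \<open>The recurrence descends in steps of 2 deg P, without any growth, into the range n < deg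
  P + 2, where counting terms suffices.\<close>

lemma sum_jacobi_sqfree_bounded:
  "\<bar>\<Sum>D\<in>sqfree_monics n. jacobi P D\<bar> \<le> int CARD('a) ^ (degree P + 2)"
proof (induction n rule: less_induct)
  case (less n)
  show ?case
  proof (cases "n \<ge> degree P + 2")
    case True
    then show ?thesis
      using less.IH[of "n - 2 * degree P"] monic_prime_props(3) sum_jacobi_sqfree_recurrence[OF True] by auto
  next
    case False
    have "\<bar>\<Sum>D\<in>sqfree_monics n. jacobi P D\<bar> \<le> (\<Sum>D\<in>sqfree_monics n. \<bar>jacobi P D\<bar>)" by (rule sum_abs)
    also have "\<dots> \<le> (\<Sum>D\<in>(sqfree_monics n :: 'a poly set). 1)"
    proof (rule sum_mono)
      fix D :: "'a poly" show "\<bar>jacobi P D\<bar> \<le> 1" using jacobi_values[of P D] by auto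
    qed
    also have "\<dots> = int (card (sqfree_monics n :: 'a poly set))" by simp
    also have "\<dots> \<le> int (CARD('a) ^ n)" by (simp only: of_nat_le_iff card_sqfree_monics_le)
    also have "\<dots> \<le> int (CARD('a) ^ (degree P + 2))"
      using False card_field_gt_1[where 'a='a] by (intro of_nat_mono power_increasing) auto
    finally show ?thesis by simp
  qed
qed

text \<open>The square-free multiples of P are the products P E with E square-free and prime to
  P.\<close>

lemma card_sqfree_coprime:
  "card {D \<in> sqfree_monics n. \<not> P dvd D} + (if degree P \<le> n then card {D \<in> sqfree_monics (n - degree P). \<not> P dvd D} else 0)
     = card (sqfree_monics n :: 'a poly set)"
proof -
  let ?N = "\<lambda>n. {D \<in> sqfree_monics n. \<not> P dvd D}"
  let ?M = "{D \<in> sqfree_monics n. P dvd D}"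
  have "card (sqfree_monics n :: 'a poly set) = card (?N n \<union> ?M)" by (rule arg_cong[of _ _ card]) auto
  also have "\<dots> = card (?N n) + card ?M" by (rule card_Un_disjoint) auto
  also have "card ?M = (if degree P \<le> n then card (?N (n - degree P)) else 0)"
  proof (cases "degree P \<le> n")
    case True
    have "bij_betw (\<lambda>D. P * D) (?N (n - degree P)) ?M"
    proof (rule bij_betw_byWitness[where f' = "\<lambda>D. D div P"])
      show "(\<lambda>D. P * D) ` ?N (n - degree P) \<subseteq> ?M"
      proof (rule image_subsetI)
        fix D assume "D \<in> ?N (n - degree P)"
        then have D: "lead_coeff D = 1" "degree D = n - degree P" "squarefree D" "\<not> P dvd D"
          by (auto simp: sqfree_monics_def monics_def)
        have "coprime P D" using D(4) coprime_irreducible_iff[OF odd_card monic_prime_props(1)] by blast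
        then have "squarefree (P * D)"
          using D P by (intro squarefree_mult_coprime) (auto intro: squarefree_prime_elem)
        moreover have "degree (P * D) = n" using D monic_prime_props True by (subst degree_mult_eq) auto
        moreover have "lead_coeff (P * D) = 1" unfolding lead_coeff_mult D(1) monic_prime_props(2) by simp
        ultimately show "P * D \<in> ?M" by (simp add: sqfree_monics_def monics_def)
      qed
      show "(\<lambda>D. D div P) ` ?M \<subseteq> ?N (n - degree P)"
      proof (rule image_subsetI)
        fix D assume "D \<in> ?M"
        then obtain E where E: "D = P * E" "lead_coeff D = 1" "degree D = n" "squarefree D"
          by (auto simp: sqfree_monics_def monics_def elim: dvdE)
        have lE: "lead_coeff E = 1" using E(1,2) monic_prime_props(2) by (simp add: lead_coeff_mult)
        have "degree D = degree P + degree E"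
          unfolding E(1) using monic_prime_props(4) monic_ne_0[OF lE] by (rule degree_mult_eq)
        then have "degree E = n - degree P" using E(3) by simp
        moreover have "squarefree E" using E(1,4) squarefree_multD by blast
        moreover have "\<not> P dvd E"
        proof
          assume "P dvd E"
          then have "P ^ 2 dvd D" using E(1) by (simp add: power2_eq_square)
          then have "is_unit P" using E(4) by (simp add: squarefree_def)
          then show False using P not_prime_unit by blast
        qed
        ultimately show "D div P \<in> ?N (n - degree P)"
          using lE E(1) monic_prime_props(4) by (auto simp: sqfree_monics_def monics_def)
      qed
    qed (use monic_prime_props(4) in auto)
    then show ?thesis using True bij_betw_same_card by fastforce
  next
    case False
    then have "?M = {}" by (auto simp: sqfree_monics_def monics_def dest: dvd_imp_degree_le)
    then show ?thesis using False by simp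
  qed
  finally show ?thesis by simp
qed

text \<open>Lowering the degree by deg P divides the full count by N = |P|, so a stable proportion x
  satisfies x = 1 - x/N, that is x = N/(N + 1). With this x the error changes only its sign from n
  to n - deg P.\<close>

lemma card_sqfree_coprime_bounded:
  fixes n :: nat
  defines "N \<equiv> real CARD('a) ^ degree P"
  shows "\<bar>real (card {D \<in> sqfree_monics n. \<not> P dvd D}) - N / (N + 1) * real (card (sqfree_monics n :: 'a poly set))\<bar>
     \<le> real CARD('a) ^ (degree P + 2)"
proof (induction n rule: less_induct)
  case (less n)
  let ?q = "real CARD('a)" and ?a = "degree P"
  let ?h = "\<lambda>n. real (card (sqfree_monics n :: 'a poly set))"
  let ?h' = "\<lambda>n. real (card {D \<in> sqfree_monics n. \<not> P dvd D})"
  have q: "?q > 1" using card_field_gt_1[where 'a='a] by simp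
  then have N: "N > 0" by (simp add: N_def)
  show ?case
  proof (cases "n \<ge> ?a + 2")
    case True
    have rec: "?h' n = ?h n - ?h' (n - ?a)" using card_sqfree_coprime[of n] True by auto
    have "n - 1 = ?a + (n - ?a - 1)" using True by simp
    then have "?h n = N * ?h (n - ?a)"
      using True card_sqfree_monics[where 'a='a, of n] card_sqfree_monics[where 'a='a, of "n - ?a"]
      by (simp add: N_def right_diff_distrib flip: power_add)
    then have "?h' n - N / (N + 1) * ?h n = - (?h' (n - ?a) - N / (N + 1) * ?h (n - ?a))"
      using N unfolding rec by (simp add: field_simps)
    then show ?thesis using less.IH[of "n - ?a"] True monic_prime_props(3) by simp
  next
    case False
    have "?h' n \<le> ?h n" by (intro of_nat_mono card_mono) auto
    moreover have "N / (N + 1) * ?h n \<le> ?h n" using N by (intro mult_left_le_one_le) auto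
    moreover have "0 \<le> N / (N + 1) * ?h n" using N by simp
    ultimately have "\<bar>?h' n - N / (N + 1) * ?h n\<bar> \<le> ?h n" by linarith
    also have "?h n \<le> real (CARD('a) ^ n)" by (simp only: of_nat_le_iff card_sqfree_monics_le)
    also have "\<dots> \<le> ?q ^ (?a + 2)" unfolding of_nat_power using False q by (intro power_increasing) auto
    finally show ?thesis .
  qed
qed

end

text \<open>The coefficients of \<open>A_prod' r / ln q\<close> as a power series in \<open>q powr (- 2 * r)\<close>.\<close>

definition c_coeff :: "'a::{finite,field_gcd} itself \<Rightarrow> nat \<Rightarrow> real" where
  "c_coeff _ j = (\<Sum>d | d dvd j. real d * real (card (monic_irreds d :: 'a poly set)) / (real CARD('a) ^ d + 1)) / real CARD('a) ^ j"

lemma c_coeff_bounds: "0 \<le> c_coeff TYPE('a::{finite,field_gcd}) j" "c_coeff TYPE('a) j \<le> 1"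
proof -
  let ?q = "real CARD('a)"
  let ?s = "\<Sum>d | d dvd j. real d * real (card (monic_irreds d :: 'a poly set)) / (?q ^ d + 1)"
  have q: "?q > 0" by simp
  show "0 \<le> c_coeff TYPE('a) j"
    unfolding c_coeff_def by (intro divide_nonneg_nonneg sum_nonneg mult_nonneg_nonneg add_nonneg_nonneg) auto
  show "c_coeff TYPE('a) j \<le> 1"
  proof (cases "j = 0")
    case True
    \<comment> \<open>All numbers divide 0, and \<open>sum\<close> over an infinite set is 0; so the
      constant coefficient vanishes, as the power series of A_D' requires.\<close>
    then show ?thesis by (simp add: c_coeff_def)
  next
    case False
    have "?s \<le> (\<Sum>d | d dvd j. real d * real (card (monic_irreds d :: 'a poly set)))"
    proof (rule sum_mono)
      fix d
      have "x / (?q ^ d + 1) \<le> x" if "x \<ge> 0" for x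
        using divide_left_mono[of 1 "?q ^ d + 1" x] that q by (simp add: add_pos_pos)
      then show "real d * real (card (monic_irreds d :: 'a poly set)) / (?q ^ d + 1) \<le>
        real d * real (card (monic_irreds d :: 'a poly set))" by simp
    qed
    also have "\<dots> = real (\<Sum>d | d dvd j. d * card (monic_irreds d :: 'a poly set))" by simp
    also have "\<dots> = ?q ^ j" using arg_cong[OF vm_coeff_one[where 'a='a, of j], of real] False by simp
    finally show ?thesis using q by (simp add: c_coeff_def)
  qed
qed

text \<open>The characters have absolute value at most 1, and for F = 1 the coefficient is q^k. The
  bound is uniform in D, which the final interchange of limits needs.\<close>

lemma norm_vm_coeff_chi_le:
  fixes D :: "'a::{finite,field_gcd} poly"
  assumes "k \<ge> 1"
  shows "norm (vm_coeff (\<lambda>f. of_int (chi D f) :: complex) k) \<le> real CARD('a) ^ k"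
proof -
  have "norm (of_nat d * (\<Sum>P\<in>monic_irreds d. of_int (chi D P) ^ (k div d)) :: complex) \<le> 
    real (d * card (monic_irreds d :: 'a poly set))" for d
  proof -
    have "norm (of_int (chi D P) ^ (k div d) :: complex) \<le> 1" if "P \<in> monic_irreds d" for P
    proof -
      have "chi D P = legendre_poly D P" using that by (simp add: chi_prime monic_irreds_iff)
      then have "norm (of_int (chi D P) :: complex) \<le> 1" by (simp add: legendre_poly_def)
      then show ?thesis unfolding norm_power by (intro power_le_one) auto
    qed
    then have "norm (\<Sum>P\<in>monic_irreds d. of_int (chi D P) ^ (k div d) :: complex) \<le> (\<Sum>P\<in>(monic_irreds d :: 'a poly set). 1)"
      by (intro sum_norm_le) auto
    then show ?thesis by (simp add: norm_mult mult_left_mono)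
  qed
  then have "norm (vm_coeff (\<lambda>f. of_int (chi D f) :: complex) k) \<le> (\<Sum>d | d dvd k. real (d * card (monic_irreds d :: 'a poly set)))"
    unfolding vm_coeff_def by (intro sum_norm_le)
  also have "\<dots> = real (\<Sum>d | d dvd k. d * card (monic_irreds d :: 'a poly set))" by simp
  also have "\<dots> = real CARD('a) ^ k" using arg_cong[OF vm_coeff_one[where 'a='a, OF assms], of real] by simp
  finally show ?thesis .
qed

text \<open>The factor \<open>q ^ d / (q ^ d + 1)\<close> is the proportion of square-free \<open>D\<close> not divisible by \<open>P\<close>.\<close>

definition vm_mean :: "'a::{finite,field_gcd} itself \<Rightarrow> nat \<Rightarrow> real" where
  "vm_mean _ k = (\<Sum>d | d dvd k. real d * (\<Sum>P\<in>(monic_irreds d :: 'a poly set).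
      if even (k div d) then real CARD('a) ^ d / (real CARD('a) ^ d + 1) else 0))"

lemma vm_mean_odd: "odd k \<Longrightarrow> vm_mean TYPE('a::{finite,field_gcd}) k = 0"
  unfolding vm_mean_def
proof (intro sum.neutral ballI)
  fix d assume k: "odd k" and "d \<in> {d. d dvd k}"
  then obtain m where m: "k = d * m" by (auto elim: dvdE)
  then have "odd d" "odd m" using k by auto
  then have "d \<noteq> 0" by (intro notI) simp
  then have "odd (k div d)" using m \<open>odd m\<close> by simp
  then show "real d * (\<Sum>P\<in>(monic_irreds d :: 'a poly set).
      if even (k div d) then real CARD('a) ^ d / (real CARD('a) ^ d + 1) else 0) = 0" by simp
qed

text \<open>The quotient 2j/d is even exactly if d divides j. Writing q^d/(q^d + 1) as 1 - 1/(q^d +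
  1), the first part sums to q^j by the count of primes and the second is the coefficient of
  A_D'.\<close>

lemma vm_mean_even:
  assumes "j \<ge> 1"
  shows "vm_mean TYPE('a::{finite,field_gcd}) (2 * j) = real CARD('a) ^ j * (1 - c_coeff TYPE('a) j)"
proof -
  let ?q = "real CARD('a)" and ?p = "\<lambda>d. real d * real (card (monic_irreds d :: 'a poly set))"
  have "vm_mean TYPE('a) (2 * j) = (\<Sum>d | d dvd j. ?p d * (?q ^ d / (?q ^ d + 1)))"
    unfolding vm_mean_def
  proof (rule sum.mono_neutral_cong_right)
    show "\<forall>d\<in>{d. d dvd 2 * j} - {d. d dvd j}. real d * (\<Sum>P\<in>(monic_irreds d :: 'a poly set).
      if even (2 * j div d) then ?q ^ d / (?q ^ d + 1) else 0) = 0"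
    proof
      fix d assume d: "d \<in> {d. d dvd 2 * j} - {d. d dvd j}"
      then obtain m where m: "2 * j = d * m" by (auto elim: dvdE)
      have "odd m"
      proof
        assume "even m"
        then obtain l where "m = 2 * l" by blast
        then have "j = d * l" using m by simp
        then show False using d by simp
      qed
      moreover have "2 * j div d = m" using m assms by (cases "d = 0") auto
      ultimately show "real d * (\<Sum>P\<in>(monic_irreds d :: 'a poly set).
        if even (2 * j div d) then ?q ^ d / (?q ^ d + 1) else 0) = 0" by simp
    qed
    fix d assume "d \<in> {d. d dvd j}"
    then have "even (2 * j div d)" by (auto simp: div_mult_swap[symmetric])
    then show "real d * (\<Sum>P\<in>(monic_irreds d :: 'a poly set).
      if even (2 * j div d) then ?q ^ d / (?q ^ d + 1) else 0) = ?p d * (?q ^ d / (?q ^ d + 1))" by simp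
  qed (use assms in auto)
  also have "\<dots> = (\<Sum>d | d dvd j. ?p d - ?p d / (?q ^ d + 1))"
  proof (rule sum.cong[OF refl])
    fix d
    have "?q ^ d + 1 \<noteq> 0" by (metis add_nonneg_pos of_nat_0_le_iff zero_le_power zero_less_one less_irrefl)
    then show "?p d * (?q ^ d / (?q ^ d + 1)) = ?p d - ?p d / (?q ^ d + 1)" by (simp add: field_simps)
  qed
  also have "\<dots> = real (\<Sum>d | d dvd j. d * card (monic_irreds d :: 'a poly set)) - (\<Sum>d | d dvd j. ?p d / (?q ^ d + 1))"
    by (simp add: sum_subtractf)
  also have "real (\<Sum>d | d dvd j. d * card (monic_irreds d :: 'a poly set)) = ?q ^ j"
    using arg_cong[OF vm_coeff_one[where 'a='a, OF assms], of real] by simp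
  also have "(\<Sum>d | d dvd j. ?p d / (?q ^ d + 1)) = ?q ^ j * c_coeff TYPE('a) j"
    by (simp add: c_coeff_def)
  finally show ?thesis by (simp add: algebra_simps)
qed

lemma pm_one_power:
  assumes "j \<in> {-1, 0, 1 :: int}" "m \<ge> 1"
  shows "j ^ m = (if even m then j * j else j)"
proof -
  consider "j = -1" | "j = 0" | "j = 1" using assms(1) by blast
  then show ?thesis using assms(2) by cases (simp_all add: minus_one_power_iff)
qed

text \<open>For fixed k only finitely many primes P occur. An even power of the symbol detects
  whether P divides D, and an odd power is the symbol itself; in both cases the error is bounded
  independently of n.\<close>

lemma sum_vm_coeff_bounded:
  assumes odd_card: "odd CARD('a::{finite,field_gcd})" and k: "k \<ge> 1"
  shows "\<exists>C. \<forall>n. norm ((\<Sum>D\<in>(sqfree_monics n :: 'a poly set). vm_coeff (\<lambda>f. of_int (chi D f) :: complex) k)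
     - of_real (vm_mean TYPE('a) k * real (card (sqfree_monics n :: 'a poly set)))) \<le> C"
proof (intro exI allI)
  fix n
  let ?q = "real CARD('a)" and ?S = "sqfree_monics n :: 'a poly set"
  let ?t = "\<lambda>d. if even (k div d) then ?q ^ d / (?q ^ d + 1) else 0"
  have key: "norm ((\<Sum>D\<in>?S. of_int (chi D P) ^ (k div d) :: complex) - of_real (?t d * real (card ?S))) \<le> ?q ^ (d + 2)"
    if d: "d dvd k" and P: "P \<in> monic_irreds d" for d P
  proof -
    have pP: "prime P" and dP: "degree P = d" using P by (auto simp: monic_irreds_iff)
    have irr: "irreducible P" using pP by (simp add: prime_poly_iff)
    have chi: "chi D P = jacobi P D" for D using pP irr by (simp add: chi_prime legendre_poly_eq_jacobi[OF odd_card])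
    have m: "k div d \<ge> 1" using d k by (auto elim!: dvdE)
    have pw: "chi D P ^ (k div d) = (if even (k div d) then chi D P * chi D P else chi D P)" for D
      unfolding chi by (rule pm_one_power[OF jacobi_values m])
    show ?thesis
    proof (cases "even (k div d)")
      case True
      have "(\<Sum>D\<in>?S. chi D P ^ (k div d)) = (\<Sum>D\<in>?S. if \<not> P dvd D then 1 else 0)"
      proof (rule sum.cong[OF refl])
        fix D
        show "chi D P ^ (k div d) = (if \<not> P dvd D then 1 else 0)"
          unfolding pw using True pP by (simp add: chi_prime legendre_poly_def)
      qed
      also have "\<dots> = (\<Sum>D | D \<in> ?S \<and> \<not> P dvd D. 1)" by (rule sum.inter_filter[symmetric]) simp
      finally have "(\<Sum>D\<in>?S. chi D P ^ (k div d)) = int (card {D \<in> ?S. \<not> P dvd D})" by simp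
      then have e: "(\<Sum>D\<in>?S. of_int (chi D P) ^ (k div d) :: complex) = of_real (real (card {D \<in> ?S. \<not> P dvd D}))"
        by (simp flip: of_int_power of_int_sum)
      show ?thesis
        using card_sqfree_coprime_bounded[OF odd_card pP, of n] True
        unfolding e dP by (simp only: of_real_diff [symmetric] norm_of_real if_True)
    next
      case False
      then have "chi D P ^ (k div d) = jacobi P D" for D unfolding pw by (simp add: chi)
      then have e: "(\<Sum>D\<in>?S. of_int (chi D P) ^ (k div d) :: complex) = of_int (\<Sum>D\<in>?S. jacobi P D)"
        by (simp only: of_int_power [symmetric] of_int_sum)
      have "real_of_int \<bar>\<Sum>D\<in>?S. jacobi P D\<bar> \<le> real_of_int (int CARD('a) ^ (d + 2))"
        unfolding of_int_le_iff using sum_jacobi_sqfree_bounded[OF odd_card pP, of n] dP by simp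
      then show ?thesis unfolding e using False by (simp add: norm_of_int flip: of_int_sum)
    qed
  qed
  have eq: "(\<Sum>D\<in>?S. vm_coeff (\<lambda>f. of_int (chi D f) :: complex) k) - of_real (vm_mean TYPE('a) k * real (card ?S)) =
     (\<Sum>d | d dvd k. \<Sum>P\<in>monic_irreds d. of_nat d * ((\<Sum>D\<in>?S. of_int (chi D P) ^ (k div d)) - of_real (?t d * real (card ?S))))"
  proof -
    have "(\<Sum>D\<in>?S. vm_coeff (\<lambda>f. of_int (chi D f) :: complex) k) =
       (\<Sum>d | d dvd k. \<Sum>P\<in>monic_irreds d. \<Sum>D\<in>?S. of_nat d * of_int (chi D P) ^ (k div d))"
      unfolding vm_coeff_def sum_distrib_left
      by (rule trans[OF sum.swap sum.cong[OF refl sum.swap]])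
    also have "\<dots> = (\<Sum>d | d dvd k. \<Sum>P\<in>monic_irreds d. of_nat d * (\<Sum>D\<in>?S. of_int (chi D P) ^ (k div d)))"
      by (simp only: sum_distrib_left)
    moreover have "of_real (vm_mean TYPE('a) k * real (card ?S)) =
       (\<Sum>d | d dvd k. \<Sum>P\<in>(monic_irreds d :: 'a poly set). (of_nat d * of_real (?t d * real (card ?S)) :: complex))"
      unfolding vm_mean_def sum_distrib_left sum_distrib_right of_real_sum
      by (intro sum.cong refl) (simp add: mult.assoc)
    ultimately show ?thesis by (simp only: right_diff_distrib sum_subtractf)
  qed
  show "norm ((\<Sum>D\<in>?S. vm_coeff (\<lambda>f. of_int (chi D f) :: complex) k) - of_real (vm_mean TYPE('a) k * real (card ?S)))
    \<le> (\<Sum>d | d dvd k. \<Sum>P\<in>(monic_irreds d :: 'a poly set). real d * ?q ^ (d + 2))"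
    unfolding eq
  proof (intro sum_norm_le)
    fix d P assume "d \<in> {d. d dvd k}" "P \<in> (monic_irreds d :: 'a poly set)"
    then show "norm (of_nat d * ((\<Sum>D\<in>?S. of_int (chi D P) ^ (k div d)) - of_real (?t d * real (card ?S))) :: complex)
      \<le> real d * ?q ^ (d + 2)"
      unfolding norm_mult norm_of_nat by (intro mult_left_mono key) auto
  qed
qed

section \<open>Euler products\<close>

lemma Suc_div_ge_1: "Suc d dvd Suc k \<Longrightarrow> Suc k div Suc d \<ge> 1"
  using dvd_imp_le[of "Suc d" "Suc k"] by (simp add: Suc_le_eq div_greater_zero_iff)

lemma Suc_divisors_subset: "{d. Suc d dvd Suc k} \<subseteq> {..k}"
proof
  fix d assume "d \<in> {d. Suc d dvd Suc k}"
  then show "d \<in> {..k}" using dvd_imp_le[of "Suc d" "Suc k"] by simp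
qed

lemma finite_Suc_divisors: "finite {d. Suc d dvd Suc k}"
  by (rule finite_subset[OF Suc_divisors_subset]) simp

text \<open>The correspondence of pairs (k, d) with d dividing k and pairs (d, m) with k = d m, for
  positive integers written as successors because the series are indexed from 0.\<close>

lemma bij_betw_divisor_pairs:
  "bij_betw (\<lambda>(k, d). (d, Suc k div Suc d - 1)) (Sigma UNIV (\<lambda>k. {d. Suc d dvd Suc k})) UNIV"
proof -
  define f where "f = (\<lambda>(k, d). (d, Suc k div Suc d - 1))"
  define f' where "f' = (\<lambda>(d, m). (Suc d * Suc m - 1, d))"
  have A: "f' (f (k, d)) = (k, d)" if "Suc d dvd Suc k" for k d
  proof -
    have "Suc (Suc k div Suc d - 1) = Suc k div Suc d" using Suc_div_ge_1[OF that] by simp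
    then show ?thesis
      using that by (simp only: f_def f'_def prod.case dvd_mult_div_cancel diff_Suc_1)
  qed
  have e: "Suc (Suc d * Suc m - 1) = Suc d * Suc m" for d m by simp
  have B: "f (f' (d, m)) = (d, m)" for d m
  proof -
    have "Suc d * Suc m div Suc d = Suc m" by (rule nonzero_mult_div_cancel_left) simp
    then show ?thesis by (simp only: f_def f'_def prod.case e diff_Suc_1)
  qed
  have C: "f' (d, m) \<in> Sigma UNIV (\<lambda>k. {d. Suc d dvd Suc k})" for d m
    by (simp only: f'_def prod.case mem_Sigma_iff mem_Collect_eq UNIV_I e dvd_triv_left)
  have "bij_betw f (Sigma UNIV (\<lambda>k. {d. Suc d dvd Suc k})) UNIV"
  proof (rule bij_betw_byWitness[where f' = f'])
    show "\<forall>x\<in>Sigma UNIV (\<lambda>k. {d. Suc d dvd Suc k}). f' (f x) = x" using A by blast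
    show "\<forall>x\<in>UNIV. f (f' x) = x" using B by (metis surj_pair)
    show "f' ` UNIV \<subseteq> Sigma UNIV (\<lambda>k. {d. Suc d dvd Suc k})"
      using C by (metis image_subsetI surj_pair)
  qed simp
  then show ?thesis by (simp only: f_def)
qed

text \<open>A double series over d and m is regrouped by k = d m. The number k has at most k
  divisors, so the sum of k c(k) is an absolute majorant.\<close>

lemma lambert_rearrangement:
  fixes a :: "nat \<Rightarrow> nat \<Rightarrow> complex"
  assumes bound: "\<And>d m. d \<ge> 1 \<Longrightarrow> m \<ge> 1 \<Longrightarrow> norm (a d m) \<le> c (d * m)"
    and c: "summable (\<lambda>k. real k * c k)"
  shows "\<exists>S. (\<lambda>d. \<Sum>m. a (Suc d) (Suc m)) sums S \<and> (\<lambda>k. \<Sum>d | d dvd Suc k. a d (Suc k div d)) sums S"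
proof -
  let ?f = "\<lambda>(d, m). a (Suc d) (Suc m)"
  let ?X = "Sigma UNIV (\<lambda>k. {d. Suc d dvd Suc k})"
  let ?g = "\<lambda>(k, d). a (Suc d) (Suc k div Suc d)"
  have cnn: "c k \<ge> 0" if "k \<ge> 1" for k 
    using order_trans[OF norm_ge_zero bound[of 1 k]] that by simp
  have gb: "norm (?g (k, d)) \<le> c (Suc k)" if "Suc d dvd Suc k" for k d
  proof -
    have "norm (a (Suc d) (Suc k div Suc d)) \<le> c (Suc d * (Suc k div Suc d))"
      using Suc_div_ge_1[OF that] by (intro bound) simp_all
    then show ?thesis using that by (simp only: dvd_mult_div_cancel prod.case)
  qed
  have card: "card {d. Suc d dvd Suc k} \<le> Suc k" for k
    using card_mono[OF _ Suc_divisors_subset[of k]] by simp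
  have "(\<lambda>x. norm (?g x)) summable_on ?X"
    unfolding Infinite_Sum.abs_summable_on_Sigma_iff
  proof (intro conjI ballI)
    fix k show "(\<lambda>d. norm (?g (k, d))) summable_on {d. Suc d dvd Suc k}"
      using finite_Suc_divisors by (intro summable_on_finite) 
  next
    have "norm (\<Sum>d | Suc d dvd Suc k. norm (?g (k, d))) \<le> real (Suc k) * c (Suc k)" for k
    proof -
      have "norm (\<Sum>d | Suc d dvd Suc k. norm (?g (k, d))) = (\<Sum>d | Suc d dvd Suc k. norm (?g (k, d)))"
        by (simp add: sum_nonneg)
      also have "\<dots> \<le> (\<Sum>d | Suc d dvd Suc k. c (Suc k))" by (rule sum_mono) (use gb in auto)
      also have "\<dots> = real (card {d. Suc d dvd Suc k}) * c (Suc k)" by simp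
      also have "\<dots> \<le> real (Suc k) * c (Suc k)"
        using cnn[of "Suc k"] by (intro mult_right_mono of_nat_mono card) simp
      finally show ?thesis .
    qed
    moreover have "summable (\<lambda>k. real (Suc k) * c (Suc k))"
      using c summable_Suc_iff[of "\<lambda>k. real k * c k"] by simp
    ultimately have "summable (\<lambda>k. norm (\<Sum>d | Suc d dvd Suc k. norm (?g (k, d))))"
      by (rule_tac summable_comparison_test[rotated]) (auto intro!: exI[of _ 0])
    then have "(\<lambda>k. norm (\<Sum>d | Suc d dvd Suc k. norm (?g (k, d)))) summable_on UNIV"
      by (intro norm_summable_imp_summable_on) simp
    then show "(\<lambda>k. norm (infsum (\<lambda>d. norm (?g (k, d))) {d. Suc d dvd Suc k})) summable_on UNIV"
      using finite_Suc_divisors by simp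
  qed
  then have gs: "?g summable_on ?X" by (rule Infinite_Sum.abs_summable_summable)
  have gf: "?g x = ?f ((\<lambda>(k, d). (d, Suc k div Suc d - 1)) x)" if "x \<in> ?X" for x
  proof -
    obtain k d where x: "x = (k, d)" by (cases x)
    then have "Suc (Suc k div Suc d - 1) = Suc k div Suc d" using Suc_div_ge_1[of d k] that by simp
    then show ?thesis by (simp only: x prod.case)
  qed
  have "(\<lambda>x. ?f ((\<lambda>(k, d). (d, Suc k div Suc d - 1)) x)) summable_on ?X"
    using gs by (subst summable_on_cong[OF gf, symmetric]) auto
  then have fs: "?f summable_on UNIV"
    using summable_on_reindex_bij_betw[OF bij_betw_divisor_pairs, of ?f] by simp
  have eq: "infsum ?f UNIV = infsum ?g ?X"
  proof -
    have "infsum ?g ?X = infsum (\<lambda>x. ?f ((\<lambda>(k, d). (d, Suc k div Suc d - 1)) x)) ?X"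
      by (rule infsum_cong) (rule gf)
    also have "\<dots> = infsum ?f UNIV" by (rule infsum_reindex_bij_betw[OF bij_betw_divisor_pairs])
    finally show ?thesis ..
  qed
  have fs': "?f summable_on Sigma UNIV (\<lambda>_. UNIV)" using fs by simp
  have 1: "(\<lambda>d. infsum (\<lambda>m. a (Suc d) (Suc m)) UNIV) summable_on UNIV"
    using summable_on_Sigma_banach[OF fs'] .
  have in1: "infsum (\<lambda>d. infsum (\<lambda>m. a (Suc d) (Suc m)) UNIV) UNIV = infsum ?f UNIV"
    using infsum_Sigma'_banach[OF fs'] by simp
  have inner: "infsum (\<lambda>m. a (Suc d) (Suc m)) UNIV = (\<Sum>m. a (Suc d) (Suc m))" for d
  proof -
    have "(\<lambda>m. a (Suc d) (Suc m)) summable_on UNIV"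
      using summable_on_SigmaD1[OF fs', of d] by simp
    then show ?thesis using has_sum_imp_sums[OF has_sum_infsum] sums_unique by blast
  qed
  have s1: "(\<lambda>d. \<Sum>m. a (Suc d) (Suc m)) sums infsum ?f UNIV"
    using has_sum_imp_sums[OF has_sum_infsum[OF 1]] in1 by (simp only: inner)
  have 2: "(\<lambda>k. infsum (\<lambda>d. a (Suc d) (Suc k div Suc d)) {d. Suc d dvd Suc k}) summable_on UNIV"
    using summable_on_Sigma_banach[OF gs] .
  have in2: "infsum (\<lambda>k. infsum (\<lambda>d. a (Suc d) (Suc k div Suc d)) {d. Suc d dvd Suc k}) UNIV = infsum ?g ?X"
    using infsum_Sigma'_banach[OF gs] by simp
  have "(\<lambda>k. infsum (\<lambda>d. a (Suc d) (Suc k div Suc d)) {d. Suc d dvd Suc k}) sums infsum ?f UNIV"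
    using has_sum_imp_sums[OF has_sum_infsum[OF 2]] unfolding in2 eq .
  moreover have "infsum (\<lambda>d. a (Suc d) (Suc k div Suc d)) {d. Suc d dvd Suc k} = (\<Sum>d | d dvd Suc k. a d (Suc k div d))" for k
  proof -
    have "infsum (\<lambda>d. a (Suc d) (Suc k div Suc d)) {d. Suc d dvd Suc k} = (\<Sum>d | Suc d dvd Suc k. a (Suc d) (Suc k div Suc d))"
      by (simp add: finite_Suc_divisors)
    also have "\<dots> = (\<Sum>d | d dvd Suc k. a d (Suc k div d))"
    proof (rule sum.reindex_bij_witness[of _ "\<lambda>d. d - 1" Suc])
      fix d assume "d \<in> {d. d dvd Suc k}"
      then have "d > 0" by (intro gr0I) auto
      then show "Suc (d - 1) = d" by simp
      then show "d - 1 \<in> {d. Suc d dvd Suc k}" using \<open>d \<in> {d. d dvd Suc k}\<close> by simp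
    qed auto
    finally show ?thesis .
  qed
  ultimately show ?thesis using s1 by auto
qed

lemma summable_mult_power:
  fixes \<rho> :: real
  assumes "0 \<le> \<rho>" "\<rho> < 1"
  shows "summable (\<lambda>k. real k * \<rho> ^ k)"
proof (rule summable_comparison_test[OF exI[of _ 0]])
  show "summable (\<lambda>k. real (Suc k) * \<rho> ^ k)"
    using geometric_deriv_sums[of \<rho>] assms by (simp add: sums_iff)
  show "\<forall>n\<ge>0. norm (real n * \<rho> ^ n) \<le> real (Suc n) * \<rho> ^ n"
    using assms by (auto intro!: mult_right_mono)
qed

lemma tendsto_prod_imp_prodinf:
  fixes f :: "nat \<Rightarrow> complex"
  assumes "(\<lambda>n. \<Prod>i<n. f i) \<longlonglongrightarrow> p" "p \<noteq> 0"
  shows "f has_prod p"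
proof -
  have "(\<lambda>n. \<Prod>i\<le>n. f i) \<longlonglongrightarrow> p"
    using LIMSEQ_Suc[OF assms(1)] by (simp add: lessThan_Suc_atMost)
  then show ?thesis using assms(2) by (simp add: has_prod_def raw_has_prod_def)
qed

text \<open>The Euler product of 1/zeta_A with x = q^(-s). In the logarithm the terms are regrouped
  by k = d m; the count of primes turns the k-th coefficient into -(q x)^k / k. The range of x is
  that of the resulting series.\<close>

lemma euler_product:
  fixes x :: complex
  assumes x: "norm x < 1 / real CARD('a::{finite,field_gcd})"
  shows "(\<lambda>n. (1 - x ^ n) ^ card (monic_irreds n :: 'a poly set)) has_prod (1 - of_nat CARD('a) * x)"
proof -
  let ?q = "CARD('a)" and ?p = "\<lambda>n. card (monic_irreds n :: 'a poly set)"
  define \<rho> where "\<rho> = real ?q * norm x"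
  have q: "real ?q > 1" using card_field_gt_1[where 'a='a] by simp
  have \<rho>: "0 \<le> \<rho>" "\<rho> < 1" using x q by (auto simp: \<rho>_def field_simps)
  have "1 / real ?q < 1" using q by simp
  with x have xn: "norm x < 1" by (rule less_trans)
  define a where "a d m = - of_nat (?p d) * (x ^ (d * m) / of_nat m)" for d m :: nat
  have lnx: "(\<lambda>m. - ((x ^ d) ^ Suc m) / of_nat (Suc m)) sums Ln (1 - x ^ d)" if "d \<ge> 1" for d
  proof -
    have "norm (x ^ d) < 1" using xn that by (simp add: norm_power power_less_one_iff)
    then have "(\<lambda>n. - ((x ^ d) ^ n) / of_nat n) sums Ln (1 + - (x ^ d))"
      using Ln_series'[of "- (x ^ d)"] by simp
    then show ?thesis using sums_Suc_iff[of "\<lambda>n. - ((x ^ d) ^ n) / of_nat n"] by simp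
  qed
  have inner: "(\<Sum>m. a (Suc d) (Suc m)) = of_nat (?p (Suc d)) * Ln (1 - x ^ Suc d)" for d
  proof -
    have "(\<lambda>m. of_nat (?p (Suc d)) * (- ((x ^ Suc d) ^ Suc m) / of_nat (Suc m))) sums (of_nat (?p (Suc d)) * Ln (1 - x ^ Suc d))"
      by (intro sums_mult lnx) simp
    moreover have "a (Suc d) (Suc m) = of_nat (?p (Suc d)) * (- ((x ^ Suc d) ^ Suc m) / of_nat (Suc m))" for m
      by (simp only: a_def power_mult) simp
    ultimately show ?thesis by (simp only: sums_iff)
  qed
  have bound: "norm (a d m) \<le> \<rho> ^ (d * m)" if "d \<ge> 1" "m \<ge> 1" for d m
  proof -
    have "norm (a d m) = real (?p d) * (norm x ^ (d * m) / real m)"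
      by (simp add: a_def norm_mult norm_divide norm_power)
    also have "\<dots> \<le> real ?q ^ (d * m) * (norm x ^ (d * m) / 1)"
    proof (intro mult_mono divide_left_mono)
      have "real (?p d) \<le> real (?q ^ d)" by (simp only: of_nat_le_iff card_monic_irreds_le)
      also have "\<dots> \<le> real ?q ^ (d * m)" unfolding of_nat_power using q that by (intro power_increasing) auto
      finally show "real (?p d) \<le> real ?q ^ (d * m)" .
    qed (use that in auto)
    also have "\<dots> = \<rho> ^ (d * m)" by (simp add: \<rho>_def power_mult_distrib)
    finally show ?thesis .
  qed
  from lambert_rearrangement[OF bound summable_mult_power[OF \<rho>]] obtain S where
    S: "(\<lambda>d. \<Sum>m. a (Suc d) (Suc m)) sums S" "(\<lambda>k. \<Sum>d | d dvd Suc k. a d (Suc k div d)) sums S" by blast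
  have "(\<Sum>d | d dvd Suc k. a d (Suc k div d)) = - ((of_nat ?q * x) ^ Suc k) / of_nat (Suc k)" for k
  proof -
    have "a d (Suc k div d) = - (of_nat (d * ?p d) * (x ^ Suc k / of_nat (Suc k)))" if "d dvd Suc k" for d
    proof -
      from that obtain m where m: "Suc k = d * m" by (rule dvdE)
      then have "d > 0" "m > 0" by (auto intro: gr0I)
      then show ?thesis by (simp add: a_def m)
    qed
    then have "(\<Sum>d | d dvd Suc k. a d (Suc k div d)) = (\<Sum>d | d dvd Suc k. - (of_nat (d * ?p d) * (x ^ Suc k / of_nat (Suc k))))"
      by (intro sum.cong) auto
    also have "\<dots> = - (of_nat (\<Sum>d | d dvd Suc k. d * ?p d) * (x ^ Suc k / of_nat (Suc k)))"
      by (simp only: sum_negf of_nat_sum sum_distrib_right)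
    also have "(\<Sum>d | d dvd Suc k. d * ?p d) = ?q ^ Suc k" by (rule vm_coeff_one) simp
    finally show ?thesis by (simp add: power_mult_distrib)
  qed
  then have "(\<lambda>k. - ((of_nat ?q * x) ^ Suc k) / of_nat (Suc k)) sums S" using S(2) by simp
  then have "(\<lambda>n. - ((of_nat ?q * x) ^ n) / of_nat n) sums S"
    using sums_Suc_iff[of "\<lambda>n. - ((of_nat ?q * x) ^ n) / of_nat n"] by simp
  moreover have "norm (of_nat ?q * x) < 1" using \<rho> by (simp add: \<rho>_def norm_mult)
  then have "(\<lambda>n. - ((of_nat ?q * x) ^ n) / of_nat n) sums Ln (1 + - (of_nat ?q * x))"
    using Ln_series'[of "- (of_nat ?q * x)"] by simp
  ultimately have SLn: "S = Ln (1 - of_nat ?q * x)" using sums_unique2 by fastforce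
  have nz: "1 - of_nat ?q * x \<noteq> 0"
    using \<open>norm (of_nat ?q * x) < 1\<close> by auto
  have "(\<lambda>d. of_nat (?p (Suc d)) * Ln (1 - x ^ Suc d)) sums S" using S(1) unfolding inner .
  then have "(\<lambda>d. of_nat (?p d) * Ln (1 - x ^ d)) sums S"
    using sums_Suc_iff[of "\<lambda>d. of_nat (?p d) * Ln (1 - x ^ d)"] by simp
  then have "(\<lambda>n. exp (\<Sum>d<n. of_nat (?p d) * Ln (1 - x ^ d))) \<longlonglongrightarrow> exp S"
    unfolding sums_def by (rule tendsto_exp)
  moreover have "exp (\<Sum>d<n. of_nat (?p d) * Ln (1 - x ^ d)) = (\<Prod>d<n. (1 - x ^ d) ^ ?p d)" for n
  proof -
    have "exp (of_nat (?p d) * Ln (1 - x ^ d)) = (1 - x ^ d) ^ ?p d" for d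
    proof (cases "d = 0")
      case False
      then have "norm (x ^ d) < 1" using xn by (simp add: norm_power power_less_one_iff)
      then have "1 - x ^ d \<noteq> 0" by auto
      then show ?thesis by (simp add: exp_of_nat_mult)
    qed simp
    then show ?thesis by (simp add: exp_sum)
  qed
  ultimately have "(\<lambda>n. \<Prod>d<n. (1 - x ^ d) ^ ?p d) \<longlonglongrightarrow> 1 - of_nat ?q * x"
    using nz SLn by simp
  then show ?thesis using nz by (rule tendsto_prod_imp_prodinf)
qed

section \<open>The arithmetic factor on the antidiagonal (-r; r) and its derivative on the diagonal
  (r; r)\<close>

lemma of_real_powr_exp: "x > 0 \<Longrightarrow> complex_of_real x powr s = exp (s * of_real (ln x))"
  by (simp add: powr_def Ln_of_real)

lemma one_minus_nonzero: "norm x < 1 \<Longrightarrow> 1 - x \<noteq> 0" for x :: complex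
  by auto

text \<open>With N = |P| and Y = |P|^(2r) the left side is the factor of the product at (-r; r). It
  simplifies because N (N + 1) - (Y + N) = N^2 - Y, and becomes a quotient of two Euler factors of
  zeta_A.\<close>

lemma euler_factor_identity:
  fixes N Y :: complex
  assumes N: "N \<noteq> 0" "N \<noteq> 1" "N + 1 \<noteq> 0"
  shows "inverse (1 - 1 / N) * (1 - (Y / N + 1) / (N + 1)) = (1 - Y / (N * N)) / (1 - 1 / (N * N))"
proof -
  have NN: "N * (N + 1) \<noteq> 0" using N by simp
  have "Y / N + 1 = (Y + N) / N" using N by (simp add: add_divide_distrib)
  then have "1 - (Y / N + 1) / (N + 1) = 1 - (Y + N) / (N * (N + 1))" by simp
  also have "\<dots> = (N * (N + 1) - (Y + N)) / (N * (N + 1))"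
    unfolding diff_divide_distrib divide_self[OF NN] ..
  also have "N * (N + 1) - (Y + N) = N * N - Y" by (simp add: algebra_simps)
  finally have "1 - (Y / N + 1) / (N + 1) = (N * N - Y) / (N * (N + 1))" .
  moreover have "inverse (1 - 1 / N) = N / (N - 1)" using N by (simp add: field_simps)
  ultimately have "inverse (1 - 1 / N) * (1 - (Y / N + 1) / (N + 1)) = (N * N - Y) / ((N - 1) * (N + 1))"
    using N by simp
  moreover have "1 - Y / (N * N) = (N * N - Y) / (N * N)" "1 - 1 / (N * N) = (N * N - 1) / (N * N)"
    using N by (simp_all add: diff_divide_distrib)
  moreover have "(N - 1) * (N + 1) = N * N - 1" by (simp add: algebra_simps)
  ultimately show ?thesis using N by simp
qed

text \<open>The product rule for a single factor on the diagonal: i and k stand for the inverses of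
  1 - s and N + 1, so that the identity is polynomial.\<close>

lemma log_derivative_identity:
  fixes i k l s N :: complex
  assumes "(1 - s) * i = 1" "(N + 1) * k = 1"
  shows "- (i * (0 - (- l * s)) * i) * (1 - s) + (0 - (- 2 * l * s - l * (N * s)) * k) * i = l * k * (s * i)"
  using assms by algebra

lemma of_nat_power_plus_one:
  assumes "real q > 1"
  shows "(of_nat q ^ n :: complex) \<noteq> 0" "of_nat q ^ n + 1 \<noteq> (0 :: complex)"
    "norm (of_nat q ^ n + 1 :: complex) = real q ^ n + 1"
proof -
  show "(of_nat q ^ n :: complex) \<noteq> 0" using assms by simp
  have pos: "real q ^ n + 1 > 0" using assms by (simp add: add_pos_pos)
  have "of_nat q ^ n + 1 = complex_of_real (real q ^ n + 1)" by simp
  then have "norm (of_nat q ^ n + 1 :: complex) = \<bar>real q ^ n + 1\<bar>" by (simp only: norm_of_real)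
  then show n: "norm (of_nat q ^ n + 1 :: complex) = real q ^ n + 1" using pos by linarith
  show "of_nat q ^ n + 1 \<noteq> (0 :: complex)"
  proof
    assume "of_nat q ^ n + 1 = (0 :: complex)"
    then have "norm (of_nat q ^ n + 1 :: complex) = 0" by (simp only: norm_zero)
    then show False using n pos by linarith
  qed
qed

text \<open>The common value of \<^const>\<open>A_factor\<close> at the primes of degree \<open>n\<close>.\<close>

definition A_factor_deg :: "nat \<Rightarrow> nat \<Rightarrow> complex \<Rightarrow> complex \<Rightarrow> complex" where
  "A_factor_deg q n \<alpha> \<gamma> = (let N = of_nat q ^ n; l = of_nat n * of_real (ln (real q)) in
     inverse (1 - exp (- ((1 + \<alpha> + \<gamma>) * l))) *
     (1 - (exp (- ((1 + 2 * \<alpha>) * l)) + exp (- ((\<alpha> + \<gamma>) * l))) / (N + 1)))"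

lemma A_factor_eq_deg:
  fixes P :: "'a::{finite,field_gcd} poly"
  assumes "degree P = n"
  shows "A_factor \<alpha> \<gamma> P = A_factor_deg CARD('a) n \<alpha> \<gamma>"
proof -
  let ?q = "real CARD('a)"
  have q: "?q > 0" by simp
  have N: "complex_of_real (pnorm P) powr s = exp (s * (of_nat n * of_real (ln ?q)))" for s
    using of_real_powr_exp[of "?q ^ n" s] q assms by (simp add: pnorm_def ln_realpow)
  have "1 / ((M + 1) * exp x) = exp (- x) / (M + 1)" "1 / exp x = exp (- x)" for x M :: complex
    by (simp_all add: exp_minus field_simps)
  moreover have "complex_of_real (pnorm P) = of_nat CARD('a) ^ n" by (simp add: pnorm_def assms)
  ultimately show ?thesis
    unfolding A_factor_def A_factor_deg_def Let_def N by (simp only: diff_diff_eq add_divide_distrib)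
qed

lemma A_prod_eq_deg:
  "A_prod TYPE('a::{finite,field_gcd}) \<alpha> \<gamma> =
     (\<Prod>n. A_factor_deg CARD('a) n \<alpha> \<gamma> ^ card (monic_irreds n :: 'a poly set))"
proof -
  have "(\<Prod>P\<in>(monic_irreds n :: 'a poly set). A_factor \<alpha> \<gamma> P) =
      A_factor_deg CARD('a) n \<alpha> \<gamma> ^ card (monic_irreds n :: 'a poly set)" for n
  proof -
    have "(\<Prod>P\<in>(monic_irreds n :: 'a poly set). A_factor \<alpha> \<gamma> P) =
        (\<Prod>P\<in>(monic_irreds n :: 'a poly set). A_factor_deg CARD('a) n \<alpha> \<gamma>)"
      by (rule prod.cong) (auto simp: monic_irreds_iff A_factor_eq_deg)
    then show ?thesis by simp
  qed
  then show ?thesis by (simp only: A_prod_def)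
qed

text \<open>Factor by factor the product is a quotient of the Euler products at y/q^2 and 1/q^2. The
  strip for r gives |y| < q, which puts y/q^2 into the range of
  \<open>euler_product\<close>.\<close>

lemma A_prod_uminus:
  fixes r :: complex
  defines "q \<equiv> CARD('a::{finite,field_gcd})"
  defines "y \<equiv> exp (2 * r * of_real (ln (real q)))"
  assumes r: "\<bar>Re r\<bar> < 1 / 2"
  shows "A_prod TYPE('a) (- r) r = (1 - y / of_nat q) / (1 - 1 / of_nat q)"
proof -
  let ?L = "ln (real q)" and ?Q = "of_nat q :: complex"
  let ?p = "\<lambda>n. card (monic_irreds n :: 'a poly set)"
  have q: "real q > 1" using card_field_gt_1[where 'a='a] by (simp add: q_def)
  then have L: "?L > 0" and Q0: "?Q \<noteq> 0" by auto
  have eL: "exp (of_real ?L) = ?Q" using q by (simp add: exp_of_real)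
  have "norm y = exp (2 * Re r * ?L)" by (simp add: y_def norm_exp_eq_Re)
  also have "\<dots> < exp (1 * ?L)" unfolding exp_less_cancel_iff using r L by (intro mult_strict_right_mono) auto
  finally have yq: "norm y < real q" using q by simp
  have x1: "norm (y / ?Q ^ 2) < 1 / real CARD('a)"
  proof -
    have "norm (y / ?Q ^ 2) = norm y / real q ^ 2" by (simp add: norm_divide norm_power)
    also have "\<dots> < real q / real q ^ 2" using yq q by (intro divide_strict_right_mono) auto
    also have "\<dots> = 1 / real q" using q by (simp add: power2_eq_square)
    finally show ?thesis by (simp only: q_def)
  qed
  have x2: "norm (1 / ?Q ^ 2) < 1 / real CARD('a)"
  proof -
    have "norm (1 / ?Q ^ 2) = 1 / real q ^ 2" by (simp add: norm_divide norm_power)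
    also have "\<dots> < real q / real q ^ 2" using q by (intro divide_strict_right_mono) auto
    also have "\<dots> = 1 / real q" using q by (simp add: power2_eq_square)
    finally show ?thesis by (simp only: q_def)
  qed
  note E1 = euler_product[where 'a='a, OF x1] and E2 = euler_product[where 'a='a, OF x2]
  have fac: "A_factor_deg q n (- r) r = (1 - (y / ?Q ^ 2) ^ n) / (1 - (1 / ?Q ^ 2) ^ n)" if "n > 0" for n
  proof -
    let ?N = "?Q ^ n" and ?l = "of_nat n * of_real ?L :: complex"
    have N1: "norm ?N > 1" using q that by (simp add: norm_power one_less_power)
    have N: "?N \<noteq> 0" "?N \<noteq> 1" "?N + 1 \<noteq> 0"
    proof -
      show "?N \<noteq> 0" "?N + 1 \<noteq> 0" by (rule of_nat_power_plus_one[OF q])+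
      show "?N \<noteq> 1" using N1 by (intro notI) simp
    qed
    have el: "exp ?l = ?N" by (simp add: exp_of_nat_mult eL)
    have e1: "exp (- ((1 + - r + r) * ?l)) = 1 / ?N" using el by (simp add: exp_minus field_simps)
    have e2: "exp (- ((- r + r) * ?l)) = 1" by simp
    have "- ((1 + 2 * - r) * ?l) = of_nat n * (2 * r * of_real ?L) - ?l" by (simp add: algebra_simps)
    then have e3: "exp (- ((1 + 2 * - r) * ?l)) = y ^ n / ?N"
      unfolding y_def by (simp only: exp_diff exp_of_nat_mult el) (simp add: eL)
    have "A_factor_deg q n (- r) r = inverse (1 - 1 / ?N) * (1 - (y ^ n / ?N + 1) / (?N + 1))"
      unfolding A_factor_deg_def Let_def e1 e2 e3 ..
    also have "\<dots> = (1 - y ^ n / (?N * ?N)) / (1 - 1 / (?N * ?N))"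
      by (rule euler_factor_identity[OF N(1,2,3)])
    finally show ?thesis by (simp add: power_divide power_mult_distrib power2_eq_square)
  qed
  have "(\<lambda>n. A_factor_deg q n (- r) r ^ ?p n) = (\<lambda>n. (1 - (y / ?Q ^ 2) ^ n) ^ ?p n / (1 - (1 / ?Q ^ 2) ^ n) ^ ?p n)"
  proof
    fix n show "A_factor_deg q n (- r) r ^ ?p n = (1 - (y / ?Q ^ 2) ^ n) ^ ?p n / (1 - (1 / ?Q ^ 2) ^ n) ^ ?p n"
      using fac[of n] by (cases "n = 0") (simp_all add: power_divide)
  qed
  then have "A_prod TYPE('a) (- r) r = (\<Prod>n. (1 - (y / ?Q ^ 2) ^ n) ^ ?p n / (1 - (1 / ?Q ^ 2) ^ n) ^ ?p n)"
    unfolding A_prod_eq_deg q_def by simp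
  also have "\<dots> = (1 - of_nat CARD('a) * (y / ?Q ^ 2)) / (1 - of_nat CARD('a) * (1 / ?Q ^ 2))"
    using E1 E2 by (subst prodinf_divide [symmetric]) (simp_all add: has_prod_iff)
  also have "\<dots> = (1 - y / ?Q) / (1 - 1 / ?Q)"
    using Q0 by (simp add: q_def power2_eq_square)
  finally show ?thesis .
qed

text \<open>A factor close to 1 is raised to the number of primes of its degree, so the loss must be
  controlled by the exponent times the deviation: (1 + d)^k - 1 \<le> e^x - 1 \<le> x e^x with x = k
  d.\<close>

lemma norm_power_minus_one_le:
  fixes z :: complex
  shows "norm (z ^ k - 1) \<le> real k * norm (z - 1) * exp (real k * norm (z - 1))"
proof -
  let ?d = "norm (z - 1)" and ?x = "real k * norm (z - 1)"
  have "norm (z ^ k - 1) = norm ((\<Prod>n\<in>{..<k}. 1 + (z - 1)) - 1)" by simp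
  also have "\<dots> \<le> (\<Prod>n\<in>{..<k}. 1 + ?d) - 1" by (rule norm_prod_minus1_le_prod_minus1)
  also have "\<dots> = (1 + ?d) ^ k - 1" by simp
  also have "\<dots> \<le> exp ?d ^ k - 1" by (intro diff_right_mono power_mono) auto
  also have "\<dots> = exp ?x - 1" by (simp add: exp_of_nat_mult)
  also have "\<dots> \<le> ?x * exp ?x"
  proof -
    have "1 - ?x \<le> exp (- ?x)" using exp_ge_add_one_self[of "- ?x"] by simp
    then have "(1 - ?x) * exp ?x \<le> exp (- ?x) * exp ?x" by (intro mult_right_mono) auto
    also have "\<dots> = 1" by (simp flip: exp_add)
    finally show ?thesis by (simp add: algebra_simps)
  qed
  finally show ?thesis .
qed

context
  fixes q :: nat and t :: real
  assumes q1: "real q > 1"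
  defines "t \<equiv> exp (- (3 / 4) * ln (real q))"
begin

lemma decay_base_bounds: "0 < t" "t < 1"
  using q1 by (simp_all add: t_def)

lemma norm_exp_neg_le:
  assumes "c \<le> Re s"
  shows "norm (exp (- (s * (of_nat n * of_real (ln (real q)))))) \<le> exp (- (c * (real n * ln (real q))))"
proof -
  have "c * (real n * ln (real q)) \<le> Re s * (real n * ln (real q))"
    using assms q1 by (intro mult_right_mono) auto
  then show ?thesis by (simp add: norm_exp_eq_Re)
qed

text \<open>The term 1/|P|^(1+\<alpha>+r) of the zeta factor almost cancels against 1/((|P|+1)
  |P|^(\<alpha>+r)); this gains a factor |P|, which pays for the up to q^n primes of degree n. With
  real parts at most 1/8, the exponents 1 + \<alpha> + r and 1 + 2 \<alpha> have real part at least
  3/4, hence \<open>t\<close>.\<close>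

lemma A_factor_deg_minus_one_bound:
  assumes "n \<ge> 1" "\<bar>Re \<alpha>\<bar> \<le> 1 / 8" "\<bar>Re r\<bar> \<le> 1 / 8"
  shows "norm (exp (- ((1 + \<alpha> + r) * (of_nat n * of_real (ln (real q)))))) \<le> t"
    and "real q ^ n * norm (A_factor_deg q n \<alpha> r - 1) \<le> 2 / (1 - t) * t ^ n"
proof -
  let ?L = "ln (real q)" and ?N = "of_nat q ^ n :: complex" and ?M = "real q ^ n"
  let ?l = "of_nat n * of_real ?L :: complex"
  define s where "s = exp (- ((1 + \<alpha> + r) * ?l))"
  define e1 where "e1 = exp (- ((1 + 2 * \<alpha>) * ?l))"
  define e2 where "e2 = exp (- ((\<alpha> + r) * ?l))"
  have L: "?L > 0" using q1 by simp
  have tn: "t ^ n = exp (- (3 / 4 * (real n * ?L)))" by (simp add: t_def flip: exp_of_nat_mult)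
  have "norm s \<le> exp (- (3 / 4 * (real n * ?L)))"
    unfolding s_def using assms by (intro norm_exp_neg_le) auto
  also have "\<dots> = t ^ n" by (simp only: tn)
  also have "t ^ n \<le> t ^ 1" using assms(1) decay_base_bounds by (intro power_decreasing) auto
  finally have ns: "norm s \<le> t" by simp
  then show "norm (exp (- ((1 + \<alpha> + r) * ?l))) \<le> t" by (simp add: s_def)
  have e1: "norm e1 \<le> exp (- (3 / 4 * (real n * ?L)))"
    unfolding e1_def using assms by (intro norm_exp_neg_le) auto
  have e2: "norm e2 \<le> exp (- (- 1 / 4 * (real n * ?L)))"
    unfolding e2_def using assms by (intro norm_exp_neg_le) auto
  have eM: "exp (real n * ?L) = ?M" using q1 by (simp add: exp_of_nat_mult)
  have eN: "exp ?l = ?N"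
  proof -
    have "exp (of_real ?L) = (of_nat q :: complex)" using q1 by (simp add: exp_of_real)
    then show ?thesis by (simp add: exp_of_nat_mult)
  qed
  have M: "?M > 0" using q1 by simp
  have N0: "?N \<noteq> 0" "?N + 1 \<noteq> 0" by (rule of_nat_power_plus_one[OF q1])+
  have s_e2: "s = e2 / ?N"
  proof -
    have "- ((1 + \<alpha> + r) * ?l) = - ((\<alpha> + r) * ?l) - ?l" by (simp add: algebra_simps)
    then show ?thesis unfolding s_def e2_def eN [symmetric] by (simp only: exp_diff)
  qed
  have "1 - s \<noteq> 0" by (rule one_minus_nonzero[OF le_less_trans[OF ns decay_base_bounds(2)]])
  have "A_factor_deg q n \<alpha> r = inverse (1 - s) * (1 - (e1 + e2) / (?N + 1))"
    by (simp only: A_factor_deg_def Let_def s_def e1_def e2_def)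
  then have "A_factor_deg q n \<alpha> r - 1 = (s - (e1 + e2) / (?N + 1)) / (1 - s)"
    using \<open>1 - s \<noteq> 0\<close> by (simp add: field_simps)
  also have "s - (e1 + e2) / (?N + 1) = (e2 / ?N - e1) / (?N + 1)"
    unfolding s_e2 using N0 by (simp add: field_simps)
  finally have eq: "A_factor_deg q n \<alpha> r - 1 = (e2 / ?N - e1) / (?N + 1) / (1 - s)" .
  have "norm (e2 / ?N - e1) \<le> norm e2 / ?M + norm e1"
    using norm_triangle_ineq4[of "e2 / ?N" e1] by (simp add: norm_divide norm_power)
  \<comment> \<open>The growth q^(n/4) of \<open>e2\<close> divided by q^n leaves q^(-3n/4).\<close>
  also have "norm e2 / ?M \<le> exp (- (- 1 / 4 * (real n * ?L))) / ?M"
    using e2 M by (intro divide_right_mono) auto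
  also have "\<dots> = t ^ n" 
  proof -
    have "- (3 / 4 * (real n * ?L)) = - (- 1 / 4 * (real n * ?L)) - real n * ?L" by simp
    then show ?thesis unfolding tn eM [symmetric] by (simp only: exp_diff)
  qed
  also note e1 [folded tn]
  finally have num: "norm (e2 / ?N - e1) \<le> 2 * t ^ n" by simp
  have den: "1 - t \<le> norm (1 - s)" using norm_triangle_ineq2[of 1 s] ns by simp
  have "?M * norm (A_factor_deg q n \<alpha> r - 1) = ?M / (?M + 1) * (norm (e2 / ?N - e1) / norm (1 - s))"
  proof -
    have "norm (?N + 1) = ?M + 1" by (rule of_nat_power_plus_one[OF q1])
    then show ?thesis unfolding eq norm_divide by simp
  qed
  also have "\<dots> \<le> 1 * (2 * t ^ n / (1 - t))"
  proof -
    have "x / (x + 1) \<le> 1" if "x > 0" for x :: real using that by simp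
    note le = this[OF M]
    show ?thesis by (rule mult_mono[OF le frac_le]) (use num den decay_base_bounds in auto)
  qed
  finally show "?M * norm (A_factor_deg q n \<alpha> r - 1) \<le> 2 / (1 - t) * t ^ n" by simp
qed

lemma A_factor_deg_power_bound:
  assumes p: "real p \<le> real q ^ n" "n = 0 \<Longrightarrow> p = 0" and "\<bar>Re \<alpha>\<bar> \<le> 1 / 8" "\<bar>Re r\<bar> \<le> 1 / 8"
  shows "norm (A_factor_deg q n \<alpha> r ^ p - 1) \<le> 2 / (1 - t) * exp (2 / (1 - t)) * t ^ n"
proof (cases "n = 0")
  case True
  then show ?thesis using p(2) decay_base_bounds by simp
next
  case False
  let ?K = "2 / (1 - t)" and ?d = "norm (A_factor_deg q n \<alpha> r - 1)"
  have K: "?K > 0" using decay_base_bounds by simp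
  have "real p * ?d \<le> real q ^ n * ?d" using p(1) by (intro mult_right_mono) auto
  also have "\<dots> \<le> ?K * t ^ n" using False assms by (intro A_factor_deg_minus_one_bound) auto
  finally have pd: "real p * ?d \<le> ?K * t ^ n" .
  also have "?K * t ^ n \<le> ?K * 1" using K decay_base_bounds by (intro mult_left_mono power_le_one) auto
  finally have pd': "real p * ?d \<le> ?K" by simp
  have "norm (A_factor_deg q n \<alpha> r ^ p - 1) \<le> real p * ?d * exp (real p * ?d)" by (rule norm_power_minus_one_le)
  also have "\<dots> \<le> (?K * t ^ n) * exp ?K" using pd' K decay_base_bounds by (intro mult_mono[OF pd]) auto
  finally show ?thesis by (simp add: mult_ac)
qed

text \<open>On the diagonal both terms over |P| + 1 add up to s = 1/|P|^(1+2r), which cancels the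
  zeta factor. Thus the derivative is also the logarithmic derivative, log|P| / ((|P| + 1)
  (|P|^(1+2r) - 1)).\<close>

lemma A_factor_deg_diag:
  assumes "n \<ge> 1" "\<bar>Re r\<bar> \<le> 1 / 8"
  defines "s \<equiv> exp (- ((1 + 2 * r) * (of_nat n * of_real (ln (real q)))))"
  shows "norm s < 1" and "A_factor_deg q n r r = 1"
    and "((\<lambda>\<alpha>. A_factor_deg q n \<alpha> r) has_field_derivative
      of_nat n * of_real (ln (real q)) / (of_nat q ^ n + 1) * (s / (1 - s))) (at r)"
proof -
  let ?L = "ln (real q)" and ?N = "of_nat q ^ n :: complex" and ?M = "real q ^ n"
  let ?l = "of_nat n * of_real ?L :: complex"
  have r: "1 + r + r = 1 + 2 * r" by simp
  show ns: "norm s < 1"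
    unfolding s_def
    by (rule le_less_trans[OF A_factor_deg_minus_one_bound(1)[OF assms(1,2,2), unfolded r] decay_base_bounds(2)])
  then have s1: "1 - s \<noteq> 0" by (rule one_minus_nonzero)
  have eN: "exp ?l = ?N"
  proof -
    have "exp (of_real ?L) = (of_nat q :: complex)" using q1 by (simp add: exp_of_real)
    then show ?thesis by (simp add: exp_of_nat_mult)
  qed
  have M: "?M > 0" using q1 by simp
  have N0: "?N \<noteq> 0" "?N + 1 \<noteq> 0" by (rule of_nat_power_plus_one[OF q1])+
  have e2: "exp (- ((r + r) * ?l)) = ?N * s"
  proof -
    have "- ((r + r) * ?l) = ?l + - ((1 + 2 * r) * ?l)" by (simp add: algebra_simps)
    then show ?thesis unfolding s_def eN [symmetric] by (simp only: exp_add)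
  qed
  have u: "(s + ?N * s) / (?N + 1) = s" using N0 by (simp add: field_simps)
  show "A_factor_deg q n r r = 1"
    unfolding A_factor_deg_def Let_def r e2 s_def [symmetric] u using s1 by simp
  let ?s = "\<lambda>\<alpha>. exp (- ((1 + \<alpha> + r) * ?l))"
  let ?u = "\<lambda>\<alpha>. (exp (- ((1 + 2 * \<alpha>) * ?l)) + exp (- ((\<alpha> + r) * ?l))) / (?N + 1)"
  have ds: "(?s has_field_derivative - ?l * s) (at r)"
    unfolding s_def r [symmetric] by (auto intro!: derivative_eq_intros)
  have du: "(?u has_field_derivative (- 2 * ?l * s - ?l * (?N * s)) / (?N + 1)) (at r)"
    unfolding e2 [symmetric] unfolding s_def using N0(2) by (auto intro!: derivative_eq_intros)
  have sr: "?s r = s" and ur: "?u r = s" unfolding s_def [symmetric] r e2 using u by (simp_all add: s_def)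
  have "((\<lambda>\<alpha>. inverse (1 - ?s \<alpha>) * (1 - ?u \<alpha>)) has_field_derivative
     - (inverse (1 - ?s r) * (0 - (- ?l * s)) * inverse (1 - ?s r)) * (1 - ?u r) +
      (0 - (- 2 * ?l * s - ?l * (?N * s)) / (?N + 1)) * inverse (1 - ?s r)) (at r)"
    by (intro DERIV_mult DERIV_inverse' DERIV_diff DERIV_const ds du) (use sr s1 in simp)
  moreover have "- (inverse (1 - s) * (0 - (- ?l * s)) * inverse (1 - s)) * (1 - s) +
      (0 - (- 2 * ?l * s - ?l * (?N * s)) / (?N + 1)) * inverse (1 - s) = ?l / (?N + 1) * (s / (1 - s))"
    using log_derivative_identity[of s "inverse (1 - s)" ?N "inverse (?N + 1)" ?l] s1 N0(2)
    by (simp only: divide_inverse right_inverse simp_thms)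
  ultimately show "((\<lambda>\<alpha>. A_factor_deg q n \<alpha> r) has_field_derivative ?l / (?N + 1) * (s / (1 - s))) (at r)"
    unfolding A_factor_deg_def Let_def sr ur by simp
qed

end

text \<open>Locally uniform convergence permits differentiating the product termwise in the first
  variable. Each s/(1 - s) is then a geometric series, and regrouping the prime powers by degree
  yields the coefficients \<open>c_coeff\<close>.\<close>

lemma A_prod'_sums:
  fixes r :: complex
  defines "q \<equiv> CARD('a::{finite,field_gcd})"
  defines "w \<equiv> exp (- 2 * r * of_real (ln (real q)))"
  assumes r: "\<bar>Re r\<bar> < 1 / 16"
  shows "(\<lambda>j. of_real (ln (real q)) * of_real (c_coeff TYPE('a) j) * w ^ j) sums A_prod' TYPE('a) r"
proof -
  let ?L = "ln (real q)" and ?p = "\<lambda>n. card (monic_irreds n :: 'a poly set)"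
  define t where "t = exp (- (3 / 4) * ?L)"
  have q: "real q > 1" using card_field_gt_1[where 'a='a] by (simp add: q_def)
  then have L: "?L > 0" by simp
  have t: "0 < t" "t < 1" using decay_base_bounds[OF q] by (simp_all add: t_def)
  define H where "H n \<alpha> = A_factor_deg q n \<alpha> r ^ ?p n" for n \<alpha>
  define M where "M n = 2 / (1 - t) * exp (2 / (1 - t)) * t ^ n" for n
  have "real (?p n) \<le> real q ^ n" for n
    unfolding of_nat_power [symmetric] of_nat_le_iff q_def by (rule card_monic_irreds_le)
  then have HM: "norm (H n \<alpha> - 1) \<le> M n" if "\<bar>Re \<alpha>\<bar> \<le> 1 / 8" for n \<alpha>
    unfolding H_def M_def t_def using that r by (intro A_factor_deg_power_bound[OF q]) auto
  have sM: "summable M"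
    unfolding M_def using t by (intro summable_mult summable_geometric) auto
  \<comment> \<open>The radius 1/16 and the bound 1/16 on Re r keep Re \<alpha> within the range 1/8
    of the estimates.\<close>
  let ?S = "ball r (1 / 16)"
  have inS: "\<bar>Re \<alpha>\<bar> \<le> 1 / 8" if "\<alpha> \<in> ?S" for \<alpha>
    using that abs_Re_le_cmod[of "r - \<alpha>"] r by (simp add: dist_norm)
  have den: "1 - exp (- ((1 + \<alpha> + r) * (of_nat n * of_real ?L))) \<noteq> 0"
    if "\<alpha> \<in> ?S" "n \<ge> 1" for \<alpha> n
  proof -
    have "norm (exp (- ((1 + \<alpha> + r) * (of_nat n * of_real ?L)))) \<le> t"
      unfolding t_def using r by (intro A_factor_deg_minus_one_bound(1)[OF q that(2) inS[OF that(1)]]) simp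
    also note t(2)
    finally show ?thesis by (rule one_minus_nonzero)
  qed
  have holo: "H n holomorphic_on ?S" for n
  proof (cases "n = 0")
    \<comment> \<open>In degree 0 the formula for the factor degenerates, since 1 - exp 0 = 0; there
      are no primes of degree 0, so the exponent is 0.\<close>
    case True
    then have "H n = (\<lambda>_. 1)" by (auto simp: H_def)
    then show ?thesis by simp
  next
    case False
    have N: "of_nat q ^ n + 1 \<noteq> (0::complex)"
      by (rule of_nat_power_plus_one[OF q])
    show ?thesis
      unfolding H_def A_factor_deg_def Let_def using den False N by (auto intro!: holomorphic_intros)
  qed
  let ?P = "\<lambda>N \<alpha>. \<Prod>n<N. H n \<alpha>"
  have conv: "convergent_prod (\<lambda>n. H n \<alpha>)" if "\<alpha> \<in> ?S" for \<alpha>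
  proof -
    have "summable (\<lambda>n. norm (H n \<alpha> - 1))"
      by (rule summable_comparison_test[OF _ sM]) (use HM inS[OF that] in auto)
    then show ?thesis
      by (simp add: abs_convergent_prod_conv_summable abs_convergent_prod_imp_convergent_prod)
  qed
  have lim: "(\<lambda>N. ?P N \<alpha>) \<longlonglongrightarrow> A_prod TYPE('a) \<alpha> r" if "\<alpha> \<in> ?S" for \<alpha>
  proof -
    have "(\<lambda>N. \<Prod>n\<le>N. H n \<alpha>) \<longlonglongrightarrow> (\<Prod>n. H n \<alpha>)"
      by (rule convergent_prod_LIMSEQ[OF conv[OF that]])
    then have "(\<lambda>N. ?P (Suc N) \<alpha>) \<longlonglongrightarrow> A_prod TYPE('a) \<alpha> r"
      by (simp add: lessThan_Suc_atMost A_prod_eq_deg H_def q_def)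
    then show ?thesis by (rule LIMSEQ_imp_Suc)
  qed
  have ulim: "\<exists>d>0. cball x d \<subseteq> ?S \<and> uniform_limit (cball x d) ?P (\<lambda>\<alpha>. A_prod TYPE('a) \<alpha> r) sequentially"
    if x: "x \<in> ?S" for x
  proof -
    have "\<exists>d>0. cball x d \<subseteq> ?S" using x open_contains_cball[of ?S] open_ball by blast
    then obtain d where d: "d > 0" "cball x d \<subseteq> ?S" by blast
    have "uniformly_convergent_on (cball x d) (\<lambda>N \<alpha>. \<Sum>n<N. norm (H n \<alpha> - 1))"
      by (rule Weierstrass_m_test'[OF _ sM]) (use HM inS d(2) in auto)
    then have "uniformly_convergent_on (cball x d) ?P"
      using holo d(2) by (intro uniformly_convergent_on_prod')
        (auto intro!: holomorphic_on_imp_continuous_on intro: holomorphic_on_subset)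
    then obtain l where l: "uniform_limit (cball x d) ?P l sequentially"
      by (auto simp: uniformly_convergent_on_def)
    have eq: "l \<alpha> = A_prod TYPE('a) \<alpha> r" if "\<alpha> \<in> cball x d" for \<alpha>
      using LIMSEQ_unique[OF tendsto_uniform_limitI[OF l that] lim] d(2) that by auto
    then have "uniform_limit (cball x d) ?P (\<lambda>\<alpha>. A_prod TYPE('a) \<alpha> r) sequentially"
      using l uniform_limit_cong'[of "cball x d" ?P ?P l "\<lambda>\<alpha>. A_prod TYPE('a) \<alpha> r" sequentially, OF refl eq]
      by blast
    then show ?thesis using d by blast
  qed
  have holoP: "?P N holomorphic_on ?S" for N
    using holo by (intro holomorphic_intros)
  obtain g' where g': "\<And>x. x \<in> ?S \<Longrightarrow> ((\<lambda>\<alpha>. A_prod TYPE('a) \<alpha> r) has_field_derivative g' x) (at x)"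
    "\<And>x. x \<in> ?S \<Longrightarrow> (\<lambda>N. deriv (?P N) x) \<longlonglongrightarrow> g' x"
    using has_complex_derivative_uniform_sequence[OF open_ball, of r "1 / 16" ?P "\<lambda>N. deriv (?P N)", OF _ ulim]
      holomorphic_derivI[OF holoP open_ball] by blast
  define s where "s n = exp (- ((1 + 2 * r) * (of_nat n * of_real ?L)))" for n
  define h where "h n = of_nat (?p n) * (of_nat n * of_real ?L / (of_nat q ^ n + 1) * (s n / (1 - s n)))" for n
  have r8: "\<bar>Re r\<bar> \<le> 1 / 8" using r by simp
  have H1: "H n r = 1" for n
    using A_factor_deg_diag(2)[OF q _ r8, of n] by (cases "n = 0") (simp_all add: H_def)
  have dH: "(H n has_field_derivative h n) (at r)" for n
  proof (cases "n = 0")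
    case True
    then have "H n = (\<lambda>_. 1)" "h n = 0" by (auto simp: H_def h_def)
    then show ?thesis by simp
  next
    case False
    then have n: "n \<ge> 1" by simp
    have "((\<lambda>\<alpha>. A_factor_deg q n \<alpha> r ^ ?p n) has_field_derivative
      of_nat (?p n) * (of_nat n * of_real ?L / (of_nat q ^ n + 1) * (s n / (1 - s n)) * A_factor_deg q n r r ^ (?p n - Suc 0))) (at r)"
      unfolding s_def by (rule DERIV_power[OF A_factor_deg_diag(3)[OF q n r8]])
    then show ?thesis unfolding H_def h_def A_factor_deg_diag(2)[OF q n r8] by simp
  qed
  \<comment> \<open>Every factor is 1 at r, so the product rule leaves the plain sum of the
    derivatives.\<close>
  have dP: "(?P N has_field_derivative (\<Sum>n<N. h n)) (at r)" for N
  proof (induction N)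
    case (Suc N)
    have "((\<lambda>\<alpha>. ?P N \<alpha> * H N \<alpha>) has_field_derivative (\<Sum>n<N. h n) * H N r + h N * ?P N r) (at r)"
      by (rule DERIV_mult[OF Suc dH])
    then show ?case by (simp add: H1)
  qed simp
  have rS: "r \<in> ?S" by simp
  have "h sums g' r"
    using g'(2)[OF rS] DERIV_imp_deriv[OF dP] by (simp add: sums_def)
  moreover have "A_prod' TYPE('a) r = g' r"
    unfolding A_prod'_def by (rule DERIV_imp_deriv[OF g'(1)[OF rS]])
  ultimately have hs: "h sums A_prod' TYPE('a) r" by simp
  \<comment> \<open>The m-th term of the geometric series in degree d; the weight depends on d only
    and s is (w/q)^d, so the power of w depends on the product d m alone.\<close>
  define a where "a d m = of_real ?L * (of_nat d * of_nat (?p d) / (of_nat q ^ d + 1)) * (w / of_nat q) ^ (d * m)" for d m :: nat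
  have wq: "s d = (w / of_nat q) ^ d" for d
  proof -
    have "exp (of_real ?L) = (of_nat q :: complex)" using q by (simp add: exp_of_real)
    then have "exp (- ((1 + 2 * r) * of_real ?L)) = w / of_nat q"
    proof -
      have "- ((1 + 2 * r) * of_real ?L) = - 2 * r * of_real ?L - of_real ?L" by (simp add: algebra_simps)
      then show ?thesis unfolding w_def \<open>exp (of_real ?L) = of_nat q\<close> [symmetric] by (simp only: exp_diff)
    qed
    moreover have "s d = exp (of_nat d * (- ((1 + 2 * r) * of_real ?L)))"
      unfolding s_def by (simp add: mult_ac)
    ultimately show ?thesis by (simp only: exp_of_nat_mult)
  qed
  define \<rho> where "\<rho> = norm (w / of_nat q)"
  have "norm (s 1) < 1" unfolding s_def by (rule A_factor_deg_diag(1)[OF q _ r8]) simp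
  then have \<rho>: "0 \<le> \<rho>" "\<rho> < 1" by (simp_all only: \<rho>_def wq power_one_right norm_ge_zero)
  have inner: "(\<Sum>m. a (Suc d) (Suc m)) = h (Suc d)" for d
  proof -
    let ?x = "s (Suc d)"
    have "norm ?x < 1" unfolding s_def by (rule A_factor_deg_diag(1)[OF q _ r8]) simp
    then have "(\<lambda>m. ?x * ?x ^ m) sums (?x * (1 / (1 - ?x)))" by (intro sums_mult geometric_sums)
    then have "(\<lambda>m. of_real ?L * (of_nat (Suc d) * of_nat (?p (Suc d)) / (of_nat q ^ Suc d + 1)) * (?x * ?x ^ m)) sums
      (of_real ?L * (of_nat (Suc d) * of_nat (?p (Suc d)) / (of_nat q ^ Suc d + 1)) * (?x * (1 / (1 - ?x))))"
      by (rule sums_mult)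
    moreover have "a (Suc d) (Suc m) = of_real ?L * (of_nat (Suc d) * of_nat (?p (Suc d)) / (of_nat q ^ Suc d + 1)) * (?x * ?x ^ m)" for m
      unfolding a_def wq by (simp only: power_mult power_Suc)
    ultimately have "(\<lambda>m. a (Suc d) (Suc m)) sums
       (of_real ?L * (of_nat (Suc d) * of_nat (?p (Suc d)) / (of_nat q ^ Suc d + 1)) * (?x * (1 / (1 - ?x))))" by simp
    then show ?thesis by (simp add: sums_iff h_def mult_ac)
  qed
  have bound: "norm (a d m) \<le> ?L * \<rho> ^ (d * m)" if "d \<ge> 1" "m \<ge> 1" for d m
  proof -
    have "d * ?p d \<le> (\<Sum>e | e dvd d. e * ?p e)"
      using that by (intro member_le_sum) auto
    also have "\<dots> = q ^ d" unfolding q_def using that by (intro vm_coeff_one)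
    finally have "real (d * ?p d) \<le> real (q ^ d)" by (simp only: of_nat_le_iff)
    then have le: "real d * real (?p d) / (real q ^ d + 1) \<le> 1"
      using q by (simp add: add_pos_pos divide_le_eq)
    have "norm (of_nat q ^ d + 1 :: complex) = real q ^ d + 1" by (rule of_nat_power_plus_one[OF q])
    then have "norm (a d m) = ?L * (real d * real (?p d) / (real q ^ d + 1)) * \<rho> ^ (d * m)"
      unfolding a_def \<rho>_def norm_mult norm_divide norm_power using L by simp
    also have "\<dots> \<le> ?L * 1 * \<rho> ^ (d * m)" using L le \<rho> by (intro mult_right_mono mult_left_mono) auto
    finally show ?thesis by simp
  qed
  have "summable (\<lambda>k. real k * (?L * \<rho> ^ k))"
    using summable_mult[OF summable_mult_power[OF \<rho>], of ?L] by (simp add: mult_ac)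
  from lambert_rearrangement[OF bound this] obtain S where
    S: "(\<lambda>d. \<Sum>m. a (Suc d) (Suc m)) sums S" "(\<lambda>k. \<Sum>d | d dvd Suc k. a d (Suc k div d)) sums S" by blast
  have "(\<lambda>d. h (Suc d)) sums S" using S(1) by (simp only: inner)
  then have "h sums S" using sums_Suc_iff[of h] by (simp add: h_def)
  then have SA: "S = A_prod' TYPE('a) r" using hs sums_unique2 by blast
  let ?c = "\<lambda>j. of_real ?L * of_real (c_coeff TYPE('a) j) * w ^ j"
  have "(\<Sum>d | d dvd Suc k. a d (Suc k div d)) = ?c (Suc k)" for k
  proof -
    have "(\<Sum>d | d dvd Suc k. a d (Suc k div d)) =
       (\<Sum>d | d dvd Suc k. of_real ?L * (w / of_nat q) ^ Suc k * of_real (real d * real (?p d) / (real q ^ d + 1)))"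
      by (rule sum.cong) (simp_all add: a_def mult_ac)
    also have "\<dots> = of_real ?L * (w / of_nat q) ^ Suc k * of_real (\<Sum>d | d dvd Suc k. real d * real (?p d) / (real q ^ d + 1))"
      by (simp only: sum_distrib_left of_real_sum)
    also have "(\<Sum>d | d dvd Suc k. real d * real (?p d) / (real q ^ d + 1)) = real q ^ Suc k * c_coeff TYPE('a) (Suc k)"
      using q by (simp add: c_coeff_def q_def)
    also have "of_real ?L * (w / of_nat q) ^ Suc k * of_real (real q ^ Suc k * c_coeff TYPE('a) (Suc k)) = ?c (Suc k)"
      using q by (simp add: power_divide del: power_Suc)
    finally show ?thesis .
  qed
  then have "(\<lambda>k. ?c (Suc k)) sums A_prod' TYPE('a) r" using S(2) SA by simp
  then show ?thesis using sums_Suc_iff[of ?c] by (simp add: c_coeff_def)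
qed

section \<open>Even periodic entire functions\<close>

lemma complex_periodic_int:
  fixes F :: "complex \<Rightarrow> 'b"
  assumes "\<And>z. F (z + of_real p) = F z"
  shows "F (z + of_int n * of_real p) = F z"
proof -
  have nat: "F (z + of_nat n * of_real p) = F z" for n z
  proof (induction n)
    case (Suc n)
    have "F (z + of_nat (Suc n) * of_real p) = F ((z + of_nat n * of_real p) + of_real p)"
      by (simp add: algebra_simps)
    then show ?case using assms Suc by simp
  qed simp
  show ?thesis
  proof (cases n rule: int_cases2)
    case (nonneg k)
    then show ?thesis using nat[of z k] by simp
  next
    case (nonpos k)
    have "F ((z + of_int n * of_real p) + of_nat k * of_real p) = F (z + of_int n * of_real p)" by (rule nat)
    then show ?thesis using nonpos by simp
  qed
qed

text \<open>The open mapping theorem; openness of cos is what makes the factor through it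
  continuous.\<close>

lemma open_cos_image:
  assumes "open U"
  shows "open (cos ` U :: complex set)"
proof (rule open_mapping_thm[of cos UNIV])
  have "cos (0::complex) \<noteq> cos (of_real pi)" by (simp only: cos_zero cos_of_real cos_pi) simp
  then show "\<not> (cos :: complex \<Rightarrow> complex) constant_on UNIV"
    unfolding constant_on_def by (metis UNIV_I)
qed (use assms in \<open>auto intro: holomorphic_intros\<close>)

text \<open>Equal cosines mean equal arguments up to sign and period, so G is well defined. Away
  from 1 and -1 the cosine is locally invertible, which makes G holomorphic there; at these two
  branch points continuity removes the singularity.\<close>

lemma even_periodic_factors_through_cos:
  fixes F :: "complex \<Rightarrow> complex"
  assumes holo: "F holomorphic_on UNIV" and even: "\<And>z. F (- z) = F z"
    and per: "\<And>z. F (z + of_real (2 * pi)) = F z"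
  shows "\<exists>G. G holomorphic_on UNIV \<and> (\<forall>z. F z = G (cos z))"
proof -
  have Feq: "F w = F z" if "cos w = cos z" for w z
  proof -
    obtain n where n: "n \<in> \<int>" "w = z + of_real (2 * n * pi) \<or> w = - z + of_real (2 * n * pi)"
      using \<open>cos w = cos z\<close> complex_cos_eq[of w z] by blast
    then obtain k where k: "n = of_int k" by (auto elim: Ints_cases)
    have "complex_of_real (2 * n * pi) = of_int k * of_real (2 * pi)" by (simp add: k)
    then have "w = z + of_int k * of_real (2 * pi) \<or> w = - z + of_int k * of_real (2 * pi)"
      using n(2) by (simp only:)
    then show ?thesis
      by (elim disjE) (simp_all only: complex_periodic_int[of F "2 * pi", OF per] even)
  qed
  define G where "G x = F (Arccos x)" for x
  have G: "G (cos z) = F z" for z unfolding G_def by (rule Feq) simp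
  have cont: "continuous_on UNIV G"
  proof (subst continuous_on_open_vimage[OF open_UNIV], intro allI impI)
    fix V :: "complex set" assume "open V"
    then have "open (F -` V)"
      using holomorphic_on_imp_continuous_on[OF holo] by (simp add: continuous_on_open_vimage)
    then have "open (cos ` (F -` V))" by (rule open_cos_image)
    also have "cos ` (F -` V) = G -` V \<inter> UNIV"
    proof (intro equalityI subsetI)
      fix x assume "x \<in> G -` V \<inter> UNIV"
      then have "x = cos (Arccos x)" "Arccos x \<in> F -` V" by (simp_all add: G_def)
      then show "x \<in> cos ` (F -` V)" by blast
    qed (auto simp: G)
    finally show "open (G -` V \<inter> UNIV)" .
  qed
  have cos_holo: "(cos :: complex \<Rightarrow> complex) holomorphic_on S" for S by (intro holomorphic_intros)
  have "G holomorphic_on (UNIV - {1, -1})"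
  proof (rule holomorphic_onI)
    fix x :: complex assume x: "x \<in> UNIV - {1, -1}"
    let ?w = "Arccos x"
    have "sin ?w \<noteq> 0"
    proof
      assume "sin ?w = 0"
      then have "x ^ 2 = 1" using sin_cos_squared_add[of ?w] by simp
      then show False using x by (auto simp: power2_eq_1_iff)
    qed
    moreover have "(cos has_field_derivative - sin ?w) (at ?w)" by (rule DERIV_cos)
    then have "deriv cos ?w = - sin ?w" by (rule DERIV_imp_deriv)
    ultimately have "deriv cos ?w \<noteq> 0" by simp
    then obtain r where r: "r > 0" "open (cos ` ball ?w r)" "inj_on cos (ball ?w r)"
      using has_complex_derivative_locally_invertible[OF cos_holo UNIV_I open_UNIV] by metis
    obtain g where g: "g holomorphic_on (cos ` ball ?w r)" "\<And>z. z \<in> ball ?w r \<Longrightarrow> g (cos z) = z"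
      using holomorphic_has_inverse[OF cos_holo open_ball r(3)] by metis
    have "(\<lambda>y. F (g y)) holomorphic_on (cos ` ball ?w r)"
      using holomorphic_on_compose_gen[OF g(1) holo] by (simp add: o_def)
    then have "G holomorphic_on (cos ` ball ?w r)"
      by (rule holomorphic_transform) (auto simp: G g(2))
    moreover have "x \<in> cos ` ball ?w r" using r(1) by (auto intro!: image_eqI[of _ _ ?w])
    ultimately have "G field_differentiable at x"
      using r(2) by (auto simp: holomorphic_on_open field_differentiable_def)
    then show "G field_differentiable at x within UNIV - {1, -1}"
      by (rule field_differentiable_at_within)
  qed
  then have "G holomorphic_on UNIV"
    by (intro no_isolated_singularity[OF cont]) auto
  then show ?thesis using G by metis
qed

text \<open>The coefficients are the Taylor coefficients of an entire function, hence summable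
  against R^n for every R. This is the decay that absorbs the growth of the estimates in the
  frequency.\<close>

lemma even_periodic_cos_series:
  fixes f :: "complex \<Rightarrow> complex"
  assumes L: "L > 0" and holo: "f holomorphic_on UNIV" and even: "\<And>z. f (- z) = f z"
    and per: "\<And>z. f (z + of_real (2 * pi / L)) = f z"
  shows "\<exists>c. (\<forall>R. summable (\<lambda>n. norm (c n) * R ^ n)) \<and> (\<forall>z. (\<lambda>n. c n * cos (of_real L * z) ^ n) sums f z)"
proof -
  define F where "F w = f (w / of_real L)" for w
  have "F holomorphic_on UNIV"
  proof -
    have "(\<lambda>w. w / of_real L) holomorphic_on UNIV" using L by (intro holomorphic_intros) auto
    from holomorphic_on_compose_gen[OF this holo] show ?thesis by (simp add: o_def F_def[abs_def])
  qed
  moreover have "F (- z) = F z" for z using even[of "z / of_real L"] by (simp add: F_def)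
  moreover have "F (z + of_real (2 * pi)) = F z" for z
    using per[of "z / of_real L"] by (simp add: F_def add_divide_distrib)
  ultimately obtain G where G: "G holomorphic_on UNIV" "\<And>z. F z = G (cos z)"
    using even_periodic_factors_through_cos[of F] by blast
  define c where "c n = (deriv ^^ n) G 0 / fact n" for n
  have sums: "(\<lambda>n. c n * x ^ n) sums G x" for x
  proof -
    have "G holomorphic_on ball 0 (norm x + 1)" using G(1) holomorphic_on_subset by blast
    then show ?thesis using holomorphic_power_series[of G 0 "norm x + 1" x] by (simp add: c_def)
  qed
  have "summable (\<lambda>n. norm (c n) * R ^ n)" for R :: real
  proof -
    have "summable (\<lambda>n. c n * (of_real (\<bar>R\<bar> + 1)) ^ n)" using sums sums_summable by blast
    then have "summable (\<lambda>n. norm (c n * of_real R ^ n))" by (rule powser_insidea) simp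
    then have "summable (\<lambda>n. norm (c n) * \<bar>R\<bar> ^ n)" by (simp add: norm_mult norm_power)
    then show ?thesis by (rule summable_comparison_test[rotated]) (auto intro!: exI[of _ 0] simp: abs_mult power_abs)
  qed
  moreover have "(\<lambda>n. c n * cos (of_real L * z) ^ n) sums f z" for z
    using sums[of "cos (of_real L * z)"] G(2)[of "of_real L * z"] L by (simp add: F_def)
  ultimately show ?thesis by blast
qed

section \<open>The density of zeros as a Fourier series\<close>

text \<open>With v = q^(-2iz), V = v^g and Q = q, the left side is zeta_A'/zeta_A and the |D|^(-iz)
  term, both divided by log q. Their poles at v = 1 cancel, because (v - V)/(1 - v) is a finite
  geometric sum.\<close>

lemma density_identity:
  fixes v V Q :: complex
  assumes "v \<noteq> 0" "v \<noteq> 1" "Q \<noteq> 0" "Q \<noteq> 1"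
  shows "- v / (1 - v) - V * (1 / (1 - 1 / v)) * ((1 - 1 / v / Q) / (1 - 1 / Q)) =
    - ((v - V) / (1 - v)) - Q / (Q - 1) * V"
proof -
  have alg: "- (v * a) - V * (v * (- a)) * ((Q * v - 1) * (u * b)) = - ((v - V) * a) - Q * b * V"
    if "(1 - v) * a = 1" "(Q - 1) * b = 1" "v * u = 1" for a b u :: complex
    using that by algebra
  define a b u where "a = inverse (1 - v)" and "b = inverse (Q - 1)" and "u = inverse v"
  have inv: "(1 - v) * a = 1" "(Q - 1) * b = 1" "v * u = 1"
    using assms by (simp_all add: a_def b_def u_def)
  have "1 - 1 / v = (v - 1) / v" using assms(1) by (simp add: diff_divide_distrib)
  then have e1: "1 / (1 - 1 / v) = v * (- a)"
    using assms(2) by (simp add: a_def divide_inverse inverse_minus_eq [symmetric])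
  have "1 - 1 / v / Q = (Q * v - 1) / (v * Q)" using assms(1,3) by (simp add: diff_divide_distrib)
  moreover have "1 - 1 / Q = (Q - 1) / Q" using assms(3) by (simp add: diff_divide_distrib)
  ultimately have e2: "(1 - 1 / v / Q) / (1 - 1 / Q) = (Q * v - 1) * (u * b)"
    using assms(1,3,4) by (simp add: b_def u_def divide_inverse mult_ac)
  have e3: "- v / (1 - v) = - (v * a)" "(v - V) / (1 - v) = (v - V) * a" "Q / (Q - 1) * V = Q * b * V"
    by (simp_all add: a_def b_def divide_inverse)
  show ?thesis unfolding e1 e2 e3 by (rule alg[OF inv])
qed

text \<open>Coefficient of v^j in the density divided by 2 log q, apart from the summand g. The 1
  stems from the finite geometric sum, and the term at j = g is the boundary term of
  \<open>density_identity\<close>.\<close>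

definition density_coeff :: "'a::{finite,field_gcd} itself \<Rightarrow> nat \<Rightarrow> nat \<Rightarrow> real" where
  "density_coeff T g j = c_coeff T j - (if 1 \<le> j \<and> j < g then 1 else 0)
     - (if j = g then real CARD('a) / (real CARD('a) - 1) else 0)"

definition density_variable :: "nat \<Rightarrow> complex \<Rightarrow> complex" where
  "density_variable q z = exp (- 2 * \<i> * z * of_real (ln (real q)))"

text \<open>The expansion of A_D' is valid also for some r with negative real part, where its
  variable exceeds 1.\<close>

lemma c_coeff_summable: "\<exists>K>1. summable (\<lambda>j. c_coeff TYPE('a::{finite,field_gcd}) j * K ^ j)"
proof -
  let ?L = "ln (real CARD('a))"
  have "real CARD('a) > 1" using card_field_gt_1[where 'a='a] by simp
  then have L: "?L > 0" by simp
  \<comment> \<open>The value of q^(-2r) at r = -1/32, an arbitrary negative point inside the strip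
    |Re r| < 1/16.\<close>
  define K where "K = exp (?L / 16)"
  have K: "exp (- 2 * (- 1 / 32) * complex_of_real ?L) = of_real K"
    by (simp add: K_def exp_of_real [symmetric])
  have "\<bar>Re (- 1 / 32 :: complex)\<bar> < 1 / 16" by simp
  from A_prod'_sums[where 'a='a, OF this, unfolded K]
  have "summable (\<lambda>j. of_real ?L * of_real (c_coeff TYPE('a) j) * complex_of_real K ^ j)"
    by (rule sums_summable)
  then have "summable (\<lambda>j. complex_of_real (?L * (c_coeff TYPE('a) j * K ^ j)))" by (simp add: mult.assoc)
  then have "summable (\<lambda>j. ?L * (c_coeff TYPE('a) j * K ^ j))" by (simp only: summable_of_real_iff)
  then have "summable (\<lambda>j. c_coeff TYPE('a) j * K ^ j)" using L by (simp add: summable_cmult_iff)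
  moreover have "K > 1" using L by (simp add: K_def)
  ultimately show ?thesis by blast
qed

lemma c_coeff_summable_1: "summable (c_coeff TYPE('a::{finite,field_gcd}))"
proof -
  obtain K where K: "K > 1" "summable (\<lambda>j. c_coeff TYPE('a) j * K ^ j)" using c_coeff_summable by blast
  then show ?thesis using powser_inside[OF K(2), of 1] by simp
qed

text \<open>The radius of convergence exceeds 1, so the series is continuous on the unit circle,
  where the density lives.\<close>

lemma isCont_c_series:
  assumes "norm v \<le> 1"
  shows "isCont (\<lambda>x. \<Sum>j. of_real (c_coeff TYPE('a::{finite,field_gcd}) j) * x ^ j) (v :: complex)"
proof -
  obtain K where K: "K > 1" "summable (\<lambda>j. c_coeff TYPE('a) j * K ^ j)" using c_coeff_summable by blast
  from K(2) have "summable (\<lambda>j. complex_of_real (c_coeff TYPE('a) j * K ^ j))" by (simp only: summable_of_real_iff)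
  then have "summable (\<lambda>j. of_real (c_coeff TYPE('a) j) * complex_of_real K ^ j)" by simp
  then show ?thesis using assms K(1) by (intro isCont_powser) auto
qed

text \<open>A form of the density that stays meaningful and continuous at v = 1, where the original
  expression has its removable singularities.\<close>

definition density_value :: "'a::{finite,field_gcd} itself \<Rightarrow> nat \<Rightarrow> complex \<Rightarrow> complex" where
  "density_value T g v = 2 * of_real (ln (real CARD('a))) * (of_nat g - (\<Sum>j=1..<g. v ^ j)
      - of_nat CARD('a) / (of_nat CARD('a) - 1) * v ^ g + (\<Sum>j. of_real (c_coeff T j) * v ^ j))"

text \<open>The summand g arises since log|D| is 2g + 1 times log q and X'/X takes away one of
  these. Likewise |D|^(-iz) X(1/2 + iz) is exactly v^g. The condition on Im z is that of the
  expansion of A_D' at iz.\<close>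

lemma density_pointwise:
  fixes D :: "'a::{finite,field_gcd} poly" and z :: complex
  defines "v \<equiv> density_variable CARD('a) z"
  assumes D: "D \<in> hyp_family g" and g: "g \<ge> 1" and z: "\<bar>Im z\<bar> < 1 / 16" and v1: "v \<noteq> 1"
  shows "(let q = CARD('a); \<zeta> = zeta_A q; X = X_fun q in
       of_real (ln (pnorm D)) - deriv X (1 / 2 - \<i> * z) / X (1 / 2 - \<i> * z)
       + 2 * (deriv \<zeta> (1 + 2 * \<i> * z) / \<zeta> (1 + 2 * \<i> * z)
              + A_prod' TYPE('a) (\<i> * z)
              - of_real (ln (real q)) * of_real (pnorm D) powr (- (\<i> * z)) * X (1 / 2 + \<i> * z)
                * \<zeta> (1 - 2 * \<i> * z) * A_prod TYPE('a) (- (\<i> * z)) (\<i> * z))) = density_value TYPE('a) g v"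
proof -
  let ?q = "CARD('a)"
  define L where "L = ln (real ?q)"
  define Q where "Q = (of_nat ?q :: complex)"
  have q: "real ?q > 1" using card_field_gt_1[where 'a='a] by simp
  then have L: "L > 0" by (simp add: L_def)
  have Q: "Q \<noteq> 0" "Q \<noteq> 1" using q by (auto simp: Q_def)
  have pw: "Q powr s = exp (s * of_real L)" for s
    using of_real_powr_exp[of "real ?q" s] q by (simp add: Q_def L_def)
  have v: "v = exp (- (2 * \<i> * z * of_real L))" by (simp add: v_def density_variable_def L_def)
  have v0: "v \<noteq> 0" by (simp add: v)
  have iv: "exp (2 * \<i> * z * of_real L) = 1 / v" by (simp add: v exp_minus field_simps)
  have dD: "degree D = 2 * g + 1" using D by (simp add: hyp_family_def)
  have lnD: "ln (pnorm D) = (2 * real g + 1) * L"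
    unfolding pnorm_def dD L_def using q by (subst ln_realpow) auto
  have Xe: "X_fun ?q = (\<lambda>s. exp ((- 1 / 2 + s) * of_real L))"
    by (rule ext) (simp add: X_fun_def pw Q_def [symmetric])
  have X: "deriv (X_fun ?q) s / X_fun ?q s = of_real L" for s
  proof -
    have "(X_fun ?q has_field_derivative of_real L * X_fun ?q s) (at s)"
      unfolding Xe by (auto intro!: derivative_eq_intros)
    then have "deriv (X_fun ?q) s = of_real L * X_fun ?q s" by (rule DERIV_imp_deriv)
    moreover have "X_fun ?q s \<noteq> 0" unfolding Xe by simp
    ultimately show ?thesis by simp
  qed
  have ze: "zeta_A ?q = (\<lambda>s. 1 / (1 - exp ((1 - s) * of_real L)))"
    by (rule ext) (simp add: zeta_A_def pw Q_def [symmetric])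
  have zeta: "deriv (zeta_A ?q) (1 + 2 * \<i> * z) / zeta_A ?q (1 + 2 * \<i> * z) = of_real L * (- v / (1 - v))"
  proof -
    let ?s = "1 + 2 * \<i> * z"
    have E: "exp ((1 - ?s) * of_real L) = v" by (simp add: v)
    have "((\<lambda>s. inverse (1 - exp ((1 - s) * of_real L))) has_field_derivative
       - (inverse (1 - v) * (of_real L * v) * inverse (1 - v))) (at ?s)"
      unfolding E [symmetric] using v1 E
      by (intro DERIV_inverse') (auto intro!: derivative_eq_intros)
    then have "(zeta_A ?q has_field_derivative - (inverse (1 - v) * (of_real L * v) * inverse (1 - v))) (at ?s)"
      unfolding ze by (simp add: inverse_eq_divide)
    then have "deriv (zeta_A ?q) ?s = - (inverse (1 - v) * (of_real L * v) * inverse (1 - v))"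
      by (rule DERIV_imp_deriv)
    moreover have "zeta_A ?q ?s = inverse (1 - v)" unfolding ze E by (simp add: inverse_eq_divide)
    ultimately show ?thesis using v1 by (simp add: divide_inverse)
  qed
  have zeta2: "zeta_A ?q (1 - 2 * \<i> * z) = 1 / (1 - 1 / v)"
    unfolding ze using iv by simp
  have vg: "of_real (pnorm D) powr (- (\<i> * z)) * X_fun ?q (1 / 2 + \<i> * z) = v ^ g"
  proof -
    have "pnorm D > 0" using q by (simp add: pnorm_def)
    then have "complex_of_real (pnorm D) powr (- (\<i> * z)) * X_fun ?q (1 / 2 + \<i> * z) =
       exp (- (\<i> * z) * of_real ((2 * real g + 1) * L)) * exp ((- 1 / 2 + (1 / 2 + \<i> * z)) * of_real L)"
      unfolding Xe by (simp only: of_real_powr_exp lnD)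
    also have "\<dots> = exp (of_nat g * (- (2 * \<i> * z * of_real L)))"
      unfolding exp_add [symmetric] by (simp add: algebra_simps)
    also have "\<dots> = v ^ g" unfolding v by (rule exp_of_nat_mult)
    finally show ?thesis .
  qed
  have r: "\<bar>Re (\<i> * z)\<bar> < 1 / 16" "\<bar>Re (\<i> * z)\<bar> < 1 / 2" using z by auto
  have A: "A_prod TYPE('a) (- (\<i> * z)) (\<i> * z) = (1 - 1 / v / Q) / (1 - 1 / Q)"
  proof -
    have "exp (2 * (\<i> * z) * of_real L) = 1 / v" using iv by (simp add: mult.assoc)
    then show ?thesis using A_prod_uminus[where 'a='a, OF r(2)] by (simp only: Q_def L_def)
  qed
  have A': "A_prod' TYPE('a) (\<i> * z) = of_real L * (\<Sum>j. of_real (c_coeff TYPE('a) j) * v ^ j)"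
  proof -
    have "exp (- 2 * (\<i> * z) * of_real L) = v" by (simp add: v mult.assoc)
    then have "(\<lambda>j. of_real L * of_real (c_coeff TYPE('a) j) * v ^ j) sums A_prod' TYPE('a) (\<i> * z)"
      using A_prod'_sums[where 'a='a, OF r(1)] by (simp only: L_def)
    then have s: "(\<lambda>j. of_real L * (of_real (c_coeff TYPE('a) j) * v ^ j)) sums A_prod' TYPE('a) (\<i> * z)"
      by (simp add: mult.assoc)
    then have "summable (\<lambda>j. of_real (c_coeff TYPE('a) j) * v ^ j)"
      using L sums_summable[OF s] by (simp add: summable_cmult_iff)
    then show ?thesis using s by (simp add: sums_iff suminf_mult)
  qed
  have geo: "(\<Sum>j=1..<g. v ^ j) = (v - v ^ g) / (1 - v)"
  proof -
    have "(1 - v) * (\<Sum>j=1..<n. v ^ j) = v - v ^ n" if "n \<ge> 1" for n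
      using that
    proof (induction n rule: nat_induct_at_least)
      case (Suc n)
      then show ?case by (simp add: distrib_left left_diff_distrib)
    qed simp
    from this[OF g] show ?thesis using v1 by (simp add: field_simps)
  qed
  have "of_real (ln (pnorm D)) - of_real L
       + 2 * (of_real L * (- v / (1 - v)) + of_real L * C
              - of_real L * (of_real (pnorm D) powr (- (\<i> * z)) * X_fun ?q (1 / 2 + \<i> * z)) 
                * (1 / (1 - 1 / v)) * ((1 - 1 / v / Q) / (1 - 1 / Q)))
     = 2 * of_real L * (of_nat g + (- v / (1 - v) - v ^ g * (1 / (1 - 1 / v)) * ((1 - 1 / v / Q) / (1 - 1 / Q))) + C)" for C
    unfolding vg lnD by (simp add: algebra_simps)
  also have "2 * of_real L * (of_nat g + (- v / (1 - v) - v ^ g * (1 / (1 - 1 / v)) * ((1 - 1 / v / Q) / (1 - 1 / Q))) + C) =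
     2 * of_real L * (of_nat g - (\<Sum>j=1..<g. v ^ j) - Q / (Q - 1) * v ^ g + C)" for C
    unfolding density_identity[OF v0 v1 Q] geo by (simp add: algebra_simps)
  finally show ?thesis
    unfolding Let_def X zeta zeta2 A A' density_value_def L_def [symmetric] Q_def [symmetric]
    by (simp only: mult.assoc)
qed

text \<open>\<open>remove_sings\<close> is the limit at the point. In a punctured neighbourhood v
  differs from 1, since v has nonzero derivative, so the closed form applies there, and it is
  continuous.\<close>

lemma zero_density_eq:
  fixes D :: "'a::{finite,field_gcd} poly"
  assumes D: "D \<in> hyp_family g" and g: "g \<ge> 1"
  shows "zero_density D (of_real t) = density_value TYPE('a) g (density_variable CARD('a) (of_real t))"
proof -
  let ?q = "CARD('a)" and ?t = "complex_of_real t"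
  define L where "L = ln (real ?q)"
  have "real ?q > 1" using card_field_gt_1[where 'a='a] by simp
  then have L: "L > 0" by (simp add: L_def)
  let ?v = "density_variable ?q"
  have dv: "(?v has_field_derivative - 2 * \<i> * of_real L * ?v z) (at z)" for z
    unfolding density_variable_def [abs_def] L_def by (auto intro!: derivative_eq_intros)
  have cv: "isCont ?v z" for z using dv DERIV_isCont by blast
  have ev1: "eventually (\<lambda>z. ?v z \<noteq> 1) (at ?t)"
  proof (cases "?v ?t = 1")
    case True
    have "((\<lambda>w. (?v w - ?v ?t) / (w - ?t)) \<longlongrightarrow> - 2 * \<i> * of_real L * ?v ?t) (at ?t)"
      using dv[of ?t] by (simp only: has_field_derivative_iff)
    moreover have "- 2 * \<i> * of_real L * ?v ?t \<noteq> 0" using L True by simp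
    ultimately have "eventually (\<lambda>w. (?v w - ?v ?t) / (w - ?t) \<noteq> 0) (at ?t)"
      by (rule tendsto_imp_eventually_ne)
    then show ?thesis by eventually_elim (use True in auto)
  next
    case False
    then show ?thesis using cv[of ?t] unfolding isCont_def by (intro tendsto_imp_eventually_ne)
  qed
  have "((\<lambda>z. \<bar>Im z\<bar>) \<longlongrightarrow> \<bar>Im ?t\<bar>) (at ?t)" by (intro tendsto_intros)
  then have "((\<lambda>z. \<bar>Im z\<bar>) \<longlongrightarrow> 0) (at ?t)" by simp
  then have ev2: "eventually (\<lambda>z. \<bar>Im z\<bar> < 1 / 16) (at ?t)" by (rule order_tendstoD) simp
  have nv: "norm (?v ?t) \<le> 1" by (simp add: density_variable_def norm_exp_eq_Re)
  have "isCont (density_value TYPE('a) g) (?v ?t)"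
    unfolding density_value_def [abs_def] by (intro continuous_intros isCont_c_series nv)
  then have "isCont (\<lambda>z. density_value TYPE('a) g (?v z)) ?t"
    using isCont_o2[OF cv] by blast
  then have lim: "((\<lambda>z. density_value TYPE('a) g (?v z)) \<longlongrightarrow> density_value TYPE('a) g (?v ?t)) (at ?t)"
    by (simp only: isCont_def)
  show ?thesis
    unfolding zero_density_def
  proof (rule remove_sings_eqI, rule Lim_transform_eventually[OF lim])
    show "eventually (\<lambda>z. density_value TYPE('a) g (?v z) = (let q = CARD('a); \<zeta> = zeta_A q; X = X_fun q in
       of_real (ln (pnorm D)) - deriv X (1 / 2 - \<i> * z) / X (1 / 2 - \<i> * z)
       + 2 * (deriv \<zeta> (1 + 2 * \<i> * z) / \<zeta> (1 + 2 * \<i> * z)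
              + A_prod' TYPE('a) (\<i> * z)
              - of_real (ln (real q)) * of_real (pnorm D) powr (- (\<i> * z)) * X (1 / 2 + \<i> * z)
                * \<zeta> (1 - 2 * \<i> * z) * A_prod TYPE('a) (- (\<i> * z)) (\<i> * z)))) (at ?t)"
      using ev1 ev2 by eventually_elim (rule density_pointwise[OF D g, symmetric])
  qed
qed

section \<open>Comparison of the two sides\<close>

lemma integral_sums_Weierstrass:
  fixes f :: "nat \<Rightarrow> real \<Rightarrow> complex"
  assumes cont: "\<And>n. continuous_on {a..b} (f n)"
    and bound: "\<And>n t. t \<in> {a..b} \<Longrightarrow> norm (f n t) \<le> M n" and M: "summable M"
  shows "(\<lambda>n. integral {a..b} (f n)) sums integral {a..b} (\<lambda>t. \<Sum>n. f n t)"
proof -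
  have "uniform_limit {a..b} (\<lambda>n t. \<Sum>i<n. f i t) (\<lambda>t. \<Sum>i. f i t) sequentially"
    by (rule Weierstrass_m_test[OF bound M])
  then have "uniform_limit (cbox a b) (\<lambda>n t. \<Sum>i<n. f i t) (\<lambda>t. \<Sum>i. f i t) sequentially" by simp
  then obtain I J where IJ: "\<And>n. ((\<lambda>t. \<Sum>i<n. f i t) has_integral I n) (cbox a b)"
    "((\<lambda>t. \<Sum>i. f i t) has_integral J) (cbox a b)" "I \<longlonglongrightarrow> J"
    by (rule uniform_limit_integral_cbox) (auto intro!: continuous_intros cont)
  have "I n = (\<Sum>i<n. integral {a..b} (f i))" for n
  proof -
    have "integral {a..b} (\<lambda>t. \<Sum>i<n. f i t) = (\<Sum>i<n. integral {a..b} (f i))"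
      using cont by (intro integral_sum) (auto intro: integrable_continuous_real)
    then show ?thesis using integral_unique[OF IJ(1)[of n]] by simp
  qed
  then have "I = (\<lambda>n. \<Sum>i<n. integral {a..b} (f i))" ..
  moreover have "integral {a..b} (\<lambda>t. \<Sum>n. f n t) = J" using integral_unique[OF IJ(2)] by simp
  ultimately show ?thesis using IJ(3) unfolding sums_def by simp
qed

lemma integral_exp_period:
  fixes m :: int
  assumes L: "L > 0"
  shows "((\<lambda>t. exp (\<i> * of_int m * of_real L * of_real t)) has_integral
     (if m = 0 then of_real (2 * pi / L) else 0)) {- pi / L..pi / L}"
proof (cases "m = 0")
  case True
  have "((\<lambda>t. 1 :: complex) has_integral (pi / L - (- pi / L)) *\<^sub>R 1) {- pi / L..pi / L}"
    using has_integral_const_real[of "1 :: complex" "- pi / L" "pi / L"] L by (simp add: field_simps)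
  then show ?thesis using True L by (simp add: scaleR_conv_of_real field_simps)
next
  case False
  let ?c = "\<i> * of_int m * of_real L"
  have c0: "?c \<noteq> 0" using False L by simp
  have "((\<lambda>t. exp (?c * of_real t)) has_integral
      (exp (?c * of_real (pi / L)) / ?c - exp (?c * of_real (- pi / L)) / ?c)) {- pi / L..pi / L}"
  proof (rule fundamental_theorem_of_calculus)
    show "- pi / L \<le> pi / L" using L by (simp add: field_simps)
    fix t
    have "((\<lambda>z. exp (?c * z) / ?c) has_field_derivative exp (?c * of_real t)) (at (of_real t))"
      using c0 by (auto intro!: derivative_eq_intros)
    then show "((\<lambda>t. exp (?c * of_real t) / ?c) has_vector_derivative exp (?c * of_real t)) (at t within {- pi / L..pi / L})"
      using has_vector_derivative_real_field by (blast intro: has_vector_derivative_at_within)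
  qed
  moreover have "exp (?c * of_real (pi / L)) = exp (?c * of_real (- pi / L))"
  proof -
    have "?c * of_real (pi / L) = ?c * of_real (- pi / L) + 2 * of_int m * of_real pi * \<i>"
      using L by (simp add: field_simps)
    then show ?thesis unfolding exp_eq by (intro exI[of _ m]) (simp add: mult_ac)
  qed
  ultimately show ?thesis using False by simp
qed

lemma sums_sum_mset:
  fixes f :: "'b \<Rightarrow> nat \<Rightarrow> complex"
  assumes "\<And>x. x \<in># M \<Longrightarrow> f x sums s x"
  shows "(\<lambda>n. \<Sum>x\<in>#M. f x n) sums (\<Sum>x\<in>#M. s x)"
  using assms by (induction M) (auto intro!: sums_add)

section \<open>Fourier coefficients of the density\<close>

definition density_series :: "'a::{finite,field_gcd} itself \<Rightarrow> nat \<Rightarrow> real \<Rightarrow> complex" where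
  "density_series T g t = density_value T g (density_variable CARD('a) (of_real t))"

context
  fixes L :: real
  assumes odd_card: "odd CARD('a::{finite,field_gcd})"
  defines "L \<equiv> ln (real CARD('a))"
begin

lemma ln_card_field_pos: "L > 0"
  using card_field_gt_1[where 'a='a] by (simp add: L_def)

lemma density_variable_power:
  "density_variable CARD('a) (of_real t) ^ j = exp (\<i> * of_int (- 2 * int j) * of_real L * of_real t)"
  unfolding density_variable_def L_def exp_of_nat_mult [symmetric] by (simp add: mult_ac)

lemma density_coeff_summable: "summable (\<lambda>j. \<bar>density_coeff TYPE('a) g j\<bar>)"
proof (rule summable_comparison_test_ev)
  show "eventually (\<lambda>j. norm \<bar>density_coeff TYPE('a) g j\<bar> \<le> c_coeff TYPE('a) j) sequentially"
    using eventually_gt_at_top[of g]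
    by eventually_elim (simp add: density_coeff_def c_coeff_bounds)
  show "summable (c_coeff TYPE('a))" by (rule c_coeff_summable_1)
qed

lemma density_value_eq_series:
  assumes "norm v \<le> 1"
  shows "density_value TYPE('a) g v = 2 * of_real L * (of_nat g + (\<Sum>j. of_real (density_coeff TYPE('a) g j) * v ^ j))"
proof -
  let ?Q = "of_nat CARD('a) :: complex"
  have "summable (\<lambda>j. norm (of_real (c_coeff TYPE('a) j) * v ^ j))"
  proof (rule summable_comparison_test[OF _ c_coeff_summable_1], intro exI allI impI)
    fix j
    have "norm (v ^ j) \<le> 1" using assms by (simp add: norm_power power_le_one)
    then show "norm (norm (of_real (c_coeff TYPE('a) j) * v ^ j)) \<le> c_coeff TYPE('a) j"
      using c_coeff_bounds(1)[where 'a='a, of j] by (simp add: norm_mult mult_left_le)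
  qed
  then have s1: "(\<lambda>j. of_real (c_coeff TYPE('a) j) * v ^ j) sums (\<Sum>j. of_real (c_coeff TYPE('a) j) * v ^ j)"
    by (rule summable_sums[OF summable_norm_cancel])
  have s2: "(\<lambda>j. if j \<in> {1..<g} then v ^ j else 0) sums (\<Sum>j=1..<g. v ^ j)" by (rule sums_If_finite_set) simp
  have s3: "(\<lambda>j. if j = g then ?Q / (?Q - 1) * v ^ j else 0) sums (?Q / (?Q - 1) * v ^ g)" by (rule sums_single)
  have "(\<lambda>j. of_real (density_coeff TYPE('a) g j) * v ^ j) =
     (\<lambda>j. of_real (c_coeff TYPE('a) j) * v ^ j - (if j \<in> {1..<g} then v ^ j else 0) - (if j = g then ?Q / (?Q - 1) * v ^ j else 0))"
    by (rule ext) (simp add: density_coeff_def algebra_simps)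
  with sums_diff[OF sums_diff[OF s1 s2] s3]
  have "(\<Sum>j. of_real (density_coeff TYPE('a) g j) * v ^ j) =
     (\<Sum>j. of_real (c_coeff TYPE('a) j) * v ^ j) - (\<Sum>j=1..<g. v ^ j) - ?Q / (?Q - 1) * v ^ g"
    by (simp add: sums_iff)
  then have "(\<Sum>j. of_real (c_coeff TYPE('a) j) * v ^ j) =
     (\<Sum>j. of_real (density_coeff TYPE('a) g j) * v ^ j) + (\<Sum>j=1..<g. v ^ j) + ?Q / (?Q - 1) * v ^ g"
    by (simp only: algebra_simps)
  then show ?thesis unfolding density_value_def L_def by (simp only: algebra_simps)
qed

text \<open>The cosine consists of the frequencies k and -k. Against frequency -2j with j \<ge> 0
  both survive for k = j = 0, and only one of them for k = 2j > 0; hence the two values.\<close>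

lemma integral_cos_exp:
  "integral {- pi / L..pi / L} (\<lambda>t. cos (of_nat k * of_real L * of_real t) * exp (\<i> * of_int (- 2 * int j) * of_real L * of_real t)) =
     (if k = 0 \<and> j = 0 then of_real (2 * pi / L) else if k = 2 * j then of_real (pi / L) else 0)"
proof -
  have "cos (of_nat k * of_real L * of_real t) * exp (\<i> * of_int (- 2 * int j) * of_real L * of_real t) =
    exp (\<i> * of_int (int k - 2 * int j) * of_real L * of_real t) / 2 + exp (\<i> * of_int (- int k - 2 * int j) * of_real L * of_real t) / 2" for t
  proof -
    have "exp (\<i> * (of_nat k * of_real L * of_real t)) * exp (\<i> * of_int (- 2 * int j) * of_real L * of_real t) =
       exp (\<i> * of_int (int k - 2 * int j) * of_real L * of_real t)"
      "exp (- (\<i> * (of_nat k * of_real L * of_real t))) * exp (\<i> * of_int (- 2 * int j) * of_real L * of_real t) =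
       exp (\<i> * of_int (- int k - 2 * int j) * of_real L * of_real t)"
      unfolding exp_add [symmetric] by (simp_all add: algebra_simps)
    then show ?thesis unfolding cos_exp_eq by (simp add: add_divide_distrib distrib_right)
  qed
  moreover have "((\<lambda>t. exp (\<i> * of_int (int k - 2 * int j) * of_real L * of_real t) / 2 +
      exp (\<i> * of_int (- int k - 2 * int j) * of_real L * of_real t) / 2) has_integral
     ((if int k - 2 * int j = 0 then of_real (2 * pi / L) else 0) / 2 + (if - int k - 2 * int j = 0 then of_real (2 * pi / L) else 0) / 2))
     {- pi / L..pi / L}"
    by (intro has_integral_add has_integral_divide integral_exp_period ln_card_field_pos)
  ultimately show ?thesis by (auto simp: integral_unique)
qed

lemma continuous_density_series: "continuous_on S (density_series TYPE('a) g)"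
proof -
  have "isCont (density_series TYPE('a) g) t" for t
  proof -
    have v: "isCont (\<lambda>t. density_variable CARD('a) (of_real t)) t"
      unfolding density_variable_def by (intro continuous_intros)
    have "isCont (density_value TYPE('a) g) (density_variable CARD('a) (of_real t))"
      unfolding density_value_def [abs_def]
      by (intro continuous_intros isCont_c_series) (simp add: density_variable_def norm_exp_eq_Re)
    from isCont_o2[OF v this] show ?thesis unfolding density_series_def [abs_def] .
  qed
  then show ?thesis by (simp add: continuous_at_imp_continuous_on)
qed

text \<open>Orthogonality, applied termwise to the absolutely convergent series. The summand g meets
  only k = 0, where the coefficient of v^0 is itself 0.\<close>

lemma integral_cos_density:
  assumes g: "g \<ge> 1"
  shows "integral {- pi / L..pi / L} (\<lambda>t. cos (of_nat k * of_real L * of_real t) * density_series TYPE('a) g t) =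
     2 * of_real pi * (if k = 0 then 2 * of_nat g else if even k then of_real (density_coeff TYPE('a) g (k div 2)) else 0)"
proof -
  let ?I = "{- pi / L..pi / L}" and ?d = "\<lambda>j. complex_of_real (density_coeff TYPE('a) g j)"
  let ?cos = "\<lambda>t. cos (of_nat k * of_real L * of_real t) :: complex"
  let ?e = "\<lambda>j t. exp (\<i> * of_int (- 2 * int j) * of_real L * of_real t)"
  have nv: "norm (density_variable CARD('a) (of_real t)) \<le> 1" for t
    by (simp add: density_variable_def norm_exp_eq_Re)
  have ncos: "norm (?cos t) \<le> 1" for t
  proof -
    have "?cos t = of_real (cos (real k * L * t))" by (simp flip: cos_of_real)
    then show ?thesis by simp
  qed
  have ne: "norm (?e j t) = 1" for j t by (simp add: norm_exp_eq_Re)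
  have bound: "norm (?cos t * (?d j * ?e j t)) \<le> \<bar>density_coeff TYPE('a) g j\<bar>" for j t
    unfolding norm_mult ne using ncos[of t] by (simp add: mult_left_le_one_le)
  have sd: "summable (\<lambda>j. ?d j * ?e j t)" for t
    by (rule summable_norm_cancel, rule summable_comparison_test[OF _ density_coeff_summable[of g]])
       (auto simp: norm_mult ne)
  have ser: "(\<lambda>j. integral ?I (\<lambda>t. ?cos t * (?d j * ?e j t))) sums integral ?I (\<lambda>t. \<Sum>j. ?cos t * (?d j * ?e j t))"
    by (rule integral_sums_Weierstrass[OF _ bound density_coeff_summable]) (intro continuous_intros)
  have split: "?cos t * density_series TYPE('a) g t = 2 * of_real L * (of_nat g * (?cos t * ?e 0 t) + (\<Sum>j. ?cos t * (?d j * ?e j t)))" for t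
  proof -
    have "density_series TYPE('a) g t = 2 * of_real L * (of_nat g + (\<Sum>j. ?d j * ?e j t))"
      unfolding density_series_def density_value_eq_series[OF nv] density_variable_power ..
    then show ?thesis using suminf_mult[OF sd[of t], of "?cos t"] by (simp add: algebra_simps)
  qed
  let ?J = "\<lambda>j. (if k = 0 \<and> j = 0 then of_real (2 * pi / L) else if k = 2 * j then of_real (pi / L) else 0) :: complex"
  have Jd: "integral ?I (\<lambda>t. ?cos t * (?d j * ?e j t)) = ?d j * ?J j" for j
  proof -
    have "integral ?I (\<lambda>t. ?cos t * (?d j * ?e j t)) = integral ?I (\<lambda>t. ?d j * (?cos t * ?e j t))"
      by (simp only: mult.left_commute)
    then show ?thesis by (simp only: integral_mult_right integral_cos_exp)
  qed
  have d0: "?d 0 = 0" using g by (simp add: density_coeff_def c_coeff_def)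
  have "(\<lambda>j. ?d j * ?J j) = (\<lambda>j. if j = k div 2 then (if k = 0 then 0 else if even k then ?d j * of_real (pi / L) else 0) else 0)"
  proof
    fix j show "?d j * ?J j = (if j = k div 2 then (if k = 0 then 0 else if even k then ?d j * of_real (pi / L) else 0) else 0)"
      using d0 by (cases "j = 0") auto
  qed
  then have "(\<lambda>j. ?d j * ?J j) sums (if k = 0 then 0 else if even k then ?d (k div 2) * of_real (pi / L) else 0)"
    using sums_single[of "k div 2" "\<lambda>j. if k = 0 then 0 else if even k then ?d j * of_real (pi / L) else 0"] by simp
  then have tot: "integral ?I (\<lambda>t. \<Sum>j. ?cos t * (?d j * ?e j t)) = (if k = 0 then 0 else if even k then ?d (k div 2) * of_real (pi / L) else 0)"
    using ser unfolding Jd using sums_unique2 by blast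
  have eqs: "(\<Sum>j. ?cos t * (?d j * ?e j t)) = ?cos t * density_series TYPE('a) g t / (2 * of_real L) - of_nat g * (?cos t * ?e 0 t)" for t
    unfolding split using ln_card_field_pos by simp
  have c1: "(\<lambda>t. \<Sum>j. ?cos t * (?d j * ?e j t)) integrable_on ?I"
    unfolding eqs using ln_card_field_pos by (intro integrable_continuous_real continuous_intros continuous_density_series) auto
  have c0: "(\<lambda>t. of_nat g * (?cos t * ?e 0 t)) integrable_on ?I" by (intro integrable_continuous_real continuous_intros)
  have "integral ?I (\<lambda>t. ?cos t * density_series TYPE('a) g t) =
     2 * of_real L * (of_nat g * integral ?I (\<lambda>t. ?cos t * ?e 0 t) + integral ?I (\<lambda>t. \<Sum>j. ?cos t * (?d j * ?e j t)))"
    unfolding split integral_mult_right integral_add[OF c0 c1] ..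
  also have "\<dots> = 2 * of_real L * (of_nat g * ?J 0 + (if k = 0 then 0 else if even k then ?d (k div 2) * of_real (pi / L) else 0))"
    unfolding tot integral_cos_exp ..
  also have "\<dots> = 2 * of_real pi * (if k = 0 then 2 * of_nat g else if even k then ?d (k div 2) else 0)"
    using ln_card_field_pos by auto
  finally show ?thesis .
qed

end

text \<open>The difference of the two sides for a test function, with the zeros indexed by the roots
  of \<open>Lpoly D\<close>. The density no longer depends on D, so the sum over the family has
  become its cardinality.\<close>

definition discrepancy :: "'a::{finite,field_gcd} itself \<Rightarrow> nat \<Rightarrow> (complex \<Rightarrow> complex) \<Rightarrow> complex" where
  "discrepancy T g \<phi> = (\<Sum>D\<in>(hyp_family g :: 'a poly set). \<Sum>\<rho>\<in>#proots (Lpoly D). \<phi> (ordinate CARD('a) \<rho>))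
     - of_nat (card (hyp_family g :: 'a poly set)) / (2 * of_real pi) *
       integral {- pi / ln (real CARD('a))..pi / ln (real CARD('a))} (\<lambda>t. \<phi> (of_real t) * density_series T g t)"

context
  fixes L q :: real
  assumes odd_card: "odd CARD('a::{finite,field_gcd})"
  defines "L \<equiv> ln (real CARD('a))" and "q \<equiv> real CARD('a)"
begin

lemma powr_neg_half_le_1: "q powr (- real k / 2) \<le> 1"
  using powr_mono[of "- real k / 2" 0 q] card_field_gt_1[where 'a='a] by (simp add: q_def)

lemma norm_divide_power_q: "norm (z / complex_of_real (q ^ n)) = norm z / q ^ n"
  unfolding norm_divide norm_of_real by (simp add: q_def)

lemma density_coeff_bound: "\<bar>density_coeff TYPE('a) g j\<bar> \<le> 3"
proof -
  have "q / (q - 1) \<le> 2" "q / (q - 1) \<ge> 0"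
    using card_field_gt_1[where 'a='a] by (simp_all add: q_def field_simps)
  then show ?thesis
    using c_coeff_bounds[where 'a='a, of j] unfolding density_coeff_def q_def [symmetric] by (auto simp: abs_le_iff)
qed

lemma card_hyp_family_le: "real (card (hyp_family g :: 'a poly set)) \<le> q ^ (2 * g + 1)"
  using card_sqfree_monics_le[where 'a='a, of "2 * g + 1"]
  unfolding hyp_family_eq q_def of_nat_power [symmetric] of_nat_le_iff .

lemma discrepancy_linear:
  assumes \<phi>: "continuous_on UNIV \<phi>" and \<psi>: "continuous_on UNIV \<psi>"
  shows "discrepancy TYPE('a) g (\<lambda>z. a * \<phi> z + b * \<psi> z) = a * discrepancy TYPE('a) g \<phi> + b * discrepancy TYPE('a) g \<psi>"
proof -
  have int: "(\<lambda>t. h (of_real t) * density_series TYPE('a) g t) integrable_on {- pi / L..pi / L}"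
    if h: "continuous_on UNIV h" for h :: "complex \<Rightarrow> complex"
  proof -
    have "continuous_on {- pi / L..pi / L} (\<lambda>t. h (of_real t))"
      by (rule continuous_on_compose2[OF h]) auto
    then show ?thesis by (intro integrable_continuous_real continuous_intros continuous_density_series[OF odd_card])
  qed
  have "integral {- pi / L..pi / L} (\<lambda>t. (a * \<phi> (of_real t) + b * \<psi> (of_real t)) * density_series TYPE('a) g t) =
      integral {- pi / L..pi / L} (\<lambda>t. a * (\<phi> (of_real t) * density_series TYPE('a) g t) + b * (\<psi> (of_real t) * density_series TYPE('a) g t))"
    by (simp only: distrib_right mult.assoc)
  also have "\<dots> = a * integral {- pi / L..pi / L} (\<lambda>t. \<phi> (of_real t) * density_series TYPE('a) g t)
      + b * integral {- pi / L..pi / L} (\<lambda>t. \<psi> (of_real t) * density_series TYPE('a) g t)"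
    unfolding integral_mult_right [symmetric]
    by (rule integral_add) (intro integrable_on_mult_right int \<phi> \<psi>)+
  finally show ?thesis
    unfolding discrepancy_def L_def [symmetric]
    by (simp add: sum_mset.distrib sum.distrib sum_mset_distrib_left sum_distrib_left algebra_simps)
qed

text \<open>The constant function counts 2g zeros for each D, and this is exactly the mean of the
  density.\<close>

lemma discrepancy_cos_0:
  assumes "g \<ge> 1"
  shows "discrepancy TYPE('a) g (\<lambda>z. cos (of_nat 0 * of_real L * z)) = 0"
proof -
  have "(\<Sum>D\<in>(hyp_family g :: 'a poly set). \<Sum>\<rho>\<in>#proots (Lpoly D). cos (of_nat 0 * of_real L * ordinate CARD('a) \<rho>)) =
     (\<Sum>D\<in>(hyp_family g :: 'a poly set). of_nat (2 * g))"
    by (intro sum.cong refl) (simp add: size_proots_Lpoly[OF odd_card])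
  then show ?thesis
    unfolding discrepancy_def L_def [symmetric] L_def [THEN meta_eq_to_obj_eq, symmetric]
      integral_cos_density[OF odd_card assms, folded L_def] by simp
qed

lemma discrepancy_cos:
  assumes "g \<ge> 1" "k \<ge> 1"
  shows "discrepancy TYPE('a) g (\<lambda>z. cos (of_nat k * of_real L * z)) =
     - of_real (q powr (- real k / 2)) * (\<Sum>D\<in>(hyp_family g :: 'a poly set). vm_coeff (\<lambda>f. of_int (chi D f)) k)
     - of_nat (card (hyp_family g :: 'a poly set)) * (if even k then of_real (density_coeff TYPE('a) g (k div 2)) else 0)"
proof -
  have "(\<Sum>D\<in>(hyp_family g :: 'a poly set). \<Sum>\<rho>\<in>#proots (Lpoly D). cos (of_nat k * of_real L * ordinate CARD('a) \<rho>)) =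
     (\<Sum>D\<in>(hyp_family g :: 'a poly set). - of_real (q powr (- real k / 2)) * vm_coeff (\<lambda>f. of_int (chi D f)) k)"
    unfolding L_def q_def by (intro sum.cong refl sum_cos_ordinates[OF odd_card _ assms(2)])
  then show ?thesis
    using assms(2) unfolding discrepancy_def L_def [symmetric] integral_cos_density[OF odd_card assms(1), folded L_def]
    by (simp add: sum_distrib_left)
qed

text \<open>A bound uniform in g; the 4 is 1 for the zeros and 3 for the density. The growth in k is
  only geometric, which suffices for dominating the cosine series.\<close>

lemma norm_discrepancy_cos_le:
  assumes g: "g \<ge> 1"
  shows "norm (discrepancy TYPE('a) g (\<lambda>z. cos (of_nat k * of_real L * z))) \<le> 4 * q ^ k * q ^ (2 * g + 1)"
proof (cases "k = 0")
  case True
  then show ?thesis using discrepancy_cos_0[OF g] by (simp add: q_def)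
next
  case False
  then have k: "k \<ge> 1" by simp
  let ?H = "hyp_family g :: 'a poly set"
  have q1: "q > 1" using card_field_gt_1[where 'a='a] by (simp add: q_def)
  have "norm (\<Sum>D\<in>?H. vm_coeff (\<lambda>f. of_int (chi D f) :: complex) k) \<le> (\<Sum>D\<in>?H. q ^ k)"
    unfolding q_def by (intro sum_norm_le norm_vm_coeff_chi_le k)
  also have "\<dots> \<le> q ^ (2 * g + 1) * q ^ k"
    using card_hyp_family_le[of g] q1 by (simp add: mult_right_mono)
  finally have "norm (\<Sum>D\<in>?H. vm_coeff (\<lambda>f. of_int (chi D f) :: complex) k) \<le> q ^ (2 * g + 1) * q ^ k" .
  then have "q powr (- real k / 2) * norm (\<Sum>D\<in>?H. vm_coeff (\<lambda>f. of_int (chi D f) :: complex) k) \<le> 1 * (q ^ (2 * g + 1) * q ^ k)"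
    by (intro mult_mono powr_neg_half_le_1) auto
  then have 1: "norm (- of_real (q powr (- real k / 2)) * (\<Sum>D\<in>?H. vm_coeff (\<lambda>f. of_int (chi D f) :: complex) k)) \<le> q ^ (2 * g + 1) * q ^ k"
    by (simp add: norm_mult)
  have "norm (of_nat (card ?H) * (if even k then of_real (density_coeff TYPE('a) g (k div 2)) else 0) :: complex) \<le> real (card ?H) * 3"
    using density_coeff_bound[of g "k div 2"] by (auto simp: norm_mult intro!: mult_left_mono)
  also have "\<dots> \<le> q ^ (2 * g + 1) * (3 * q ^ k)"
    using card_hyp_family_le[of g] q1 by (intro mult_mono) auto
  finally have 2: "norm (of_nat (card ?H) * (if even k then of_real (density_coeff TYPE('a) g (k div 2)) else 0) :: complex) \<le> q ^ (2 * g + 1) * (3 * q ^ k)" .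
  show ?thesis
    unfolding discrepancy_cos[OF g k] by (rule order_trans[OF norm_triangle_ineq4 order_trans[OF add_mono[OF 1 2]]]) (simp add: algebra_simps)
qed

text \<open>For g > k the index k/2 lies below g, so the coefficient is c_j - 1 with j = k/2. It
  cancels the mean value q^j (1 - c_j) of the von Mangoldt coefficient exactly, since q^(-k/2) q^j =
  1. A bounded error remains.\<close>

lemma discrepancy_cos_tendsto:
  "(\<lambda>g. discrepancy TYPE('a) g (\<lambda>z. cos (of_nat k * of_real L * z)) / of_real (q ^ (2 * g + 1))) \<longlonglongrightarrow> 0"
proof (cases "k = 0")
  case True
  have "eventually (\<lambda>g. 0 = discrepancy TYPE('a) g (\<lambda>z. cos (of_nat k * of_real L * z)) / of_real (q ^ (2 * g + 1))) sequentially"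
    using eventually_ge_at_top[of 1] by eventually_elim (use True discrepancy_cos_0 in simp)
  then show ?thesis by (rule Lim_transform_eventually[OF tendsto_const])
next
  case False
  then have k: "k \<ge> 1" by simp
  have q1: "q > 1" using card_field_gt_1[where 'a='a] by (simp add: q_def)
  let ?d = "\<lambda>g. discrepancy TYPE('a) g (\<lambda>z. cos (of_nat k * of_real L * z))"
  obtain C where C: "\<And>n. norm ((\<Sum>D\<in>(sqfree_monics n :: 'a poly set). vm_coeff (\<lambda>f. of_int (chi D f) :: complex) k)
     - of_real (vm_mean TYPE('a) k * real (card (sqfree_monics n :: 'a poly set)))) \<le> C"
    using sum_vm_coeff_bounded[OF odd_card k] by blast
  have "norm (?d g) \<le> C" if g: "g > k" for g
  proof -
    let ?H = "hyp_family g :: 'a poly set"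
    let ?S = "\<Sum>D\<in>?H. vm_coeff (\<lambda>f. of_int (chi D f) :: complex) k"
    have eq: "?d g = - of_real (q powr (- real k / 2)) * (?S - of_real (vm_mean TYPE('a) k * real (card ?H)))"
    proof (cases "even k")
      case True
      then obtain j where j: "k = 2 * j" by blast
      have d: "density_coeff TYPE('a) g j = c_coeff TYPE('a) j - 1" using j k g by (simp add: density_coeff_def)
      have p: "complex_of_real (q powr (- real k / 2)) * of_real q ^ j = 1"
        using q1 by (simp add: j powr_minus powr_realpow flip: of_real_power of_real_mult)
      have "?d g = - of_real (q powr (- real k / 2)) * ?S - of_nat (card ?H) * (of_real (c_coeff TYPE('a) j) - 1)"
        using discrepancy_cos[of g k] g k d j by simp
      moreover have "of_real (vm_mean TYPE('a) k * real (card ?H)) = of_real q ^ j * (1 - complex_of_real (c_coeff TYPE('a) j)) * of_nat (card ?H)"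
        using vm_mean_even[where 'a='a, of j] k by (simp add: j q_def)
      moreover have "- a * S - n * (c - 1) = - a * (S - b * (1 - c) * n)" if "a * b = 1" for a b c n S :: complex
      proof -
        have "- a * (S - b * (1 - c) * n) = - a * S + (a * b) * (1 - c) * n" by (simp add: algebra_simps)
        then show ?thesis using that by (simp add: algebra_simps)
      qed
      ultimately show ?thesis using p by (simp only:)
    next
      case False
      then show ?thesis using discrepancy_cos[of g k] g k vm_mean_odd[where 'a='a, of k] by simp
    qed
    have "norm (?d g) = q powr (- real k / 2) * norm (?S - of_real (vm_mean TYPE('a) k * real (card ?H)))"
      unfolding eq by (simp add: norm_mult)
    also have "\<dots> \<le> 1 * C" using C[of "2 * g + 1"] unfolding hyp_family_eq
      by (intro mult_mono powr_neg_half_le_1) auto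
    finally show ?thesis by simp
  qed
  then have "eventually (\<lambda>g. norm (?d g / of_real (q ^ (2 * g + 1))) \<le> C * inverse q ^ (2 * g + 1)) sequentially"
    unfolding norm_divide_power_q power_inverse divide_inverse [symmetric]
    using eventually_gt_at_top[of k] q1 by (elim eventually_mono) (intro divide_right_mono, auto)
  moreover have "(\<lambda>g. C * inverse q ^ (2 * g + 1)) \<longlonglongrightarrow> 0"
  proof -
    have "(\<lambda>n. inverse q ^ n) \<longlonglongrightarrow> 0" using q1 by (intro LIMSEQ_power_zero) (simp add: field_simps)
    then have "(\<lambda>g. inverse q ^ (2 * g + 1)) \<longlonglongrightarrow> 0"
      by (rule LIMSEQ_subseq_LIMSEQ[of _ _ "\<lambda>g. 2 * g + 1", unfolded o_def]) (auto simp: strict_mono_def)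
    then show ?thesis by (rule tendsto_mult_right_zero)
  qed
  ultimately show ?thesis by (rule Lim_null_comparison)
qed

text \<open>The series is in powers of the cosine, while the estimates are for multiple angles. The
  extra factor cos(k L z) makes the induction work: a product of two cosines is the mean of the
  frequencies k + 1 and k - 1, and both the bound and the limit pass to means.\<close>

lemma discrepancy_cos_power:
  "(\<forall>g\<ge>1. norm (discrepancy TYPE('a) g (\<lambda>z. cos (of_real L * z) ^ n * cos (of_nat k * of_real L * z))) \<le> 4 * q ^ (n + k) * q ^ (2 * g + 1)) \<and>
   (\<lambda>g. discrepancy TYPE('a) g (\<lambda>z. cos (of_real L * z) ^ n * cos (of_nat k * of_real L * z)) / of_real (q ^ (2 * g + 1))) \<longlonglongrightarrow> 0"
proof (induction n arbitrary: k)
  case 0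
  then show ?case using norm_discrepancy_cos_le[of _ k] discrepancy_cos_tendsto[of k] by simp
next
  case (Suc n)
  have q1: "q > 1" using card_field_gt_1[where 'a='a] by (simp add: q_def)
  let ?\<phi> = "\<lambda>n k z. cos (of_real L * z) ^ n * cos (of_nat k * of_real L * z) :: complex"
  show ?case
  proof (cases k)
    case 0
    \<comment> \<open>For k = 0 there is no frequency k - 1; one power of the cosine is read as
      frequency 1 instead.\<close>
    have "?\<phi> (Suc n) 0 = ?\<phi> n 1" by (simp add: fun_eq_iff)
    then show ?thesis using Suc.IH[of 1] unfolding 0 by simp
  next
    case (Suc m)
    let ?d = "\<lambda>n k g. discrepancy TYPE('a) g (?\<phi> n k)"
    have cos2: "cos w * cos v = 1 / 2 * cos (w + v) + 1 / 2 * cos (w - v)" for w v :: complex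
      by (simp add: cos_times_cos add_divide_distrib)
    have fun_eq: "?\<phi> (Suc n) (Suc m) = (\<lambda>z. 1 / 2 * ?\<phi> n (Suc (Suc m)) z + 1 / 2 * ?\<phi> n m z)"
    proof
      fix z :: complex
      have "of_nat (Suc m) * of_real L * z + of_real L * z = of_nat (Suc (Suc m)) * of_real L * z"
        "of_nat (Suc m) * of_real L * z - of_real L * z = of_nat m * of_real L * z"
        by (simp_all add: algebra_simps)
      with cos2[where w = "of_nat (Suc m) * of_real L * z" and v = "of_real L * z"]
      have "cos (of_nat (Suc m) * of_real L * z) * cos (of_real L * z) =
        1 / 2 * cos (of_nat (Suc (Suc m)) * of_real L * z) + 1 / 2 * cos (of_nat m * of_real L * z)" by (simp only:)
      then have "cos (of_real L * z) ^ n * (cos (of_nat (Suc m) * of_real L * z) * cos (of_real L * z)) =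
        cos (of_real L * z) ^ n * (1 / 2 * cos (of_nat (Suc (Suc m)) * of_real L * z) + 1 / 2 * cos (of_nat m * of_real L * z))" by (simp only:)
      then show "?\<phi> (Suc n) (Suc m) z = 1 / 2 * ?\<phi> n (Suc (Suc m)) z + 1 / 2 * ?\<phi> n m z"
        by (simp only: power_Suc distrib_left mult_ac)
    qed
    have d: "?d (Suc n) (Suc m) g = 1 / 2 * ?d n (Suc (Suc m)) g + 1 / 2 * ?d n m g" for g
      unfolding fun_eq by (rule discrepancy_linear) (intro continuous_intros)+
    have "norm (?d (Suc n) (Suc m) g) \<le> 4 * q ^ (Suc n + Suc m) * q ^ (2 * g + 1)" if g: "g \<ge> 1" for g
    proof -
      have "norm (?d (Suc n) (Suc m) g) \<le> 1 / 2 * norm (?d n (Suc (Suc m)) g) + 1 / 2 * norm (?d n m g)"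
        unfolding d by (rule order_trans[OF norm_triangle_ineq]) (simp add: norm_mult)
      also have "\<dots> \<le> 1 / 2 * (4 * q ^ (n + Suc (Suc m)) * q ^ (2 * g + 1)) + 1 / 2 * (4 * q ^ (n + m) * q ^ (2 * g + 1))"
        using Suc.IH[of "Suc (Suc m)"] Suc.IH[of m] g by (intro add_mono mult_left_mono) auto
      also have "\<dots> \<le> 1 / 2 * (4 * q ^ (n + Suc (Suc m)) * q ^ (2 * g + 1)) + 1 / 2 * (4 * q ^ (n + Suc (Suc m)) * q ^ (2 * g + 1))"
        using q1 by (intro add_mono mult_left_mono mult_right_mono power_increasing) auto
      also have "\<dots> = 4 * q ^ (Suc n + Suc m) * q ^ (2 * g + 1)" by (simp add: algebra_simps)
      finally show ?thesis .
    qed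
    moreover have "(\<lambda>g. ?d (Suc n) (Suc m) g / of_real (q ^ (2 * g + 1))) \<longlonglongrightarrow> 0"
    proof -
      have "(\<lambda>g. 1 / 2 * (?d n (Suc (Suc m)) g / of_real (q ^ (2 * g + 1))) + 1 / 2 * (?d n m g / of_real (q ^ (2 * g + 1)))) \<longlonglongrightarrow> 1 / 2 * 0 + 1 / 2 * 0"
        using Suc.IH[of "Suc (Suc m)"] Suc.IH[of m] by (intro tendsto_intros) auto
      then show ?thesis unfolding d by (simp add: add_divide_distrib)
    qed
    ultimately show ?thesis unfolding Suc by blast
  qed
qed

text \<open>On the side of the zeros the sums are finite and convergence of the series at each
  ordinate, real or not, suffices. On the side of the integral the real cosine is bounded by 1 and
  the continuous density is bounded on the period.\<close>

lemma discrepancy_sums: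
  assumes c: "summable (\<lambda>n. norm (c n))" and f: "\<And>z. (\<lambda>n. c n * cos (of_real L * z) ^ n) sums f z"
  shows "(\<lambda>n. c n * discrepancy TYPE('a) g (\<lambda>z. cos (of_real L * z) ^ n)) sums discrepancy TYPE('a) g f"
proof -
  let ?I = "{- pi / L..pi / L}" and ?H = "hyp_family g :: 'a poly set"
  have "compact (density_series TYPE('a) g ` ?I)"
    by (intro compact_continuous_image continuous_density_series[OF odd_card]) simp
  then have "bounded (density_series TYPE('a) g ` ?I)" by (rule compact_imp_bounded)
  then obtain B where B: "\<And>t. t \<in> ?I \<Longrightarrow> norm (density_series TYPE('a) g t) \<le> B"
    unfolding bounded_iff by blast
  have "0 \<in> ?I" using ln_card_field_pos[where 'a='a] by (simp add: L_def)
  then have B0: "B \<ge> 0" using B[of 0] norm_ge_zero order_trans by blast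
  have cos1: "norm (cos (of_real L * of_real t :: complex)) \<le> 1" for t
    unfolding of_real_mult [symmetric] cos_of_real by simp
  have "(\<lambda>n. integral ?I (\<lambda>t. c n * cos (of_real L * of_real t) ^ n * density_series TYPE('a) g t)) sums
      integral ?I (\<lambda>t. \<Sum>n. c n * cos (of_real L * of_real t) ^ n * density_series TYPE('a) g t)"
  proof (rule integral_sums_Weierstrass)
    show "continuous_on ?I (\<lambda>t. c n * cos (of_real L * of_real t) ^ n * density_series TYPE('a) g t)" for n
      by (intro continuous_intros continuous_density_series[OF odd_card])
    show "summable (\<lambda>n. norm (c n) * B)" using c by (rule summable_mult2)
    show "norm (c n * cos (of_real L * of_real t) ^ n * density_series TYPE('a) g t) \<le> norm (c n) * B" if "t \<in> ?I" for n t
    proof -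
      have "norm (cos (of_real L * of_real t :: complex)) ^ n * norm (density_series TYPE('a) g t) \<le> 1 * B"
        using B[OF that] cos1[of t] B0 by (intro mult_mono power_le_one) auto
      then show ?thesis unfolding norm_mult norm_power mult.assoc by (intro mult_left_mono) auto
    qed
  qed
  moreover have "(\<Sum>n. c n * cos (of_real L * of_real t) ^ n * density_series TYPE('a) g t) = f (of_real t) * density_series TYPE('a) g t" for t
    using sums_unique[OF sums_mult2[OF f[of "of_real t"]]] by simp
  ultimately have 1: "(\<lambda>n. c n * integral ?I (\<lambda>t. cos (of_real L * of_real t) ^ n * density_series TYPE('a) g t)) sums
      integral ?I (\<lambda>t. f (of_real t) * density_series TYPE('a) g t)"
    by (simp only: mult.assoc integral_mult_right)
  have "(\<lambda>n. \<Sum>D\<in>?H. \<Sum>\<rho>\<in>#proots (Lpoly D). c n * cos (of_real L * ordinate CARD('a) \<rho>) ^ n) sums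
     (\<Sum>D\<in>?H. \<Sum>\<rho>\<in>#proots (Lpoly D). f (ordinate CARD('a) \<rho>))"
    by (intro sums_sum sums_sum_mset f)
  then have 2: "(\<lambda>n. c n * (\<Sum>D\<in>?H. \<Sum>\<rho>\<in>#proots (Lpoly D). cos (of_real L * ordinate CARD('a) \<rho>) ^ n)) sums
     (\<Sum>D\<in>?H. \<Sum>\<rho>\<in>#proots (Lpoly D). f (ordinate CARD('a) \<rho>))"
    by (simp only: sum_distrib_left sum_mset_distrib_left)
  have "(\<lambda>n. c n * (\<Sum>D\<in>?H. \<Sum>\<rho>\<in>#proots (Lpoly D). cos (of_real L * ordinate CARD('a) \<rho>) ^ n)
      - of_nat (card ?H) / (2 * of_real pi) * (c n * integral ?I (\<lambda>t. cos (of_real L * of_real t) ^ n * density_series TYPE('a) g t)))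
     sums discrepancy TYPE('a) g f"
    using sums_diff[OF 2 sums_mult[OF 1, of "of_nat (card ?H) / (2 * of_real pi)"]]
    unfolding discrepancy_def L_def .
  then show ?thesis
    unfolding discrepancy_def [of "TYPE('a)" g "\<lambda>z. cos (of_real L * z) ^ n" for n] L_def [symmetric]
    by (simp only: right_diff_distrib mult_ac)
qed

text \<open>Tannery's theorem: every term tends to 0 after division by |D|, and the majorant 4 |c_n|
  q^n, valid for all g \<ge> 1, is summable.\<close>

lemma discrepancy_tendsto:
  assumes c: "summable (\<lambda>n. norm (c n) * q ^ n)" and f: "\<And>z. (\<lambda>n. c n * cos (of_real L * z) ^ n) sums f z"
  shows "(\<lambda>g. discrepancy TYPE('a) g f / of_real (q ^ (2 * g + 1))) \<longlonglongrightarrow> 0"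
proof -
  have q1: "q > 1" using card_field_gt_1[where 'a='a] by (simp add: q_def)
  have "norm (norm (c n)) \<le> norm (c n) * q ^ n" for n
    using q1 mult_left_mono[of 1 "q ^ n" "norm (c n)"] by (simp add: one_le_power)
  then have c1: "summable (\<lambda>n. norm (c n))" by (intro summable_comparison_test[OF _ c]) blast
  let ?d = "\<lambda>n g. discrepancy TYPE('a) g (\<lambda>z. cos (of_real L * z) ^ n)"
  let ?a = "\<lambda>n g. c n * (?d n g / of_real (q ^ (2 * g + 1)))"
  have sum_eq: "(\<Sum>n. ?a n g) = discrepancy TYPE('a) g f / of_real (q ^ (2 * g + 1))" for g
    using sums_divide[OF discrepancy_sums[OF c1 f, of g], of "of_real (q ^ (2 * g + 1))"]
    by (simp add: sums_iff)
  have lim: "(\<lambda>g. ?a n g) \<longlonglongrightarrow> 0" for n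
    using discrepancy_cos_power[of n 0] by (intro tendsto_mult_right_zero) simp
  have bound: "norm (?a n g) \<le> 4 * (norm (c n) * q ^ n)" if "g \<ge> 1" for n g
  proof -
    have "norm (?d n g) \<le> 4 * q ^ n * q ^ (2 * g + 1)" using discrepancy_cos_power[of n 0] that by simp
    then have "norm (?d n g / of_real (q ^ (2 * g + 1))) \<le> 4 * q ^ n"
      unfolding norm_divide_power_q using q1 by (simp add: divide_le_eq)
    from mult_left_mono[OF this, of "norm (c n)"] show ?thesis unfolding norm_mult by (simp add: mult_ac)
  qed
  have "eventually (\<lambda>(n, g). norm (?a n g) \<le> 4 * (norm (c n) * q ^ n)) (at_top \<times>\<^sub>F sequentially)"
    unfolding eventually_prod_filter
    by (rule exI[of _ "\<lambda>_. True"], rule exI[of _ "\<lambda>g. g \<ge> 1"]) (intro conjI allI impI eventually_ge_at_top eventually_True, unfold prod.case, rule bound)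
  from tannerys_theorem[OF lim this summable_mult[OF c]]
  show ?thesis unfolding sum_eq by simp
qed

end

theorem theorem3:
  fixes q :: nat and f :: "complex \<Rightarrow> complex"
  assumes q_card: "CARD('a::{finite,field_gcd}) = q"
    and q_odd: "odd q"
    and ratios: "\<forall>c C \<epsilon> :: real. c > 0 \<longrightarrow> C > 0 \<longrightarrow> \<epsilon> > 0 \<longrightarrow>
      (\<forall>\<delta>>0. \<forall>\<^sub>F g in sequentially. \<forall>\<alpha> \<gamma> :: complex.
         - 1 / 4 < Re \<alpha> \<longrightarrow> Re \<alpha> < 1 / 4 \<longrightarrow>
         c / ln (real q ^ (2 * g + 1)) \<le> Re \<gamma> \<longrightarrow> Re \<gamma> < 1 / 4 \<longrightarrow>
         \<bar>Im \<alpha>\<bar> \<le> C * (real q ^ (2 * g + 1)) powr (1 - \<epsilon>) \<longrightarrow>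
         \<bar>Im \<gamma>\<bar> \<le> C * (real q ^ (2 * g + 1)) powr (1 - \<epsilon>) \<longrightarrow>
         norm ((\<Sum>D\<in>(hyp_family g :: 'a poly set). Lfun D (1 / 2 + \<alpha>) / Lfun D (1 / 2 + \<gamma>))
               - (\<Sum>D\<in>(hyp_family g :: 'a poly set). ratios_main D \<alpha> \<gamma>))
           \<le> \<delta> * real q ^ (2 * g + 1))"
    and f_holo: "f holomorphic_on UNIV"
    and f_even: "\<And>z. f (- z) = f z"
    and f_periodic: "\<And>z. f (z + of_real (2 * pi / ln (real q))) = f z"
  shows "(\<lambda>g. (\<Sum>D\<in>(hyp_family g :: 'a poly set). \<Sum>\<gamma>\<in>ordinates D.
                  of_int (zorder (Lfun D) (1 / 2 + \<i> * \<gamma>)) * f \<gamma>)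
              - 1 / (2 * of_real pi) *
                  integral {- pi / ln (real q) .. pi / ln (real q)}
                    (\<lambda>t. f (of_real t) * (\<Sum>D\<in>(hyp_family g :: 'a poly set). zero_density D (of_real t))))
         \<in> o(\<lambda>g. of_real (real q ^ (2 * g + 1)))"
proof -
  define L where "L = ln (real q)"
  have L: "L > 0" using ln_card_field_pos[where 'a='a] q_odd by (simp add: L_def q_card)
  have odd_card: "odd CARD('a)" using q_odd q_card by simp
  obtain c where c: "\<And>R. summable (\<lambda>n. norm (c n) * R ^ n)"
    and f: "\<And>z. (\<lambda>n. c n * cos (of_real L * z) ^ n) sums f z"
    using even_periodic_cos_series[OF L f_holo f_even] f_periodic unfolding L_def by blast
  \<comment> \<open>Only g \<ge> 1 is considered, as the series form of the density is available in
    this range.\<close>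
  have "eventually (\<lambda>g. discrepancy TYPE('a) g f / of_real (real q ^ (2 * g + 1)) =
      ((\<Sum>D\<in>(hyp_family g :: 'a poly set). \<Sum>\<gamma>\<in>ordinates D.
          of_int (zorder (Lfun D) (1 / 2 + \<i> * \<gamma>)) * f \<gamma>)
        - 1 / (2 * of_real pi) * integral {- pi / ln (real q) .. pi / ln (real q)}
            (\<lambda>t. f (of_real t) * (\<Sum>D\<in>(hyp_family g :: 'a poly set). zero_density D (of_real t))))
       / of_real (real q ^ (2 * g + 1))) sequentially"
    using eventually_ge_at_top[of 1]
  proof eventually_elim
    case (elim g)
    let ?H = "hyp_family g :: 'a poly set"
    have "(\<Sum>D\<in>?H. \<Sum>\<gamma>\<in>ordinates D. of_int (zorder (Lfun D) (1 / 2 + \<i> * \<gamma>)) * f \<gamma>) =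
        (\<Sum>D\<in>?H. \<Sum>\<rho>\<in>#proots (Lpoly D). f (ordinate CARD('a) \<rho>))"
      by (intro sum.cong refl sum_ordinates_eq[OF odd_card])
    moreover have "(\<Sum>D\<in>?H. zero_density D (of_real t)) = of_nat (card ?H) * density_series TYPE('a) g t" for t
      using elim by (simp add: zero_density_eq density_series_def)
    ultimately show ?case
      unfolding discrepancy_def q_card by (simp add: mult.left_commute[of "f _"])
  qed
  moreover have "(\<lambda>g. discrepancy TYPE('a) g f / of_real (real q ^ (2 * g + 1))) \<longlonglongrightarrow> 0"
    using discrepancy_tendsto[OF odd_card c f[unfolded L_def q_card [symmetric]]] unfolding q_card .
  moreover have "eventually (\<lambda>g. complex_of_real (real q ^ (2 * g + 1)) \<noteq> 0) sequentially"
    using q_card by (intro always_eventually) auto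
  ultimately show ?thesis
    by (intro smalloI_tendsto) (rule Lim_transform_eventually)
qed

end
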